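(* For every positive integer $d$, the moduli space $\widetilde{Mp}_{0,2}(\mathbb{P}(1,1,1,3),d)$ is a compact toric orbifold.
   Context: Let $d\ge 1$. Use coordinates $(\mathbf{a}_0,\dots,\mathbf{a}_d,a_{3,0},\dots,a_{3,3d},u_1,\dots,u_{d-1})$ on $\mathbb{C}^{3(d+1)+(3d+1)+(d-1)}$, where $\mathbf{a}_j=(a_{0,j},a_{1,j},a_{2,j})\in\mathbb{C}^3$ and $a_{3,j},u_k\in\mathbb{C}$ (for $d=1$ there are no $u_k$). Let $U$ be the open subset of points satisfying all of: $(\mathbf{a}_0,a_{3,0},a_{3,1})\neq 0$; $(\mathbf{a}_i,a_{3,3i-1},a_{3,3i},a_{3,3i+1},u_i)\ne 0$ for each $1\le i\le d-1$; $(\mathbf{a}_d,a_{3,3d-1},a_{3,3d})\ne 0$. The torus $(\mathbb{C}^* )^{d+1}\ni(\lambda_0,\dots,\lambda_d)$ acts on $U$ by $\mathbf{a}_j\mapsto\lambda_j\mathbf{a}_j$ ($0\le j\le d$); $a_{3,3j}\mapsto\lambda_j^3a_{3,3j}$ ($0\le j\le d$); $a_{3,3j+1}\mapsto\lambda_j^2\lambda_{j+1}a_{3,3j+1}$ and $a_{3,3j+2}\mapsto\lambda_j\lambda_{j+1}^2a_{3,3j+2}$ ($0\le j\le d-1$); $u_k\mapsto\lambda_{k-1}^{-1}\lambda_k^2\lambda_{k+1}^{-1}u_k$ ($1\le k\le d-1$). Define $\widetilde{Mp}_{0,2}(\mathbb{P}(1,1,1,3),d):=U/(\mathbb{C}^*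 )^{d+1}$. It is the compactified moduli space of degree $d$ quasi-maps from $\mathbb{P}^1$ with two marked points to $\mathbb{P}(1,1,1,3)$. A compact toric orbifold means the toric variety of a complete simplicial fan. *)

theory Defs
  imports "HOL-Analysis.Analysis"
begin

section \<open>Complex varieties as spaces with functions\<close>

text \<open>A (reduced) complex variety is represented by its set of closed points with the Zariski
  topology and, for each open set \<open>V\<close>, the regular functions on \<open>V\<close>. Functions are total in HOL;
  only their values on \<open>V\<close> matter for membership in \<open>reg X V\<close>.\<close>

record 'a fspace =
  ztop :: "'a topology"
  reg :: "'a set \<Rightarrow> ('a \<Rightarrow> complex) set"

definition fspace_iso :: "'a fspace \<Rightarrow> 'b fspace \<Rightarrow> ('a \<Rightarrow> 'b) \<Rightarrow> bool" where
  "fspace_iso X Y \<phi> \<longleftrightarrow>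
     homeomorphic_map (ztop X) (ztop Y) \<phi> \<and>
     (\<forall>V f. openin (ztop Y) V \<longrightarrow>
        (f \<in> reg Y V \<longleftrightarrow> f \<circ> \<phi> \<in> reg X {x \<in> topspace (ztop X). \<phi> x \<in> V}))"

definition fspace_isomorphic :: "'a fspace \<Rightarrow> 'b fspace \<Rightarrow> bool" where
  "fspace_isomorphic X Y \<longleftrightarrow> (\<exists>\<phi>. fspace_iso X Y \<phi>)"

text \<open>The \<open>\<complex>\<close>-algebra of functions generated by \<open>G\<close>.\<close>

inductive_set gen_algebra :: "('a \<Rightarrow> complex) set \<Rightarrow> ('a \<Rightarrow> complex) set"
  for G :: "('a \<Rightarrow> complex) set" where
  const: "(\<lambda>_. c) \<in> gen_algebra G"
| gen: "g \<in> G \<Longrightarrow> g \<in> gen_algebra G"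
| add: "p \<in> gen_algebra G \<Longrightarrow> q \<in> gen_algebra G \<Longrightarrow> (\<lambda>x. p x + q x) \<in> gen_algebra G"
| mult: "p \<in> gen_algebra G \<Longrightarrow> q \<in> gen_algebra G \<Longrightarrow> (\<lambda>x. p x * q x) \<in> gen_algebra G"

text \<open>The (quasi-)affine variety with point set \<open>P\<close> whose ambient affine coordinates generate the
  algebra \<open>A\<close>: the non-vanishing loci of elements of \<open>A\<close> are a basis of the Zariski topology, and
  regular functions are those that are locally quotients of elements of \<open>A\<close>.\<close>

definition quasi_affine :: "'a set \<Rightarrow> ('a \<Rightarrow> complex) set \<Rightarrow> 'a fspace" where
  "quasi_affine P A =
     \<lparr> ztop = topology_generated_by ((\<lambda>q. {x \<in> P. q x \<noteq> 0}) ` A),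
       reg = (\<lambda>V. {f. \<forall>x\<in>V. \<exists>p\<in>A. \<exists>q\<in>A. q x \<noteq> 0 \<and> (\<forall>y\<in>V. q y \<noteq> 0 \<longrightarrow> f y = p y / q y)}) \<rparr>"

text \<open>The final structure for a family of maps \<open>\<pi> i\<close> from \<open>X i\<close>, on the union of their images: a set
  is open, and a function is regular, iff all its pullbacks are. It serves both for the
  quotient by a group (one map) and for gluing charts.\<close>

definition final_fspace ::
    "'i set \<Rightarrow> ('i \<Rightarrow> 'a fspace) \<Rightarrow> ('i \<Rightarrow> 'a \<Rightarrow> 'b) \<Rightarrow> 'b fspace" where
  "final_fspace I X \<pi> =
     \<lparr> ztop = topology (\<lambda>V. V \<subseteq> (\<Union>i\<in>I. \<pi> i ` topspace (ztop (X i))) \<and>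
         (\<forall>i\<in>I. openin (ztop (X i)) {x \<in> topspace (ztop (X i)). \<pi> i x \<in> V})),
       reg = (\<lambda>V. {f. \<forall>i\<in>I. f \<circ> \<pi> i \<in> reg (X i) {x \<in> topspace (ztop (X i)). \<pi> i x \<in> V}}) \<rparr>"

lemma openin_final_fspace:
  "openin (ztop (final_fspace I X \<pi>)) V \<longleftrightarrow>
     V \<subseteq> (\<Union>i\<in>I. \<pi> i ` topspace (ztop (X i))) \<and>
     (\<forall>i\<in>I. openin (ztop (X i)) {x \<in> topspace (ztop (X i)). \<pi> i x \<in> V})"
proof -
  let ?P = "\<lambda>V. V \<subseteq> (\<Union>i\<in>I. \<pi> i ` topspace (ztop (X i))) \<and>
     (\<forall>i\<in>I. openin (ztop (X i)) {x \<in> topspace (ztop (X i)). \<pi> i x \<in> V})"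
  have "istopology ?P"
    unfolding istopology_def
  proof (intro conjI allI impI)
    fix S T assume S: "?P S" and T: "?P T"
    show "S \<inter> T \<subseteq> (\<Union>i\<in>I. \<pi> i ` topspace (ztop (X i)))" using S by blast
    show "\<forall>i\<in>I. openin (ztop (X i)) {x \<in> topspace (ztop (X i)). \<pi> i x \<in> S \<inter> T}"
    proof
      fix i assume "i \<in> I"
      moreover have "{x \<in> topspace (ztop (X i)). \<pi> i x \<in> S \<inter> T} =
        {x \<in> topspace (ztop (X i)). \<pi> i x \<in> S} \<inter> {x \<in> topspace (ztop (X i)). \<pi> i x \<in> T}" by blast
      ultimately show "openin (ztop (X i)) {x \<in> topspace (ztop (X i)). \<pi> i x \<in> S \<inter> T}"
        using S T by auto
    qed
  next
    fix \<K> assume K: "\<forall>K\<in>\<K>. ?P K"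
    show "\<Union>\<K> \<subseteq> (\<Union>i\<in>I. \<pi> i ` topspace (ztop (X i)))" using K by blast
    show "\<forall>i\<in>I. openin (ztop (X i)) {x \<in> topspace (ztop (X i)). \<pi> i x \<in> \<Union>\<K>}"
    proof
      fix i assume "i \<in> I"
      moreover have "{x \<in> topspace (ztop (X i)). \<pi> i x \<in> \<Union>\<K>} =
        (\<Union>K\<in>\<K>. {x \<in> topspace (ztop (X i)). \<pi> i x \<in> K})" by blast
      ultimately show "openin (ztop (X i)) {x \<in> topspace (ztop (X i)). \<pi> i x \<in> \<Union>\<K>}"
        using K by auto
    qed
  qed
  then show ?thesis by (simp add: final_fspace_def topology_inverse')
qed


section \<open>Fans\<close>

text \<open>The lattices \<open>N = M = \<int>\<^sup>n\<close> and their real spans are modelled by functions on \<open>nat\<close> vanishing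
  from index \<open>n\<close> on, so that the rank \<open>n\<close> can be quantified over.\<close>

definition int_lattice :: "nat \<Rightarrow> (nat \<Rightarrow> int) set" where
  "int_lattice n = {m. \<forall>i\<ge>n. m i = 0}"

definition real_span :: "nat \<Rightarrow> (nat \<Rightarrow> real) set" where
  "real_span n = {x. \<forall>i\<ge>n. x i = 0}"

definition pairing :: "nat \<Rightarrow> (nat \<Rightarrow> real) \<Rightarrow> (nat \<Rightarrow> real) \<Rightarrow> real" where
  "pairing n m x = (\<Sum>i<n. m i * x i)"

definition gen_cone :: "(nat \<Rightarrow> int) set \<Rightarrow> (nat \<Rightarrow> real) set" where
  "gen_cone S = {(\<lambda>i. \<Sum>v\<in>S. c v * real_of_int (v i)) | c. \<forall>v\<in>S. 0 \<le> c v}"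

definition rational_polyhedral_cone :: "nat \<Rightarrow> (nat \<Rightarrow> real) set \<Rightarrow> bool" where
  "rational_polyhedral_cone n \<sigma> \<longleftrightarrow> (\<exists>S. S \<subseteq> int_lattice n \<and> finite S \<and> \<sigma> = gen_cone S)"

definition strongly_convex :: "(nat \<Rightarrow> real) set \<Rightarrow> bool" where
  "strongly_convex \<sigma> \<longleftrightarrow> (\<forall>x\<in>\<sigma>. (\<lambda>i. - x i) \<in> \<sigma> \<longrightarrow> x = (\<lambda>_. 0))"

definition dual_cone :: "nat \<Rightarrow> (nat \<Rightarrow> real) set \<Rightarrow> (nat \<Rightarrow> real) set" where
  "dual_cone n \<sigma> = {m \<in> real_span n. \<forall>x\<in>\<sigma>. 0 \<le> pairing n m x}"

definition cone_face :: "nat \<Rightarrow> (nat \<Rightarrow> real) set \<Rightarrow> (nat \<Rightarrow> real) set \<Rightarrow> bool" where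
  "cone_face n \<tau> \<sigma> \<longleftrightarrow> (\<exists>m\<in>dual_cone n \<sigma>. \<tau> = {x \<in> \<sigma>. pairing n m x = 0})"

definition fan :: "nat \<Rightarrow> (nat \<Rightarrow> real) set set \<Rightarrow> bool" where
  "fan n \<Sigma> \<longleftrightarrow>
     finite \<Sigma> \<and>
     (\<forall>\<sigma>\<in>\<Sigma>. rational_polyhedral_cone n \<sigma> \<and> strongly_convex \<sigma>) \<and>
     (\<forall>\<sigma>\<in>\<Sigma>. \<forall>\<tau>. cone_face n \<tau> \<sigma> \<longrightarrow> \<tau> \<in> \<Sigma>) \<and>
     (\<forall>\<sigma>\<in>\<Sigma>. \<forall>\<sigma>'\<in>\<Sigma>. cone_face n (\<sigma> \<inter> \<sigma>') \<sigma> \<and> cone_face n (\<sigma> \<inter> \<sigma>') \<sigma>')"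

definition lin_indep :: "(nat \<Rightarrow> int) set \<Rightarrow> bool" where
  "lin_indep S \<longleftrightarrow>
     (\<forall>c :: (nat \<Rightarrow> int) \<Rightarrow> real.
        (\<forall>i. (\<Sum>v\<in>S. c v * real_of_int (v i)) = 0) \<longrightarrow> (\<forall>v\<in>S. c v = 0))"

definition simplicial_fan :: "nat \<Rightarrow> (nat \<Rightarrow> real) set set \<Rightarrow> bool" where
  "simplicial_fan n \<Sigma> \<longleftrightarrow>
     fan n \<Sigma> \<and>
     (\<forall>\<sigma>\<in>\<Sigma>. \<exists>S. S \<subseteq> int_lattice n \<and> finite S \<and> lin_indep S \<and> \<sigma> = gen_cone S)"

definition complete_fan :: "nat \<Rightarrow> (nat \<Rightarrow> real) set set \<Rightarrow> bool" where
  "complete_fan n \<Sigma> \<longleftrightarrow> fan n \<Sigma> \<and> \<Union>\<Sigma> = real_span n"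


section \<open>The toric variety of a fan\<close>

definition dual_monoid :: "nat \<Rightarrow> (nat \<Rightarrow> real) set \<Rightarrow> (nat \<Rightarrow> int) set" where
  "dual_monoid n \<sigma> = {m \<in> int_lattice n. (\<lambda>i. real_of_int (m i)) \<in> dual_cone n \<sigma>}"

text \<open>The points of \<open>U\<^sub>\<sigma> = Spec \<complex>[\<sigma>\<^sup>\<or> \<inter> M]\<close> are the monoid homomorphisms from \<open>\<sigma>\<^sup>\<or> \<inter> M\<close> to
  \<open>(\<complex>, \<cdot>)\<close>; its coordinate ring is spanned by the characters, i.e. the evaluations at
  \<open>m \<in> \<sigma>\<^sup>\<or> \<inter> M\<close>.\<close>

definition chart_points :: "nat \<Rightarrow> (nat \<Rightarrow> real) set \<Rightarrow> ((nat \<Rightarrow> int) \<Rightarrow> complex) set" where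
  "chart_points n \<sigma> =
     {\<gamma> \<in> extensional (dual_monoid n \<sigma>). \<gamma> (\<lambda>_. 0) = 1 \<and>
        (\<forall>m\<in>dual_monoid n \<sigma>. \<forall>m'\<in>dual_monoid n \<sigma>. \<gamma> (\<lambda>i. m i + m' i) = \<gamma> m * \<gamma> m')}"

definition toric_chart :: "nat \<Rightarrow> (nat \<Rightarrow> real) set \<Rightarrow> ((nat \<Rightarrow> int) \<Rightarrow> complex) fspace" where
  "toric_chart n \<sigma> =
     quasi_affine (chart_points n \<sigma>) (gen_algebra ((\<lambda>m \<gamma>. \<gamma> m) ` dual_monoid n \<sigma>))"

text \<open>\<open>U\<^sub>\<sigma>\<close> and \<open>U\<^sub>\<sigma>\<^sub>'\<close> are glued along \<open>U\<^bsub>\<sigma> \<inter> \<sigma>'\<^esub>\<close>, which maps to both by restriction of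
  homomorphisms. A point of the toric variety is the class of all its representatives.\<close>

definition glued_point :: "nat \<Rightarrow> (nat \<Rightarrow> real) set set \<Rightarrow> (nat \<Rightarrow> real) set \<Rightarrow>
    ((nat \<Rightarrow> int) \<Rightarrow> complex) \<Rightarrow> ((nat \<Rightarrow> real) set \<times> ((nat \<Rightarrow> int) \<Rightarrow> complex)) set" where
  "glued_point n \<Sigma> \<sigma> \<gamma> =
     {(\<sigma>', \<gamma>'). \<sigma>' \<in> \<Sigma> \<and> \<gamma>' \<in> chart_points n \<sigma>' \<and>
        (\<exists>\<delta>\<in>chart_points n (\<sigma> \<inter> \<sigma>').
           restrict \<delta> (dual_monoid n \<sigma>) = \<gamma> \<and> restrict \<delta> (dual_monoid n \<sigma>') = \<gamma>')}"

definition toric_variety :: "nat \<Rightarrow> (nat \<Rightarrow> real) set set \<Rightarrow>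
    ((nat \<Rightarrow> real) set \<times> ((nat \<Rightarrow> int) \<Rightarrow> complex)) set fspace" where
  "toric_variety n \<Sigma> = final_fspace \<Sigma> (toric_chart n) (glued_point n \<Sigma>)"

definition compact_toric_orbifold :: "'a fspace \<Rightarrow> bool" where
  "compact_toric_orbifold X \<longleftrightarrow>
     (\<exists>n \<Sigma>. complete_fan n \<Sigma> \<and> simplicial_fan n \<Sigma> \<and> fspace_isomorphic X (toric_variety n \<Sigma>))"


section \<open>The moduli space of quasi-maps\<close>

text \<open>Names of the coordinates: \<open>cA i j\<close> is \<open>a\<^sub>i\<^sub>,\<^sub>j\<close> for \<open>i \<le> 2\<close>, \<open>cB j\<close> is \<open>a\<^sub>3\<^sub>,\<^sub>j\<close>, and \<open>cU k\<close> is \<open>u\<^sub>k\<close>.\<close>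

datatype coord = cA nat nat | cB nat | cU nat

definition coords :: "nat \<Rightarrow> coord set" where
  "coords d = {cA i j | i j. i \<le> 2 \<and> j \<le> d} \<union> {cB j | j. j \<le> 3 * d} \<union> {cU k | k. 1 \<le> k \<and> k \<le> d - 1}"

definition ambient :: "nat \<Rightarrow> (coord \<Rightarrow> complex) set" where
  "ambient d = {x. \<forall>c. c \<notin> coords d \<longrightarrow> x c = 0}"

definition qm_domain :: "nat \<Rightarrow> (coord \<Rightarrow> complex) set" where
  "qm_domain d = {x \<in> ambient d.
     ((\<exists>i\<le>2. x (cA i 0) \<noteq> 0) \<or> x (cB 0) \<noteq> 0 \<or> x (cB 1) \<noteq> 0) \<and>
     (\<forall>j. 1 \<le> j \<and> j \<le> d - 1 \<longrightarrow>
        (\<exists>i\<le>2. x (cA i j) \<noteq> 0) \<or> x (cB (3 * j - 1)) \<noteq> 0 \<or> x (cB (3 * j)) \<noteq> 0 \<or>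
        x (cB (3 * j + 1)) \<noteq> 0 \<or> x (cU j) \<noteq> 0) \<and>
     ((\<exists>i\<le>2. x (cA i d) \<noteq> 0) \<or> x (cB (3 * d - 1)) \<noteq> 0 \<or> x (cB (3 * d)) \<noteq> 0)}"

definition torus :: "nat \<Rightarrow> (nat \<Rightarrow> complex) set" where
  "torus d = {l. \<forall>j\<le>d. l j \<noteq> 0}"

text \<open>Only the entries \<open>l 0, \<dots>, l d\<close> act on the coordinates in \<open>coords d\<close>; all other coordinates
  are zero on \<open>ambient d\<close>.\<close>

fun torus_act :: "(nat \<Rightarrow> complex) \<Rightarrow> (coord \<Rightarrow> complex) \<Rightarrow> coord \<Rightarrow> complex" where
  "torus_act l x (cA i j) = l j * x (cA i j)"
| "torus_act l x (cB k) =
     (let j = k div 3 in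
      if k mod 3 = 0 then l j ^ 3 * x (cB k)
      else if k mod 3 = 1 then l j ^ 2 * l (j + 1) * x (cB k)
      else l j * l (j + 1) ^ 2 * x (cB k))"
| "torus_act l x (cU k) = inverse (l (k - 1)) * l k ^ 2 * inverse (l (k + 1)) * x (cU k)"

definition torus_orbit :: "nat \<Rightarrow> (coord \<Rightarrow> complex) \<Rightarrow> (coord \<Rightarrow> complex) set" where
  "torus_orbit d x = {torus_act l x | l. l \<in> torus d}"

definition qm_open :: "nat \<Rightarrow> (coord \<Rightarrow> complex) fspace" where
  "qm_open d = quasi_affine (qm_domain d) (gen_algebra ((\<lambda>c x. x c) ` coords d))"

text \<open>The quotient of \<open>qm_domain d\<close> by the torus: its points are the orbits, and regular functions
  are those whose pullbacks (the invariant functions) are regular.\<close>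

definition Mp02 :: "nat \<Rightarrow> (coord \<Rightarrow> complex) set fspace" where
  "Mp02 d = final_fspace {()} (\<lambda>_. qm_open d) (\<lambda>_. torus_orbit d)"

end

theory Submission
  imports Defs
begin

text \<open>Let \<open>w\<^sub>c\<close> be the weight with which the torus acts on the coordinate \<open>c\<close>. The coordinates fall into
  \<open>d + 1\<close> groups, one for each torus factor: group \<open>j\<close> consists of the coordinates in the \<open>j\<close>-th
  nonvanishing condition, so that \<open>U\<close> is the set of points at which no group vanishes identically.
  This is a quotient presentation in the sense of Cox. Let \<open>M\<close> be the lattice of exponent vectors of
  weight zero and \<open>N\<close> its dual. Each coordinate \<open>c\<close> gives a ray \<open>v\<^sub>c\<close> in \<open>N\<close>, the \<open>c\<close>-th exponent, and
  each set \<open>S\<close> of coordinates that contains no whole group gives the cone spanned by the \<open>v\<^sub>c\<close> with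
  \<open>c \<in> S\<close>. The claim splits into two parts: these cones form a complete simplicial fan, and its toric
  variety is the quotient.

  \<^bold>\<open>The fan.\<close> A vector of \<open>N\<^sub>\<real>\<close> is a vector \<open>x\<close> of real numbers indexed by the coordinates, up to adding
  \<open>(w\<^sub>c \<bullet> t)\<^sub>c\<close> for some \<open>t\<close>. It has a unique expression as a nonnegative combination of the rays of one
  of the cones iff there is exactly one \<open>t\<close> for which all \<open>x\<^sub>c + w\<^sub>c \<bullet> t\<close> are nonnegative and every group
  contains a zero among them. This is a linear complementarity problem, and it is solvable because of
  diagonal dominance: with \<open>p\<^sub>j = (j + 1) (d + 1 - j)\<close>, every weight \<open>w\<close> in group \<open>j\<close> satisfies
  \<open>(\<Sum>i \<noteq> j. \<bar>w\<^sub>i\<bar> p\<^sub>i) < w\<^sub>j p\<^sub>j\<close>. For the weights \<open>-e\<^sub>j\<^sub>-\<^sub>1 + 2 e\<^sub>j - e\<^sub>j\<^sub>+\<^sub>1\<close> of the \<open>u\<^sub>j\<close> this says that \<open>p\<close> is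
  strictly concave; constant \<open>p\<close> would only give a weak inequality. Solving the \<open>j\<close>-th condition for
  \<open>t\<^sub>j\<close>, for all \<open>j\<close> simultaneously, is then a contraction in the \<open>p\<close>-weighted maximum norm, whose
  iteration converges to a solution (\<open>complementarity_exists\<close>). For uniqueness one looks at an index
  at which the difference of two solutions is largest relative to \<open>p\<close> (\<open>sign_change_imp_zero\<close>).
  Completeness is existence; linear independence of the rays of a cone and the intersection property
  of cones both follow from uniqueness.

  \<^bold>\<open>The quotient.\<close> Where the coordinates outside \<open>S\<close> do not vanish, the monomials with exponents in
  the dual monoid of the cone of \<open>S\<close> define a map to the points of the toric chart. It is surjective
  (\<open>chart_map_surj\<close>), and points are identified in the toric variety iff they lie in one orbit
  (\<open>toric_point_eq_iff\<close>): both rest on the extension of characters from subgroups of \<open>\<int>\<^sup>C\<close>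
  (\<open>character_extension\<close>), which is possible because nonzero complex numbers have roots. That the
  charts carry the quotient topology and the invariant functions (\<open>openin_chart_iff\<close>,
  \<open>reg_chart_iff\<close>) comes from splitting polynomials into weight components. The coordinates that are
  invertible on a chart have weights spanning a sublattice of finite index, so a suitable power of a
  component times an invertible monomial is invariant, that is, a polynomial in the characters of the
  chart. Finally, these statements are local on \<open>U\<close>, so they glue.\<close>

section \<open>Integer relations and characters of lattices\<close>

text \<open>Eliminating one equation with one of the unknowns, without division, reduces both numbers by one.\<close>

lemma nontrivial_integer_solution:
  fixes a :: "'c \<Rightarrow> 'i \<Rightarrow> int"
  assumes "finite I" "finite K" "card I < card K"
  shows "\<exists>k. (\<exists>c\<in>K. k c \<noteq> 0) \<and> (\<forall>i\<in>I. (\<Sum>c\<in>K. k c * a c i) = 0)"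
  using assms
proof (induction I arbitrary: K a rule: finite_induct)
  case empty
  then have "K \<noteq> {}" by auto
  then show ?case by (intro exI[of _ "\<lambda>_. 1"]) auto
next
  case (insert i0 I)
  show ?case
  proof (cases "\<forall>c\<in>K. a c i0 = 0")
    case True
    have "card I < card K" using insert by simp
    from insert.IH[OF insert.prems(1) this, of a] obtain k
      where k: "\<exists>c\<in>K. k c \<noteq> 0" "\<forall>i\<in>I. (\<Sum>c\<in>K. k c * a c i) = 0" by blast
    moreover have "(\<Sum>c\<in>K. k c * a c i0) = 0" using True by simp
    ultimately show ?thesis by (intro exI[of _ k]) auto
  next
    case False
    then obtain c0 where c0: "c0 \<in> K" "a c0 i0 \<noteq> 0" by blast
    define q where "q = a c0 i0"
    define a' where "a' = (\<lambda>c i. q * a c i - a c i0 * a c0 i)"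
    have "card I < card (K - {c0})" using insert c0 by simp
    from insert.IH[OF _ this, of a'] insert.prems obtain k'
      where k': "\<exists>c\<in>K-{c0}. k' c \<noteq> 0" "\<forall>i\<in>I. (\<Sum>c\<in>K-{c0}. k' c * a' c i) = 0" by blast
    define k where "k = (\<lambda>c. if c = c0 then - (\<Sum>c\<in>K-{c0}. a c i0 * k' c) else q * k' c)"
    have expand: "(\<Sum>c\<in>K. k c * a c i) = (\<Sum>c\<in>K-{c0}. k' c * a' c i)" for i
    proof -
      have "(\<Sum>c\<in>K. k c * a c i) = k c0 * a c0 i + (\<Sum>c\<in>K-{c0}. k c * a c i)"
        using insert.prems c0 by (simp add: sum.remove)
      also have "(\<Sum>c\<in>K-{c0}. k c * a c i) = (\<Sum>c\<in>K-{c0}. q * k' c * a c i)"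
        by (rule sum.cong) (auto simp: k_def)
      also have "k c0 * a c0 i = (\<Sum>c\<in>K-{c0}. - (a c i0 * k' c * a c0 i))"
        by (simp add: k_def sum_distrib_right sum_negf)
      finally show ?thesis by (simp add: a'_def algebra_simps sum.distrib[symmetric])
    qed
    have "a' c i0 = 0" for c by (simp add: a'_def q_def)
    then have "\<forall>i\<in>insert i0 I. (\<Sum>c\<in>K. k c * a c i) = 0"
      using k'(2) by (auto simp: expand)
    moreover have "\<exists>c\<in>K. k c \<noteq> 0" using k'(1) c0(2) by (auto simp: k_def q_def)
    ultimately show ?thesis by blast
  qed
qed

lemma prod_powi_sum:
  fixes z :: "'a::field"
  assumes "z \<noteq> 0"
  shows "(\<Prod>c\<in>A. z powi f c) = z powi (\<Sum>c\<in>A. f c)"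
proof (cases "finite A")
  case True
  then show ?thesis by (induction A) (auto simp: power_int_add assms)
qed auto

lemma powi_prod:
  fixes f :: "'c \<Rightarrow> 'a::field"
  shows "(\<Prod>c\<in>A. f c) powi n = (\<Prod>c\<in>A. f c powi n)"
proof (cases "finite A")
  case True
  then show ?thesis by (induction A) (auto simp: power_int_mult_distrib)
qed auto

lemma complex_root_exists:
  fixes z :: complex
  assumes "z \<noteq> 0" "0 < g"
  shows "\<exists>u. u \<noteq> 0 \<and> u ^ g = z"
proof -
  have "exp (Ln z / of_nat g) ^ g = exp (of_nat g * (Ln z / of_nat g))"
    by (rule exp_of_nat_mult[symmetric])
  then have "exp (Ln z / of_nat g) ^ g = z" using assms by simp
  then show ?thesis using exp_not_eq_zero by blast
qed

lemma character_multiples: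
  fixes \<psi> :: "('c \<Rightarrow> int) \<Rightarrow> complex"
  assumes add: "\<And>h h'. h \<in> H \<Longrightarrow> h' \<in> H \<Longrightarrow> (\<lambda>c. h c + h' c) \<in> H"
    and neg: "\<And>h. h \<in> H \<Longrightarrow> (\<lambda>c. - h c) \<in> H"
    and mult: "\<And>h h'. h \<in> H \<Longrightarrow> h' \<in> H \<Longrightarrow> \<psi> (\<lambda>c. h c + h' c) = \<psi> h * \<psi> h'"
    and nz: "\<And>h. h \<in> H \<Longrightarrow> \<psi> h \<noteq> 0"
    and h: "h \<in> H"
  shows "(\<lambda>c. q * h c) \<in> H \<and> \<psi> (\<lambda>c. q * h c) = \<psi> h powi q"
proof -
  have z: "(\<lambda>c. 0) \<in> H" using add[OF h neg[OF h]] by simp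
  have z1: "\<psi> (\<lambda>c. 0) = 1" using mult[OF z z] nz[OF z] by simp
  have pos: "(\<lambda>c. int N * h' c) \<in> H \<and> \<psi> (\<lambda>c. int N * h' c) = \<psi> h' ^ N" if "h' \<in> H" for N h'
  proof (induction N)
    case 0 then show ?case by (simp add: z z1)
  next
    case (Suc N)
    have "(\<lambda>c. int (Suc N) * h' c) = (\<lambda>c. h' c + int N * h' c)" by (auto simp: algebra_simps)
    then show ?case using add[OF that conjunct1[OF Suc]] mult[OF that conjunct1[OF Suc]] Suc by simp
  qed
  have neg1: "\<psi> (\<lambda>c. - h c) = inverse (\<psi> h)"
    using mult[OF h neg[OF h]] z1 nz[OF h] by (simp add: field_simps)
  show ?thesis
  proof (cases q rule: int_cases2)
    case (nonneg N) then show ?thesis using pos[OF h, of N] by simp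
  next
    case (nonpos N)
    then show ?thesis using pos[OF neg[OF h], of N] neg1 by (simp add: power_int_minus power_inverse)
  qed
qed

text \<open>Characters of a subgroup of \<open>\<int>\<^sup>C\<close> extend to \<open>\<int>\<^sup>C\<close>. One coordinate is added at a time: if \<open>h\<^sub>1\<close>
  generates the subgroup modulo the elements vanishing at the new coordinate \<open>c\<^sub>0\<close>, then the value at
  \<open>c\<^sub>0\<close> has to be a root of order \<open>h\<^sub>1 c\<^sub>0\<close> of a number that is already determined.\<close>

lemma character_extension:
  fixes \<psi> :: "('c \<Rightarrow> int) \<Rightarrow> complex"
  assumes "finite C"
    and "\<And>h c. h \<in> H \<Longrightarrow> c \<notin> C \<Longrightarrow> h c = 0"
    and "\<And>h h'. h \<in> H \<Longrightarrow> h' \<in> H \<Longrightarrow> (\<lambda>c. h c + h' c) \<in> H"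
    and "\<And>h. h \<in> H \<Longrightarrow> (\<lambda>c. - h c) \<in> H"
    and "\<And>h h'. h \<in> H \<Longrightarrow> h' \<in> H \<Longrightarrow> \<psi> (\<lambda>c. h c + h' c) = \<psi> h * \<psi> h'"
    and "\<And>h. h \<in> H \<Longrightarrow> \<psi> h \<noteq> 0"
  shows "\<exists>z. (\<forall>c. z c \<noteq> 0) \<and> (\<forall>h\<in>H. \<psi> h = (\<Prod>c\<in>C. z c powi h c))"
  using assms
proof (induction C arbitrary: H rule: finite_induct)
  case empty
  have "\<psi> h = 1" if "h \<in> H" for h
  proof -
    have "h = (\<lambda>_. 0)" using empty(1)[OF that] by auto
    then show ?thesis using empty(4)[OF that that] empty(5)[OF that] by simp
  qed
  then show ?case by (intro exI[of _ "\<lambda>_. 1"]) auto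
next
  case (insert c0 C)
  note supp = insert.prems(1) and add = insert.prems(2) and neg = insert.prems(3)
    and mult = insert.prems(4) and nz = insert.prems(5)
  define H0 where "H0 = {h \<in> H. h c0 = 0}"
  have "\<exists>z. (\<forall>c. z c \<noteq> 0) \<and> (\<forall>h\<in>H0. \<psi> h = (\<Prod>c\<in>C. z c powi h c))"
  proof (rule insert.IH)
    show "h c = 0" if "h \<in> H0" "c \<notin> C" for h c
      using that supp[of h c] by (cases "c = c0") (auto simp: H0_def)
  qed (use add neg mult nz in \<open>auto simp: H0_def\<close>)
  then obtain z where z: "\<And>c. z c \<noteq> 0" "\<And>h. h \<in> H0 \<Longrightarrow> \<psi> h = (\<Prod>c\<in>C. z c powi h c)" by blast
  have multiples: "(\<lambda>c. q * h c) \<in> H \<and> \<psi> (\<lambda>c. q * h c) = \<psi> h powi q" if "h \<in> H" for h q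
    by (rule character_multiples[OF add neg mult nz that])
  show ?case
  proof (cases "H = H0")
    case True
    have H0: "h \<in> H0" if "h \<in> H" for h by (rule subsetD[OF equalityD1[OF True] that])
    have "(\<Prod>c\<in>insert c0 C. z c powi h c) = (\<Prod>c\<in>C. z c powi h c)" if "h \<in> H" for h
    proof -
      have "h c0 = 0" using H0[OF that] by (simp add: H0_def)
      then show ?thesis using insert.hyps by simp
    qed
    then show ?thesis using z(1) z(2)[OF H0] by (intro exI[of _ z]) simp
  next
    case False
    have "\<exists>g. 0 < g \<and> (\<exists>h\<in>H. h c0 = int g)"
    proof -
      obtain h where h: "h \<in> H" "h c0 \<noteq> 0" using False by (auto simp: H0_def)
      have "\<exists>h'\<in>H. h' c0 = int (nat \<bar>h c0\<bar>)"
      proof (cases "h c0 > 0")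
        case True
        then show ?thesis using h(1) by (intro bexI[of _ h]) auto
      next
        case False
        then show ?thesis using neg[OF h(1)] by (intro bexI[of _ "\<lambda>c. - h c"]) auto
      qed
      then show ?thesis using h(2) by (intro exI[of _ "nat \<bar>h c0\<bar>"]) auto
    qed
    \<comment> \<open>The values at \<open>c0\<close> form a subgroup of \<open>\<int>\<close>, generated by its least positive element.\<close>
    define g where "g = (LEAST g. 0 < g \<and> (\<exists>h\<in>H. h c0 = int g))"
    have "0 < g \<and> (\<exists>h\<in>H. h c0 = int g)"
      unfolding g_def by (rule LeastI_ex) fact
    then have g: "0 < g" "\<exists>h\<in>H. h c0 = int g" by simp_all
    have least: "g \<le> g'" if "0 < g'" "\<exists>h\<in>H. h c0 = int g'" for g'
      unfolding g_def by (rule Least_le) (use that in simp)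
    obtain h1 where h1: "h1 \<in> H" "h1 c0 = int g" using g by blast
    define P where "P = (\<Prod>c\<in>C. z c powi h1 c)"
    have P0: "P \<noteq> 0" by (simp add: P_def insert.hyps z)
    obtain u where u: "u \<noteq> 0" "u ^ g = \<psi> h1 / P"
      using complex_root_exists[of "\<psi> h1 / P" g] nz[OF h1(1)] P0 g(1) by auto
    define z' where "z' = z(c0 := u)"
    have "\<psi> h = (\<Prod>c\<in>insert c0 C. z' c powi h c)" if h: "h \<in> H" for h
    proof -
      define q where "q = h c0 div int g"
      define h2 where "h2 = (\<lambda>c. h c + (- q) * h1 c)"
      have h2H: "h2 \<in> H" unfolding h2_def using add[OF h] multiples[OF h1(1), of "- q"] by blast
      have h2c: "h2 c0 = h c0 mod int g"
        by (simp add: h2_def h1 q_def minus_mult_div_eq_mod[symmetric] mult.commute)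
      have "h2 c0 = 0"
      proof (rule ccontr)
        assume "h2 c0 \<noteq> 0"
        moreover have "0 \<le> h2 c0" "h2 c0 < int g" using g by (auto simp: h2c)
        ultimately have pos: "0 < nat (h2 c0)" "h2 c0 = int (nat (h2 c0))" "nat (h2 c0) < g" by auto
        have "g \<le> nat (h2 c0)" by (rule least[OF pos(1)]) (use pos(2) h2H in blast)
        then show False using pos(3) by simp
      qed
      then have h20: "h2 \<in> H0" using h2H by (simp add: H0_def)
      have hc0: "h c0 = int g * q" using \<open>h2 c0 = 0\<close> by (simp add: h2_def h1)
      have "h = (\<lambda>c. h2 c + q * h1 c)" by (auto simp: h2_def)
      then have "\<psi> h = \<psi> h2 * \<psi> h1 powi q"
        using mult[OF h2H] multiples[OF h1(1), of q] by metis
      also have "\<psi> h1 = u ^ g * P" using u P0 by simp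
      also have "(u ^ g * P) powi q = u powi h c0 * (\<Prod>c\<in>C. z c powi (h1 c * q))"
        by (simp add: power_int_mult_distrib hc0 power_int_mult P_def powi_prod)
      also have "\<psi> h2 = (\<Prod>c\<in>C. z c powi h2 c)" using z(2)[OF h20] .
      also have "(\<Prod>c\<in>C. z c powi h2 c) * (u powi h c0 * (\<Prod>c\<in>C. z c powi (h1 c * q)))
          = u powi h c0 * (\<Prod>c\<in>C. z c powi (h2 c + h1 c * q))"
        by (simp add: prod.distrib power_int_add z)
      also have "\<dots> = u powi h c0 * (\<Prod>c\<in>C. z c powi h c)"
        by (simp add: h2_def algebra_simps)
      also have "\<dots> = (\<Prod>c\<in>insert c0 C. z' c powi h c)"
      proof -
        have "(\<Prod>c\<in>C. z c powi h c) = (\<Prod>c\<in>C. z' c powi h c)"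
          by (rule prod.cong) (use insert.hyps in \<open>auto simp: z'_def\<close>)
        then show ?thesis using insert.hyps by (simp add: z'_def)
      qed
      finally show ?thesis .
    qed
    then show ?thesis using z u by (intro exI[of _ z']) (auto simp: z'_def)
  qed
qed

text \<open>Dedekind's independence of characters, for characters of any set with a binary operation.\<close>

lemma characters_independent:
  fixes \<phi> :: "'i \<Rightarrow> 't \<Rightarrow> complex" and op :: "'t \<Rightarrow> 't \<Rightarrow> 't"
  assumes "finite X"
    and closed: "\<And>s t. s \<in> T \<Longrightarrow> t \<in> T \<Longrightarrow> op s t \<in> T"
    and "\<And>\<psi> s t. \<psi> \<in> X \<Longrightarrow> s \<in> T \<Longrightarrow> t \<in> T \<Longrightarrow> \<phi> \<psi> (op s t) = \<phi> \<psi> s * \<phi> \<psi> t"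
    and "\<And>\<psi>. \<psi> \<in> X \<Longrightarrow> \<exists>t\<in>T. \<phi> \<psi> t \<noteq> 0"
    and "\<And>\<psi> \<psi>'. \<psi> \<in> X \<Longrightarrow> \<psi>' \<in> X \<Longrightarrow> \<psi> \<noteq> \<psi>' \<Longrightarrow> \<exists>t\<in>T. \<phi> \<psi> t \<noteq> \<phi> \<psi>' t"
    and "\<And>t. t \<in> T \<Longrightarrow> (\<Sum>\<psi>\<in>X. a \<psi> * \<phi> \<psi> t) = 0"
  shows "\<forall>\<psi>\<in>X. a \<psi> = 0"
  using assms(1,3-)
proof (induction X arbitrary: a rule: finite_induct)
  case empty
  then show ?case by simp
next
  case (insert \<psi>0 X)
  note mult = insert.prems(1) and nz = insert.prems(2) and dist = insert.prems(3)
    and zero = insert.prems(4)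
  have "a \<psi> = 0" if \<psi>: "\<psi> \<in> X" for \<psi>
  proof -
    have ne: "\<psi> \<noteq> \<psi>0" using that insert.hyps by blast
    obtain s where s: "s \<in> T" "\<phi> \<psi> s \<noteq> \<phi> \<psi>0 s" using dist[of \<psi> \<psi>0] \<psi> ne by auto
    \<comment> \<open>Translating by \<open>s\<close> and subtracting eliminates \<open>\<psi>0\<close>.\<close>
    have "\<forall>\<psi>\<in>X. a \<psi> * (\<phi> \<psi> s - \<phi> \<psi>0 s) = 0"
    proof (rule insert.IH)
      fix t assume t: "t \<in> T"
      have "(\<Sum>\<psi>\<in>X. a \<psi> * (\<phi> \<psi> s - \<phi> \<psi>0 s) * \<phi> \<psi> t)
          = (\<Sum>\<psi>\<in>insert \<psi>0 X. a \<psi> * (\<phi> \<psi> s - \<phi> \<psi>0 s) * \<phi> \<psi> t)"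
        using insert.hyps by simp
      also have "\<dots> = (\<Sum>\<psi>\<in>insert \<psi>0 X. a \<psi> * \<phi> \<psi> (op s t))
          - \<phi> \<psi>0 s * (\<Sum>\<psi>\<in>insert \<psi>0 X. a \<psi> * \<phi> \<psi> t)"
        unfolding sum_distrib_left sum_subtractf[symmetric]
        by (rule sum.cong[OF refl]) (use mult s t in \<open>auto simp: algebra_simps\<close>)
      also have "\<dots> = 0" using zero[OF closed[OF s(1) t]] zero[OF t] by simp
      finally show "(\<Sum>\<psi>\<in>X. a \<psi> * (\<phi> \<psi> s - \<phi> \<psi>0 s) * \<phi> \<psi> t) = 0" .
    qed (use mult nz dist in auto)
    then show ?thesis using that s by auto
  qed
  moreover obtain t where "t \<in> T" "\<phi> \<psi>0 t \<noteq> 0" using nz by blast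
  ultimately show ?case using zero[of t] insert.hyps by simp
qed

section \<open>Gradings with dominant weights\<close>

text \<open>The data of the quotient: coordinates \<open>c \<in> C\<close> of weight \<open>w c\<close>, divided into the groups
  \<open>grp c = j\<close> for \<open>j \<le> d\<close>. The coordinate \<open>b j\<close>, whose weight is the \<open>j\<close>-th unit vector, makes the
  lattice of weight-zero exponent vectors free on the other coordinates. The vector \<open>p\<close> rescales the
  torus factors so that the weights of group \<open>j\<close> become strictly diagonally dominant at \<open>j\<close>.\<close>

locale dominant_grading =
  fixes C :: "'c set" and d :: nat and grp :: "'c \<Rightarrow> nat" and w :: "'c \<Rightarrow> nat \<Rightarrow> int"
    and b :: "nat \<Rightarrow> 'c" and p :: "nat \<Rightarrow> real"
  assumes finite_C: "finite C"
    and grp_le: "c \<in> C \<Longrightarrow> grp c \<le> d"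
    and b_in: "j \<le> d \<Longrightarrow> b j \<in> C"
    and grp_b: "j \<le> d \<Longrightarrow> grp (b j) = j"
    and w_b: "j \<le> d \<Longrightarrow> i \<le> d \<Longrightarrow> w (b j) i = (if i = j then 1 else 0)"
    and p_pos: "j \<le> d \<Longrightarrow> 0 < p j"
    and dominant: "c \<in> C \<Longrightarrow>
      (\<Sum>i\<in>{..d} - {grp c}. \<bar>real_of_int (w c i)\<bar> * p i) < real_of_int (w c (grp c)) * p (grp c)"
begin

definition wt_apply :: "'c \<Rightarrow> (nat \<Rightarrow> real) \<Rightarrow> real" where
  "wt_apply c t = (\<Sum>i\<le>d. real_of_int (w c i) * t i)"

lemma wt_apply_split:
  assumes "c \<in> C"
  shows "wt_apply c t = real_of_int (w c (grp c)) * t (grp c) + (\<Sum>i\<in>{..d} - {grp c}. real_of_int (w c i) * t i)"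
  unfolding wt_apply_def using grp_le[OF assms] by (simp add: sum.remove)

lemma wt_apply_diff: "wt_apply c (\<lambda>i. s i - t i) = wt_apply c s - wt_apply c t"
  by (simp add: wt_apply_def algebra_simps sum_subtractf)

lemma wt_apply_uminus: "wt_apply c (\<lambda>i. - t i) = - wt_apply c t"
  by (simp add: wt_apply_def sum_negf)

lemma wt_apply_b: "j \<le> d \<Longrightarrow> wt_apply (b j) t = t j"
proof -
  assume j: "j \<le> d"
  have "wt_apply (b j) t = (\<Sum>i\<le>d. if i = j then t j else 0)"
    unfolding wt_apply_def by (rule sum.cong) (use j in \<open>auto simp: w_b\<close>)
  then show ?thesis using j by simp
qed

lemma p_nonneg: "j \<le> d \<Longrightarrow> 0 \<le> p j"
  using p_pos less_imp_le by blast

lemma w_diag_pos: "c \<in> C \<Longrightarrow> 0 < w c (grp c)"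
proof -
  assume c: "c \<in> C"
  have "0 \<le> (\<Sum>i\<in>{..d} - {grp c}. \<bar>real_of_int (w c i)\<bar> * p i)"
    by (intro sum_nonneg) (simp add: p_nonneg)
  then have "0 < real_of_int (w c (grp c)) * p (grp c)" using dominant[OF c] by linarith
  then show ?thesis using p_pos[OF grp_le[OF c]] by (simp add: zero_less_mult_iff)
qed

lemma off_diagonal_bound:
  assumes "c \<in> C" "\<And>i. i \<le> d \<Longrightarrow> \<bar>s i\<bar> \<le> M * p i"
  shows "\<bar>\<Sum>i\<in>{..d} - {grp c}. real_of_int (w c i) * s i\<bar>
      \<le> M * (\<Sum>i\<in>{..d} - {grp c}. \<bar>real_of_int (w c i)\<bar> * p i)"
proof -
  have "\<bar>\<Sum>i\<in>{..d} - {grp c}. real_of_int (w c i) * s i\<bar>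
      \<le> (\<Sum>i\<in>{..d} - {grp c}. \<bar>real_of_int (w c i) * s i\<bar>)" by (rule sum_abs)
  also have "\<dots> \<le> (\<Sum>i\<in>{..d} - {grp c}. \<bar>real_of_int (w c i)\<bar> * (M * p i))"
    by (intro sum_mono) (use assms in \<open>auto simp: abs_mult intro!: mult_left_mono\<close>)
  finally show ?thesis by (simp add: sum_distrib_left mult_ac)
qed

text \<open>Where \<open>s\<close> attains its weighted maximum norm with positive sign, the diagonal term outweighs all
  the others together.\<close>

lemma dominance_sign:
  assumes "c \<in> C" "\<And>i. i \<le> d \<Longrightarrow> \<bar>s i\<bar> \<le> M * p i" "s (grp c) = M * p (grp c)" "0 < M"
  shows "0 < wt_apply c s"
proof -
  have "\<bar>\<Sum>i\<in>{..d} - {grp c}. real_of_int (w c i) * s i\<bar>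
      \<le> M * (\<Sum>i\<in>{..d} - {grp c}. \<bar>real_of_int (w c i)\<bar> * p i)"
    by (rule off_diagonal_bound[OF assms(1,2)])
  also have "\<dots> < M * (real_of_int (w c (grp c)) * p (grp c))"
    using dominant[OF assms(1)] assms(4) by simp
  finally show ?thesis by (simp add: wt_apply_split[OF assms(1)] assms(3) mult_ac)
qed

text \<open>The source of all uniqueness statements: at an index where \<open>\<bar>s j\<bar> / p j\<close> is maximal, all weights of
  group \<open>j\<close> take on \<open>s\<close> the sign of \<open>s j\<close>, so they cannot take both signs unless \<open>s\<close> vanishes.\<close>

lemma sign_change_imp_zero:
  assumes "\<And>j. j \<le> d \<Longrightarrow> \<exists>c\<in>C. grp c = j \<and> wt_apply c s \<le> 0"
    and "\<And>j. j \<le> d \<Longrightarrow> \<exists>c\<in>C. grp c = j \<and> 0 \<le> wt_apply c s"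
    and "i \<le> d"
  shows "s i = 0"
proof (rule ccontr)
  assume nz: "s i \<noteq> 0"
  define M where "M = Max ((\<lambda>j. \<bar>s j\<bar> / p j) ` {..d})"
  have "M \<in> (\<lambda>j. \<bar>s j\<bar> / p j) ` {..d}" unfolding M_def by (rule Max_in) auto
  then obtain j where j: "j \<le> d" "M = \<bar>s j\<bar> / p j" by auto
  have bound: "\<bar>s k\<bar> / p k \<le> M" if "k \<le> d" for k unfolding M_def using that by (intro Max_ge) auto
  then have le: "\<bar>s k\<bar> \<le> M * p k" if "k \<le> d" for k
    using that p_pos[OF that] by (simp add: divide_le_eq)
  have "0 < \<bar>s i\<bar> / p i" using nz p_pos[OF assms(3)] by simp
  then have M: "0 < M" using bound[OF assms(3)] by linarith
  have eq: "\<bar>s j\<bar> = M * p j" using j p_pos[OF j(1)] by simp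
  show False
  proof (cases "0 \<le> s j")
    case True
    obtain c where c: "c \<in> C" "grp c = j" "wt_apply c s \<le> 0" using assms(1)[OF j(1)] by blast
    have "0 < wt_apply c s" by (rule dominance_sign[of _ _ M]) (use c le eq True M in auto)
    then show False using c by simp
  next
    case False
    obtain c where c: "c \<in> C" "grp c = j" "0 \<le> wt_apply c s" using assms(2)[OF j(1)] by blast
    have "0 < wt_apply c (\<lambda>i. - s i)" by (rule dominance_sign[of _ _ M]) (use c le eq False M in auto)
    then show False using c by (simp add: wt_apply_uminus)
  qed
qed

text \<open>The rows of the matrix \<open>w (s j) i\<close> are independent. Dominance shows this for the columns
  (\<open>sign_change_imp_zero\<close>). If a relation among the rows involved row \<open>j\<^sub>0\<close>, then a vector orthogonal to
  the other rows, which exists by counting, would be orthogonal to row \<open>j\<^sub>0\<close> as well.\<close>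

lemma transversal_independent:
  assumes s: "\<And>j. j \<le> d \<Longrightarrow> s j \<in> C \<and> grp (s j) = j"
    and k: "\<And>i. i \<le> d \<Longrightarrow> (\<Sum>j\<le>d. k j * w (s j) i) = 0"
    and "j0 \<le> d"
  shows "k j0 = 0"
proof (rule ccontr)
  assume k0: "k j0 \<noteq> 0"
  have "card ({..d} - {j0}) < card {..d}" using assms(3) by (intro psubset_card_mono) auto
  from nontrivial_integer_solution[OF _ _ this, of "\<lambda>i j. w (s j) i"] obtain t
    where t: "\<exists>i\<in>{..d}. t i \<noteq> 0" "\<And>j. j \<in> {..d} - {j0} \<Longrightarrow> (\<Sum>i\<le>d. t i * w (s j) i) = 0" by auto
  have "(\<Sum>j\<le>d. k j * (\<Sum>i\<le>d. t i * w (s j) i)) = (\<Sum>i\<le>d. t i * (\<Sum>j\<le>d. k j * w (s j) i))"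
    unfolding sum_distrib_left by (subst sum.swap) (simp add: mult_ac)
  also have "\<dots> = 0" using k by simp
  also have "(\<Sum>j\<le>d. k j * (\<Sum>i\<le>d. t i * w (s j) i)) = k j0 * (\<Sum>i\<le>d. t i * w (s j0) i)"
    using assms(3) t(2) by (simp add: sum.remove[of _ j0])
  finally have "(\<Sum>i\<le>d. t i * w (s j0) i) = 0" using k0 by simp
  then have "(\<Sum>i\<le>d. t i * w (s j) i) = 0" if "j \<le> d" for j using t(2) that by (cases "j = j0") auto
  then have "real_of_int (\<Sum>i\<le>d. t i * w (s j) i) = 0" if "j \<le> d" for j using that by simp
  then have wz: "wt_apply (s j) (\<lambda>i. real_of_int (t i)) = 0" if "j \<le> d" for j
    using that by (simp add: wt_apply_def mult_ac)
  have "real_of_int (t i) = 0" if "i \<le> d" for i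
    by (rule sign_change_imp_zero[of "\<lambda>i. real_of_int (t i)"]) (use s wz that in \<open>auto intro!: bexI[of _ "s _"]\<close>)
  then show False using t(1) by auto
qed

section \<open>The complementarity problem of the grading\<close>

text \<open>The \<open>j\<close>-th condition, solved for the \<open>j\<close>-th unknown while the others are kept fixed.\<close>

lemma one_step_exists:
  assumes "j \<le> d"
  shows "\<exists>\<tau>. (\<forall>c\<in>C. grp c = j \<longrightarrow> 0 \<le> real_of_int (w c j) * \<tau> + f c)
    \<and> (\<exists>c\<in>C. grp c = j \<and> real_of_int (w c j) * \<tau> + f c = 0)"
proof -
  define G where "G = {c \<in> C. grp c = j}"
  have G: "finite G" "G \<noteq> {}" using finite_C b_in[OF assms] grp_b[OF assms] by (auto simp: G_def)
  define \<tau> where "\<tau> = Max ((\<lambda>c. - f c / real_of_int (w c j)) ` G)"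
  have "\<tau> \<in> (\<lambda>c. - f c / real_of_int (w c j)) ` G" unfolding \<tau>_def by (rule Max_in) (use G in auto)
  then obtain c where c: "c \<in> G" "\<tau> = - f c / real_of_int (w c j)" by auto
  have pos: "0 < w c j" if "c \<in> G" for c using w_diag_pos[of c] that by (auto simp: G_def)
  have "- f c / real_of_int (w c j) \<le> \<tau>" if "c \<in> G" for c unfolding \<tau>_def using that G by (intro Max_ge) auto
  then have "- f c \<le> \<tau> * real_of_int (w c j)" if "c \<in> G" for c
    using pos[OF that] that by (metis pos_divide_le_eq of_int_0_less_iff)
  then have "0 \<le> real_of_int (w c j) * \<tau> + f c" if "c \<in> G" for c
    using that by (fastforce simp: mult.commute)
  moreover have "real_of_int (w c j) * \<tau> + f c = 0" using c pos[OF c(1)] by (simp add: field_simps)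
  ultimately show ?thesis using c by (intro exI[of _ \<tau>]) (auto simp: G_def)
qed

lemma contraction_ratio_exists:
  "\<exists>r. 0 < r \<and> r < 1 \<and> (\<forall>c\<in>C. (\<Sum>i\<in>{..d} - {grp c}. \<bar>real_of_int (w c i)\<bar> * p i)
      \<le> r * (real_of_int (w c (grp c)) * p (grp c)))"
proof -
  define R where "R = (\<lambda>c. (\<Sum>i\<in>{..d} - {grp c}. \<bar>real_of_int (w c i)\<bar> * p i) / (real_of_int (w c (grp c)) * p (grp c)))"
  have pos: "0 < real_of_int (w c (grp c)) * p (grp c)" if "c \<in> C" for c
    using w_diag_pos[OF that] p_pos[OF grp_le[OF that]] by simp
  have R1: "R c < 1" if "c \<in> C" for c using dominant[OF that] pos[OF that] by (simp add: R_def)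
  define r where "r = Max (insert (1/2) (R ` C))"
  have "r \<in> insert (1/2) (R ` C)" unfolding r_def by (rule Max_in) (use finite_C in auto)
  then have "r < 1" using R1 by auto
  moreover have "1/2 \<le> r" unfolding r_def using finite_C by (intro Max_ge) auto
  moreover have "R c \<le> r" if "c \<in> C" for c unfolding r_def using finite_C that by (intro Max_ge) auto
  then have "\<forall>c\<in>C. (\<Sum>i\<in>{..d} - {grp c}. \<bar>real_of_int (w c i)\<bar> * p i)
      \<le> r * (real_of_int (w c (grp c)) * p (grp c))"
    using pos by (auto simp: R_def divide_le_eq)
  ultimately show ?thesis by (intro exI[of _ r]) auto
qed

text \<open>The map \<open>step\<close> that solves each condition for its own unknown contracts the \<open>p\<close>-weighted maximum
  norm by the factor \<open>r\<close>. The differences of its iterates therefore decay geometrically, and their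
  limit is a fixed point of \<open>step\<close>.\<close>

lemma complementarity_exists:
  fixes x :: "'c \<Rightarrow> real"
  shows "\<exists>t. (\<forall>c\<in>C. 0 \<le> x c + wt_apply c t) \<and>
    (\<forall>j\<le>d. \<exists>c\<in>C. grp c = j \<and> x c + wt_apply c t = 0)"
proof -
  define rest where "rest = (\<lambda>c t. \<Sum>i\<in>{..d} - {grp c}. real_of_int (w c i) * t i)"
  have rest_diff: "rest c s - rest c t = rest c (\<lambda>i. s i - t i)" for c s t
    by (simp add: rest_def algebra_simps sum_subtractf)
  define step where "step = (\<lambda>t j. SOME \<tau>. (\<forall>c\<in>C. grp c = j \<longrightarrow> 0 \<le> real_of_int (w c j) * \<tau> + (x c + rest c t))
    \<and> (\<exists>c\<in>C. grp c = j \<and> real_of_int (w c j) * \<tau> + (x c + rest c t) = 0))"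
  have step: "(\<forall>c\<in>C. grp c = j \<longrightarrow> 0 \<le> real_of_int (w c j) * step t j + (x c + rest c t))
    \<and> (\<exists>c\<in>C. grp c = j \<and> real_of_int (w c j) * step t j + (x c + rest c t) = 0)" if "j \<le> d" for t j
    unfolding step_def by (rule someI_ex[OF one_step_exists[OF that]])
  obtain r where r: "0 < r" "r < 1" "\<And>c. c \<in> C \<Longrightarrow> (\<Sum>i\<in>{..d} - {grp c}. \<bar>real_of_int (w c i)\<bar> * p i)
      \<le> r * (real_of_int (w c (grp c)) * p (grp c))" using contraction_ratio_exists by blast
  have half: "step s j - step t j \<le> r * M * p j"
    if M: "\<And>i. i \<le> d \<Longrightarrow> \<bar>s i - t i\<bar> \<le> M * p i" "0 \<le> M" and j: "j \<le> d" for s t M j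
  proof -
    obtain c where c: "c \<in> C" "grp c = j" "real_of_int (w c j) * step s j + (x c + rest c s) = 0"
      using step[OF j, of s] by blast
    have "0 \<le> real_of_int (w c j) * step t j + (x c + rest c t)" using step[OF j, of t] c by blast
    then have "real_of_int (w c j) * (step s j - step t j) \<le> - rest c (\<lambda>i. s i - t i)"
      using c(3) rest_diff[of c s t] by (simp add: algebra_simps)
    also have "\<dots> \<le> M * (\<Sum>i\<in>{..d} - {grp c}. \<bar>real_of_int (w c i)\<bar> * p i)"
      using off_diagonal_bound[OF c(1), of "\<lambda>i. s i - t i" M] M by (simp add: rest_def)
    also have "\<dots> \<le> M * (r * (real_of_int (w c j) * p j))"
      using r(3)[OF c(1)] M(2) c(2) by (intro mult_left_mono) auto
    finally have "real_of_int (w c j) * (step s j - step t j) \<le> real_of_int (w c j) * (r * M * p j)"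
      by (simp add: mult_ac)
    then show ?thesis using w_diag_pos[OF c(1)] c(2) by simp
  qed
  have contr: "\<bar>step s j - step t j\<bar> \<le> r * M * p j"
    if "\<And>i. i \<le> d \<Longrightarrow> \<bar>s i - t i\<bar> \<le> M * p i" "0 \<le> M" "j \<le> d" for s t M j
    using half[of s t M j] half[of t s M j] that by (auto simp: abs_minus_commute abs_le_iff)
  define T where "T = (\<lambda>k. (step ^^ k) (\<lambda>_. 0))"
  have T_Suc: "T (Suc k) = step (T k)" for k by (simp add: T_def)
  define B where "B = (\<Sum>i\<le>d. \<bar>T 1 i\<bar> / p i)"
  have B0: "0 \<le> B" unfolding B_def by (intro sum_nonneg) (simp add: p_nonneg)
  have decay: "\<forall>i\<le>d. \<bar>T (Suc k) i - T k i\<bar> \<le> B * r ^ k * p i" for k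
  proof (induction k)
    case 0
    have "\<bar>T 1 i\<bar> / p i \<le> B" if "i \<le> d" for i
      unfolding B_def using that by (intro member_le_sum) (simp_all add: p_nonneg)
    then show ?case using p_pos by (auto simp: divide_le_eq T_def)
  next
    case (Suc k)
    have "\<bar>step (T (Suc k)) i - step (T k) i\<bar> \<le> r * (B * r ^ k) * p i" if "i \<le> d" for i
      by (rule contr) (use Suc B0 r that in auto)
    then show ?case by (simp add: T_Suc mult_ac)
  qed
  have conv: "convergent (\<lambda>k. T k i)" if "i \<le> d" for i
  proof -
    have "summable (\<lambda>k. B * p i * r ^ k)" using r by (intro summable_mult summable_geometric) auto
    then have "summable (\<lambda>k. T (Suc k) i - T k i)"
      by (rule summable_comparison_test'[where N=0]) (use decay that in \<open>simp add: mult_ac\<close>)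
    then have "convergent (\<lambda>n. \<Sum>k<n. T (Suc k) i - T k i)" by (simp add: summable_iff_convergent)
    moreover have "(\<Sum>k<n. T (Suc k) i - T k i) = T n i" for n
      by (subst sum_lessThan_telescope) (simp add: T_def)
    ultimately show ?thesis by simp
  qed
  define t where "t = (\<lambda>i. lim (\<lambda>k. T k i))"
  have lim: "(\<lambda>k. T k i) \<longlonglongrightarrow> t i" if "i \<le> d" for i
    using conv[OF that] by (simp add: t_def convergent_LIMSEQ_iff)
  define E where "E = (\<lambda>c k. real_of_int (w c (grp c)) * T (Suc k) (grp c) + (x c + rest c (T k)))"
  have lim_E: "E c \<longlonglongrightarrow> x c + wt_apply c t" if "c \<in> C" for c
  proof -
    have "E c \<longlonglongrightarrow> real_of_int (w c (grp c)) * t (grp c) + (x c + rest c t)"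
      unfolding E_def rest_def
      by (intro tendsto_intros LIMSEQ_Suc lim grp_le that) auto
    then show ?thesis by (simp add: wt_apply_split[OF that] rest_def algebra_simps)
  qed
  have "0 \<le> x c + wt_apply c t" if "c \<in> C" for c
    by (rule LIMSEQ_le_const[OF lim_E[OF that]])
      (use step[OF grp_le[OF that]] that in \<open>auto simp: E_def T_Suc\<close>)
  moreover have "\<exists>c\<in>C. grp c = j \<and> x c + wt_apply c t = 0" if j: "j \<le> d" for j
  proof -
    define G where "G = {c \<in> C. grp c = j}"
    have G: "finite G" using finite_C by (simp add: G_def)
    \<comment> \<open>The \<open>c\<close> with \<open>E c k = 0\<close> may vary with \<open>k\<close>, but the product over the group is always zero.\<close>
    have "(\<lambda>k. \<Prod>c\<in>G. E c k) \<longlonglongrightarrow> (\<Prod>c\<in>G. x c + wt_apply c t)"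
      by (intro tendsto_prod lim_E) (auto simp: G_def)
    moreover have "(\<Prod>c\<in>G. E c k) = 0" for k
      using step[OF j, of "T k"] G by (auto simp: E_def T_Suc G_def)
    ultimately have "(\<Prod>c\<in>G. x c + wt_apply c t) = 0" by (simp add: LIMSEQ_const_iff)
    then show ?thesis using G by (auto simp: G_def)
  qed
  ultimately show ?thesis by blast
qed

section \<open>The fan of the grading\<close>

text \<open>The lattice \<open>M\<close> of exponent vectors of weight zero is identified with \<open>\<int>\<^sup>n\<close> by listing, in the order
  \<open>e\<close>, the exponents at the coordinates other than the \<open>b j\<close>; the exponents at the \<open>b j\<close> are then
  determined.\<close>

definition n :: nat where "n = card (C - b ` {..d})"

definition e :: "nat \<Rightarrow> 'c" where "e = (SOME e. bij_betw e {..<n} (C - b ` {..d}))"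

lemma e_bij: "bij_betw e {..<n} (C - b ` {..d})"
proof -
  have "\<exists>e. bij_betw e {..<n} (C - b ` {..d})"
    unfolding n_def lessThan_atLeast0 by (rule ex_bij_betw_nat_finite) (simp add: finite_C)
  then show ?thesis unfolding e_def by (rule someI_ex)
qed

lemma e_in: "i < n \<Longrightarrow> e i \<in> C" and e_not_b: "i < n \<Longrightarrow> j \<le> d \<Longrightarrow> e i \<noteq> b j"
  using bij_betwE[OF e_bij] by auto

lemma e_inj: "i < n \<Longrightarrow> i' < n \<Longrightarrow> e i = e i' \<longleftrightarrow> i = i'"
  using e_bij by (auto simp: bij_betw_def inj_on_def)

lemma b_inj: "j \<le> d \<Longrightarrow> j' \<le> d \<Longrightarrow> b j = b j' \<longleftrightarrow> j = j'"
  using grp_b by metis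

lemma C_cases:
  assumes "c \<in> C"
  obtains (b) j where "j \<le> d" "c = b j" | (e) i where "i < n" "c = e i"
proof (cases "c \<in> b ` {..d}")
  case True then show ?thesis using b by auto
next
  case False
  then have "c \<in> e ` {..<n}" using assms bij_betw_imp_surj_on[OF e_bij] by simp
  then show ?thesis using e by auto
qed

lemma sum_C: "(\<Sum>c\<in>C. f c) = (\<Sum>i<n. f (e i)) + (\<Sum>j\<le>d. f (b j))"
proof -
  have "(\<Sum>c\<in>C. f c) = (\<Sum>c\<in>C - b ` {..d}. f c) + (\<Sum>c\<in>b ` {..d}. f c)"
    using finite_C b_in by (intro sum.subset_diff) auto
  also have "(\<Sum>c\<in>C - b ` {..d}. f c) = (\<Sum>i<n. f (e i))"
    by (rule sum.reindex_bij_betw[OF e_bij, symmetric])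
  also have "(\<Sum>c\<in>b ` {..d}. f c) = (\<Sum>j\<le>d. f (b j))"
    by (subst sum.reindex) (auto simp: inj_on_def b_inj)
  finally show ?thesis .
qed

text \<open>The exponent of \<open>c\<close> as a linear form on \<open>M\<close>.\<close>

definition v :: "'c \<Rightarrow> nat \<Rightarrow> int" where
  "v c i = (if i \<ge> n then 0 else if c \<in> b ` {..d} then - w (e i) (grp c)
     else if c = e i then 1 else 0)"

lemma v_b: "j \<le> d \<Longrightarrow> i < n \<Longrightarrow> v (b j) i = - w (e i) j"
  by (simp add: v_def grp_b)

lemma v_e: "i' < n \<Longrightarrow> i < n \<Longrightarrow> v (e i') i = (if i = i' then 1 else 0)"
  using e_not_b by (auto simp: v_def e_inj)

lemma v_ge: "i \<ge> n \<Longrightarrow> v c i = 0"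
  by (simp add: v_def)

definition vsum :: "('c \<Rightarrow> real) \<Rightarrow> nat \<Rightarrow> real" where
  "vsum y = (\<lambda>i. \<Sum>c\<in>C. y c * real_of_int (v c i))"

lemma vsum_ge: "i \<ge> n \<Longrightarrow> vsum y i = 0"
  by (simp add: vsum_def v_ge)

lemma vsum_less: "i < n \<Longrightarrow> vsum y i = y (e i) - wt_apply (e i) (\<lambda>j. y (b j))"
proof -
  assume i: "i < n"
  have "(\<Sum>i'<n. y (e i') * real_of_int (v (e i') i)) = (\<Sum>i'<n. if i' = i then y (e i) else 0)"
    by (rule sum.cong) (use i in \<open>auto simp: v_e\<close>)
  moreover have "(\<Sum>j\<le>d. y (b j) * real_of_int (v (b j) i)) = - wt_apply (e i) (\<lambda>j. y (b j))"
    unfolding wt_apply_def sum_negf[symmetric] by (rule sum.cong) (use i in \<open>auto simp: v_b\<close>)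
  ultimately show ?thesis using i by (simp add: vsum_def sum_C)
qed

lemma vsum_diff: "vsum (\<lambda>c. y c - y' c) i = vsum y i - vsum y' i"
  by (simp add: vsum_def algebra_simps sum_subtractf)

text \<open>The relations among the rays are the vectors \<open>(w\<^sub>c \<bullet> t)\<^sub>c\<close>, with \<open>t\<close> read off at the coordinates \<open>b j\<close>.\<close>

lemma vsum_eq_iff:
  "vsum y = vsum y' \<longleftrightarrow> (\<forall>c\<in>C. y c - y' c = wt_apply c (\<lambda>j. y (b j) - y' (b j)))"
proof
  assume eq: "vsum y = vsum y'"
  show "\<forall>c\<in>C. y c - y' c = wt_apply c (\<lambda>j. y (b j) - y' (b j))"
  proof
    fix c assume "c \<in> C"
    then show "y c - y' c = wt_apply c (\<lambda>j. y (b j) - y' (b j))"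
    proof (cases rule: C_cases)
      case (b j) then show ?thesis by (simp add: wt_apply_b)
    next
      case (e i)
      then show ?thesis using fun_cong[OF eq, of i] by (simp add: vsum_less wt_apply_diff)
    qed
  qed
next
  assume R: "\<forall>c\<in>C. y c - y' c = wt_apply c (\<lambda>j. y (b j) - y' (b j))"
  show "vsum y = vsum y'"
  proof
    fix i show "vsum y i = vsum y' i"
      using R e_in[of i] by (cases "i < n") (auto simp: vsum_less vsum_ge wt_apply_diff algebra_simps)
  qed
qed

text \<open>The sets of coordinates that may vanish simultaneously.\<close>

definition admissible :: "'c set \<Rightarrow> bool" where
  "admissible S \<longleftrightarrow> S \<subseteq> C \<and> (\<forall>j\<le>d. \<exists>c\<in>C - S. grp c = j)"

lemma admissible_subset: "admissible S \<Longrightarrow> S' \<subseteq> S \<Longrightarrow> admissible S'"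
  unfolding admissible_def by blast

lemma admissible_finite: "admissible S \<Longrightarrow> finite S"
  using finite_C finite_subset by (auto simp: admissible_def)

text \<open>Expressions of vectors as nonnegative combinations of rays from one cone are unique: two of them
  differ by \<open>(w\<^sub>c \<bullet> s)\<^sub>c\<close> for some \<open>s\<close>, and in each group a zero of the first and a zero of the second
  give opposite signs.\<close>

lemma cox_unique:
  assumes "vsum y = vsum y'"
    and "\<And>c. c \<in> C \<Longrightarrow> 0 \<le> y c" "\<And>j. j \<le> d \<Longrightarrow> \<exists>c\<in>C. grp c = j \<and> y c = 0"
    and "\<And>c. c \<in> C \<Longrightarrow> 0 \<le> y' c" "\<And>j. j \<le> d \<Longrightarrow> \<exists>c\<in>C. grp c = j \<and> y' c = 0"
    and "c \<in> C"
  shows "y c = y' c"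
proof -
  define s where "s = (\<lambda>j. y (b j) - y' (b j))"
  have eq: "y c - y' c = wt_apply c s" if "c \<in> C" for c
    using assms(1) that unfolding vsum_eq_iff s_def by blast
  have "s j = 0" if "j \<le> d" for j
  proof (rule sign_change_imp_zero[OF _ _ that])
    fix j assume j: "j \<le> d"
    obtain c where c: "c \<in> C" "grp c = j" "y c = 0" using assms(3)[OF j] by blast
    then have "wt_apply c s \<le> 0" using eq[of c] assms(4)[of c] by simp
    then show "\<exists>c\<in>C. grp c = j \<and> wt_apply c s \<le> 0" using c by blast
    obtain c where c: "c \<in> C" "grp c = j" "y' c = 0" using assms(5)[OF j] by blast
    then have "0 \<le> wt_apply c s" using eq[of c] assms(2)[of c] by simp
    then show "\<exists>c\<in>C. grp c = j \<and> 0 \<le> wt_apply c s" using c by blast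
  qed
  then have "wt_apply c s = 0" by (simp add: wt_apply_def)
  then show ?thesis using eq[OF assms(6)] by simp
qed

lemma cox_exists:
  assumes "x \<in> real_span n"
  shows "\<exists>y. vsum y = x \<and> (\<forall>c\<in>C. 0 \<le> y c) \<and> (\<forall>j\<le>d. \<exists>c\<in>C. grp c = j \<and> y c = 0)"
proof -
  \<comment> \<open>Any lift of \<open>x\<close> to \<open>\<real>\<^sup>C\<close> will do; this one vanishes at all \<open>b j\<close>.\<close>
  define x' where "x' = (\<lambda>c. if c \<in> b ` {..d} then 0 else x (the_inv_into {..<n} e c))"
  obtain t where t: "\<forall>c\<in>C. 0 \<le> x' c + wt_apply c t"
    "\<forall>j\<le>d. \<exists>c\<in>C. grp c = j \<and> x' c + wt_apply c t = 0" using complementarity_exists by blast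
  define y where "y = (\<lambda>c. x' c + wt_apply c t)"
  have yb: "y (b j) = t j" if "j \<le> d" for j using that by (simp add: y_def x'_def wt_apply_b)
  have "vsum y = x"
  proof
    fix i show "vsum y i = x i"
    proof (cases "i < n")
      case True
      have "x' (e i) = x i" using True e_not_b e_bij
        by (auto simp: x'_def bij_betw_def the_inv_into_f_f)
      moreover have "wt_apply (e i) (\<lambda>j. y (b j)) = wt_apply (e i) t"
        unfolding wt_apply_def by (rule sum.cong) (auto simp: yb)
      ultimately show ?thesis using True by (simp add: vsum_less) (simp add: y_def)
    next
      case False then show ?thesis using assms by (simp add: vsum_ge real_span_def)
    qed
  qed
  then show ?thesis using t by (intro exI[of _ y]) (auto simp: y_def)
qed

lemma vsum_unique_admissible:
  assumes "vsum y = vsum y'" "admissible S" "admissible S'"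
    and "\<And>c. c \<in> C \<Longrightarrow> 0 \<le> y c" "\<And>c. c \<in> C - S \<Longrightarrow> y c = 0"
    and "\<And>c. c \<in> C \<Longrightarrow> 0 \<le> y' c" "\<And>c. c \<in> C - S' \<Longrightarrow> y' c = 0"
    and "c \<in> C"
  shows "y c = y' c"
  by (rule cox_unique[OF assms(1) assms(4) _ assms(6) _ assms(8)])
    (use assms(2,3,5,7) in \<open>unfold admissible_def, blast+\<close>)

text \<open>A linear relation is an equality between its positive and its negative part.\<close>

lemma rays_independent:
  assumes "admissible S" "vsum y = (\<lambda>_. 0)" "\<And>c. c \<in> C - S \<Longrightarrow> y c = 0" "c \<in> C"
  shows "y c = 0"
proof -
  have "max 0 (y c) = max 0 (- y c)"
  proof (rule vsum_unique_admissible[OF _ assms(1) assms(1) _ _ _ _ assms(4)])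
    have "max 0 r - max 0 (- r) = r" for r :: real by simp
    then have "vsum (\<lambda>c. max 0 (y c)) i - vsum (\<lambda>c. max 0 (- y c)) i = 0" for i
      using fun_cong[OF assms(2), of i] by (simp add: vsum_diff[symmetric])
    then show "vsum (\<lambda>c. max 0 (y c)) = vsum (\<lambda>c. max 0 (- y c))" by (intro ext) simp
  qed (use assms(3) in auto)
  then show ?thesis by simp
qed

lemma v_inj: "admissible S \<Longrightarrow> inj_on v S"
proof (rule inj_onI, rule ccontr)
  fix c c' assume S: "admissible S" and c: "c \<in> S" "c' \<in> S" "v c = v c'" "c \<noteq> c'"
  have C: "c \<in> C" "c' \<in> C" using S c by (auto simp: admissible_def)
  have ind: "vsum (\<lambda>x. if x = a then 1 else 0) i = real_of_int (v a i)" if "a \<in> C" for a i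
  proof -
    have "vsum (\<lambda>x. if x = a then 1 else 0) i = (\<Sum>x\<in>C. if x = a then real_of_int (v a i) else 0)"
      unfolding vsum_def by (rule sum.cong) auto
    then show ?thesis using finite_C that by simp
  qed
  have "(if c = c then 1 else 0 :: real) = (if c = c' then 1 else 0)"
    by (rule vsum_unique_admissible[of "\<lambda>x. if x = c then 1 else 0" "\<lambda>x. if x = c' then 1 else 0" S S])
      (use S c C in \<open>auto simp: ind\<close>)
  then show False using c by simp
qed

definition ray_cone :: "'c set \<Rightarrow> (nat \<Rightarrow> real) set" where
  "ray_cone S = gen_cone (v ` S)"

lemma ray_cone_iff:
  assumes "admissible S"
  shows "x \<in> ray_cone S \<longleftrightarrow> (\<exists>y. (\<forall>c\<in>C. 0 \<le> y c) \<and> (\<forall>c\<in>C - S. y c = 0) \<and> x = vsum y)"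
proof
  assume "x \<in> ray_cone S"
  then obtain z where z: "\<forall>u\<in>v ` S. 0 \<le> z u" "x = (\<lambda>i. \<Sum>u\<in>v ` S. z u * real_of_int (u i))"
    by (auto simp: ray_cone_def gen_cone_def)
  define y where "y = (\<lambda>c. if c \<in> S then z (v c) else 0)"
  have "x = vsum y"
  proof
    fix i
    have "(\<Sum>u\<in>v ` S. z u * real_of_int (u i)) = (\<Sum>c\<in>S. z (v c) * real_of_int (v c i))"
      by (simp add: sum.reindex[OF v_inj[OF assms]])
    also have "\<dots> = vsum y i" unfolding vsum_def
      by (rule sum.mono_neutral_cong_left) (use assms finite_C in \<open>auto simp: y_def admissible_def\<close>)
    finally show "x i = vsum y i" by (simp add: z)
  qed
  then show "\<exists>y. (\<forall>c\<in>C. 0 \<le> y c) \<and> (\<forall>c\<in>C - S. y c = 0) \<and> x = vsum y"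
    using z by (intro exI[of _ y]) (auto simp: y_def)
next
  assume "\<exists>y. (\<forall>c\<in>C. 0 \<le> y c) \<and> (\<forall>c\<in>C - S. y c = 0) \<and> x = vsum y"
  then obtain y where y: "\<forall>c\<in>C. 0 \<le> y c" "\<forall>c\<in>C - S. y c = 0" "x = vsum y" by blast
  define z where "z = (\<lambda>u. y (the_inv_into S v u))"
  have z: "z (v c) = y c" if "c \<in> S" for c
    using that v_inj[OF assms] by (simp add: z_def the_inv_into_f_f)
  have "x = (\<lambda>i. \<Sum>u\<in>v ` S. z u * real_of_int (u i))"
  proof
    fix i
    have "vsum y i = (\<Sum>c\<in>S. z (v c) * real_of_int (v c i))" unfolding vsum_def
      by (rule sum.mono_neutral_cong_right) (use assms finite_C y in \<open>auto simp: z admissible_def\<close>)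
    then show "x i = (\<Sum>u\<in>v ` S. z u * real_of_int (u i))"
      by (simp add: sum.reindex[OF v_inj[OF assms]] y)
  qed
  moreover have "\<forall>u\<in>v ` S. 0 \<le> z u" using y assms by (auto simp: z admissible_def)
  ultimately show "x \<in> ray_cone S" by (auto simp: ray_cone_def gen_cone_def)
qed

lemma cone_inter:
  assumes "admissible S" "admissible S'"
  shows "ray_cone S \<inter> ray_cone S' = ray_cone (S \<inter> S')"
proof -
  have SS: "admissible (S \<inter> S')" by (rule admissible_subset[OF assms(1)]) simp
  show ?thesis
  proof (intro subset_antisym subsetI)
    fix x assume x: "x \<in> ray_cone S \<inter> ray_cone S'"
    then obtain y where y: "\<forall>c\<in>C. 0 \<le> y c" "\<forall>c\<in>C - S. y c = 0" "x = vsum y"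
      using ray_cone_iff[OF assms(1)] by auto
    obtain y' where y': "\<forall>c\<in>C. 0 \<le> y' c" "\<forall>c\<in>C - S'. y' c = 0" "x = vsum y'"
      using x ray_cone_iff[OF assms(2)] by auto
    have "y c = y' c" if "c \<in> C" for c
      by (rule vsum_unique_admissible[OF _ assms]) (use y y' that in auto)
    then show "x \<in> ray_cone (S \<inter> S')" unfolding ray_cone_iff[OF SS] using y y'
      by (intro exI[of _ y]) auto
  qed (use ray_cone_iff[OF SS] ray_cone_iff[OF assms(1)] ray_cone_iff[OF assms(2)] in auto)
qed

lemma cone_subset_imp:
  assumes "admissible S" "admissible S'" "ray_cone S \<subseteq> ray_cone S'"
  shows "S \<subseteq> S'"
proof
  fix c assume c: "c \<in> S"
  then have C: "c \<in> C" using assms(1) by (auto simp: admissible_def)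
  define y where "y = (\<lambda>x. if x = c then 1 else 0 :: real)"
  have "vsum y \<in> ray_cone S" unfolding ray_cone_iff[OF assms(1)]
    by (intro exI[of _ y]) (use c in \<open>auto simp: y_def\<close>)
  then obtain y' where y': "\<forall>c\<in>C. 0 \<le> y' c" "\<forall>c\<in>C - S'. y' c = 0" "vsum y = vsum y'"
    using assms(3) ray_cone_iff[OF assms(2)] by blast
  have "y c = y' c"
    by (rule vsum_unique_admissible[OF _ assms(1,2)]) (use y' c C in \<open>auto simp: y_def\<close>)
  then have "y' c \<noteq> 0" by (simp add: y_def)
  then show "c \<in> S'" using y'(2) C by blast
qed

text \<open>The embedding of \<open>M\<close> into \<open>\<int>\<^sup>C\<close>, with image \<open>relations\<close> and inverse \<open>lift\<close>.\<close>

definition exponent :: "(nat \<Rightarrow> int) \<Rightarrow> 'c \<Rightarrow> int" where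
  "exponent m c = (if c \<in> C then (\<Sum>i<n. m i * v c i) else 0)"

definition relations :: "('c \<Rightarrow> int) set" where
  "relations = {k. (\<forall>c. c \<notin> C \<longrightarrow> k c = 0) \<and> (\<forall>j\<le>d. (\<Sum>c\<in>C. k c * w c j) = 0)}"

definition lift :: "('c \<Rightarrow> int) \<Rightarrow> nat \<Rightarrow> int" where
  "lift k i = (if i < n then k (e i) else 0)"

lemma exponent_e: "i < n \<Longrightarrow> exponent m (e i) = m i"
proof -
  assume i: "i < n"
  have "(\<Sum>i'<n. m i' * v (e i) i') = (\<Sum>i'<n. if i' = i then m i else 0)"
    by (rule sum.cong) (use i in \<open>auto simp: v_e\<close>)
  then show ?thesis using i e_in by (simp add: exponent_def)
qed

lemma exponent_b: "j \<le> d \<Longrightarrow> exponent m (b j) = - (\<Sum>i<n. m i * w (e i) j)"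
  by (simp add: exponent_def b_in v_b sum_negf)

lemma exponent_relations: "exponent m \<in> relations"
proof -
  have "(\<Sum>c\<in>C. exponent m c * w c j) = 0" if j: "j \<le> d" for j
  proof -
    have "(\<Sum>j'\<le>d. exponent m (b j') * w (b j') j) = (\<Sum>j'\<le>d. if j' = j then exponent m (b j) else 0)"
      by (rule sum.cong) (use j in \<open>auto simp: w_b\<close>)
    then show ?thesis using j by (simp add: sum_C exponent_e exponent_b)
  qed
  then show ?thesis by (auto simp: relations_def exponent_def)
qed

lemma lift_lattice: "lift k \<in> int_lattice n"
  by (simp add: lift_def int_lattice_def)

lemma exponent_lift:
  assumes "k \<in> relations"
  shows "exponent (lift k) = k"
proof
  fix c
  show "exponent (lift k) c = k c"
  proof (cases "c \<in> C")
    case True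
    then show ?thesis
    proof (cases rule: C_cases)
      case (b j)
      have "(\<Sum>j'\<le>d. k (b j') * w (b j') j) = (\<Sum>j'\<le>d. if j' = j then k (b j) else 0)"
        by (rule sum.cong) (use b in \<open>auto simp: w_b\<close>)
      moreover have "(\<Sum>c\<in>C. k c * w c j) = 0" using assms b by (simp add: relations_def)
      ultimately have "k (b j) = - (\<Sum>i<n. k (e i) * w (e i) j)" using b by (simp add: sum_C)
      then show ?thesis using b by (simp add: exponent_b lift_def)
    next
      case (e i) then show ?thesis by (simp add: exponent_e lift_def)
    qed
  next
    case False then show ?thesis using assms by (simp add: exponent_def relations_def)
  qed
qed

lemma lift_exponent: "m \<in> int_lattice n \<Longrightarrow> lift (exponent m) = m"
  by (auto simp: lift_def exponent_e int_lattice_def)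

lemma exponent_add: "exponent (\<lambda>i. m i + m' i) c = exponent m c + exponent m' c"
  by (simp add: exponent_def algebra_simps sum.distrib)

lemma exponent_zero: "exponent (\<lambda>_. 0) c = 0"
  by (simp add: exponent_def)

lemma exponent_scale: "exponent (\<lambda>i. q * m i) c = q * exponent m c"
  by (simp add: exponent_def sum_distrib_left mult_ac)

lemma exponent_uminus: "exponent (\<lambda>i. - m i) c = - exponent m c"
  by (simp add: exponent_def sum_negf)

lemma pairing_vsum: "pairing n m (vsum y) = (\<Sum>c\<in>C. y c * (\<Sum>i<n. m i * real_of_int (v c i)))"
  unfolding pairing_def vsum_def sum_distrib_left by (subst sum.swap) (simp add: mult_ac)

lemma pairing_int_vsum:
  "pairing n (\<lambda>i. real_of_int (m i)) (vsum y) = (\<Sum>c\<in>C. y c * real_of_int (exponent m c))"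
  by (simp add: pairing_vsum exponent_def)

lemma ray_in_cone:
  assumes "admissible S" "c \<in> S"
  obtains y where "vsum y \<in> ray_cone S" "\<And>f. (\<Sum>c\<in>C. y c * f c) = (f c :: real)"
proof
  let ?y = "\<lambda>x. if x = c then 1 else 0 :: real"
  show "vsum ?y \<in> ray_cone S" unfolding ray_cone_iff[OF assms(1)]
    by (intro exI[of _ ?y]) (use assms in auto)
  have c: "c \<in> C" using assms by (auto simp: admissible_def)
  have "(\<Sum>x\<in>C. ?y x * f x) = (\<Sum>x\<in>C. if x = c then f c else 0)" for f by (rule sum.cong) auto
  then show "(\<Sum>c\<in>C. ?y c * f c) = f c" for f using c finite_C by simp
qed

lemma dual_cone_iff:
  assumes "admissible S"
  shows "m \<in> dual_cone n (ray_cone S) \<longleftrightarrow> m \<in> real_span n \<and> (\<forall>c\<in>S. 0 \<le> (\<Sum>i<n. m i * real_of_int (v c i)))"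
proof (intro iffI conjI ballI)
  assume m: "m \<in> dual_cone n (ray_cone S)"
  then show "m \<in> real_span n" by (simp add: dual_cone_def)
  fix c assume "c \<in> S"
  then obtain y where y: "vsum y \<in> ray_cone S" "\<And>f. (\<Sum>c\<in>C. y c * f c) = (f c :: real)"
    using ray_in_cone[OF assms] by blast
  then show "0 \<le> (\<Sum>i<n. m i * real_of_int (v c i))"
    using m pairing_vsum[of m y] by (auto simp: dual_cone_def)
next
  assume m: "m \<in> real_span n \<and> (\<forall>c\<in>S. 0 \<le> (\<Sum>i<n. m i * real_of_int (v c i)))"
  have "0 \<le> pairing n m x" if x: "x \<in> ray_cone S" for x
  proof -
    obtain y where y: "\<forall>c\<in>C. 0 \<le> y c" "\<forall>c\<in>C - S. y c = 0" "x = vsum y"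
      using x ray_cone_iff[OF assms] by blast
    have "0 \<le> (\<Sum>c\<in>C. y c * (\<Sum>i<n. m i * real_of_int (v c i)))"
    proof (rule sum_nonneg)
      fix c assume "c \<in> C"
      then show "0 \<le> y c * (\<Sum>i<n. m i * real_of_int (v c i))" using y m by (cases "c \<in> S") auto
    qed
    then show ?thesis by (simp add: y pairing_vsum)
  qed
  then show "m \<in> dual_cone n (ray_cone S)" using m by (simp add: dual_cone_def)
qed

lemma dual_monoid_iff:
  assumes "admissible S"
  shows "m \<in> dual_monoid n (ray_cone S) \<longleftrightarrow> m \<in> int_lattice n \<and> (\<forall>c\<in>S. 0 \<le> exponent m c)"
proof -
  have "(\<Sum>i<n. real_of_int (m i) * real_of_int (v c i)) = real_of_int (exponent m c)" if "c \<in> S" for c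
    using that assms by (auto simp: exponent_def admissible_def)
  then show ?thesis
    by (auto simp: dual_monoid_def dual_cone_iff[OF assms] real_span_def int_lattice_def simp del: of_int_sum)
qed

text \<open>The weights of the coordinates outside \<open>S\<close> span a sublattice of finite index, since they contain
  one weight of each group.\<close>

lemma multiple_of_weight_spanned:
  assumes S: "admissible S"
  shows "\<exists>N k. 0 < (N :: nat) \<and> (\<forall>c. c \<notin> C - S \<longrightarrow> k c = 0) \<and>
    (\<forall>i\<le>d. (\<Sum>c\<in>C. k c * w c i) + int N * \<eta> i = 0)"
proof -
  obtain s where s: "\<And>j. j \<le> d \<Longrightarrow> s j \<in> C - S \<and> grp (s j) = j"
    using S unfolding admissible_def by metis
  have inj: "inj_on s {..d}" using s by (metis atMost_iff inj_onI)
  obtain k where k: "\<exists>j\<in>{..Suc d}. k j \<noteq> 0"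
    "\<And>i. i \<in> {..d} \<Longrightarrow> (\<Sum>j\<le>Suc d. k j * (if j \<le> d then w (s j) i else \<eta> i)) = 0"
    using nontrivial_integer_solution[of "{..d}" "{..Suc d}" "\<lambda>j i. if j \<le> d then w (s j) i else \<eta> i"]
    by auto
  have rel: "(\<Sum>j\<le>d. k j * w (s j) i) + k (Suc d) * \<eta> i = 0" if "i \<le> d" for i
    using k(2)[of i] that by (simp cong: sum.cong_simp)
  have k0: "k (Suc d) \<noteq> 0"
  proof
    assume 0: "k (Suc d) = 0"
    have "k j = 0" if "j \<le> d" for j
      by (rule transversal_independent[of s k, OF _ _ that]) (use s rel 0 in auto)
    then show False using k(1) 0 by (auto simp: le_Suc_eq)
  qed
  define k' where "k' = (\<lambda>c. if c \<in> s ` {..d} then sgn (k (Suc d)) * k (grp c) else 0)"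
  have sum: "(\<Sum>c\<in>C. k' c * w c i) = sgn (k (Suc d)) * (\<Sum>j\<le>d. k j * w (s j) i)" for i
  proof -
    have "(\<Sum>c\<in>C. k' c * w c i) = (\<Sum>c\<in>s ` {..d}. k' c * w c i)"
      by (rule sum.mono_neutral_right) (use finite_C s in \<open>auto simp: k'_def\<close>)
    also have "\<dots> = (\<Sum>j\<le>d. k' (s j) * w (s j) i)" by (simp add: sum.reindex[OF inj])
    also have "\<dots> = (\<Sum>j\<le>d. sgn (k (Suc d)) * (k j * w (s j) i))"
      by (rule sum.cong) (use s in \<open>auto simp: k'_def\<close>)
    finally show ?thesis by (simp add: sum_distrib_left)
  qed
  have "(\<Sum>c\<in>C. k' c * w c i) + int (nat \<bar>k (Suc d)\<bar>) * \<eta> i = 0" if "i \<le> d" for i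
  proof -
    have "(\<Sum>c\<in>C. k' c * w c i) + int (nat \<bar>k (Suc d)\<bar>) * \<eta> i
        = sgn (k (Suc d)) * ((\<Sum>j\<le>d. k j * w (s j) i) + k (Suc d) * \<eta> i)"
      unfolding sum by (auto simp: sgn_if abs_if algebra_simps)
    then show ?thesis using rel[OF that] by simp
  qed
  moreover have "k' c = 0" if "c \<notin> C - S" for c using that s by (auto simp: k'_def)
  ultimately show ?thesis using k0 by (intro exI[of _ "nat \<bar>k (Suc d)\<bar>"] exI[of _ k']) auto
qed

text \<open>Up to a positive multiple, the dual basis of the rays of the cone of \<open>S\<close>.\<close>

lemma relation_dual_to_ray:
  assumes S: "admissible S" and a: "a \<in> S"
  shows "\<exists>k\<in>relations. 0 < k a \<and> (\<forall>c\<in>S - {a}. k c = 0)"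
proof -
  have aC: "a \<in> C" using S a by (auto simp: admissible_def)
  obtain N k where k: "0 < (N :: nat)" "\<forall>c. c \<notin> C - S \<longrightarrow> k c = 0"
    "\<forall>i\<le>d. (\<Sum>c\<in>C. k c * w c i) + int N * w a i = 0"
    using multiple_of_weight_spanned[OF S, of "w a"] by blast
  have "(\<Sum>c\<in>C. (k(a := int N)) c * w c i) = (\<Sum>c\<in>C. k c * w c i) + int N * w a i" for i
    using k(2) a by (simp add: sum.remove[OF finite_C aC] cong: sum.cong_simp)
  then have "k(a := int N) \<in> relations" using k(2,3) aC by (auto simp: relations_def)
  then show ?thesis using k a by (intro bexI[of _ "k(a := int N)"]) auto
qed

text \<open>A sum of dual basis vectors defines the face spanned by a given set of rays.\<close>

lemma supporting_character_exists:
  assumes S: "admissible S" and "T \<subseteq> S"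
  shows "\<exists>m\<in>int_lattice n. (\<forall>c\<in>T. exponent m c = 0) \<and> (\<forall>c\<in>S - T. 0 < exponent m c)"
proof -
  obtain f where f: "\<And>a. a \<in> S \<Longrightarrow> f a \<in> relations \<and> 0 < f a a \<and> (\<forall>c\<in>S - {a}. f a c = 0)"
    using relation_dual_to_ray[OF S] by metis
  define k where "k = (\<lambda>c. \<Sum>a\<in>S - T. f a c)"
  have fin: "finite S" by (rule admissible_finite[OF S])
  have "(\<Sum>c\<in>C. k c * w c j) = (\<Sum>a\<in>S - T. \<Sum>c\<in>C. f a c * w c j)" for j
    unfolding k_def sum_distrib_right by (rule sum.swap)
  then have rel: "k \<in> relations" using f unfolding relations_def k_def by simp
  have kc: "k c = (if c \<in> T then 0 else f c c)" if "c \<in> S" for c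
  proof -
    have "k c = (\<Sum>a\<in>S - T. if a = c then f c c else 0)" unfolding k_def
      by (rule sum.cong) (use f that in auto)
    then show ?thesis using fin that by simp
  qed
  show ?thesis
    by (rule bexI[of _ "lift k", OF _ lift_lattice])
      (use kc f assms(2) in \<open>auto simp: exponent_lift[OF rel]\<close>)
qed

lemma cone_face_subset:
  assumes "admissible S" "T \<subseteq> S"
  shows "cone_face n (ray_cone T) (ray_cone S)"
proof -
  obtain m where m: "m \<in> int_lattice n" "\<forall>c\<in>T. exponent m c = 0" "\<forall>c\<in>S - T. 0 < exponent m c"
    using supporting_character_exists[OF assms] by blast
  have T: "admissible T" by (rule admissible_subset[OF assms])
  have "m \<in> dual_monoid n (ray_cone S)" unfolding dual_monoid_iff[OF assms(1)]
    using m by (metis DiffI less_imp_le order_refl)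
  then have "(\<lambda>i. real_of_int (m i)) \<in> dual_cone n (ray_cone S)" by (simp add: dual_monoid_def)
  moreover have "ray_cone T = {x \<in> ray_cone S. pairing n (\<lambda>i. real_of_int (m i)) x = 0}"
  proof (intro subset_antisym subsetI)
    fix x assume "x \<in> ray_cone T"
    then obtain y where y: "\<forall>c\<in>C. 0 \<le> y c" "\<forall>c\<in>C - T. y c = 0" "x = vsum y"
      using ray_cone_iff[OF T] by blast
    have "y c * real_of_int (exponent m c) = 0" if "c \<in> C" for c
      using that y m by (cases "c \<in> T") auto
    then have "pairing n (\<lambda>i. real_of_int (m i)) x = 0"
      unfolding y(3) pairing_int_vsum by (intro sum.neutral) blast
    moreover have "x \<in> ray_cone S" unfolding ray_cone_iff[OF assms(1)]
      by (intro exI[of _ y]) (use y assms(2) in auto)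
    ultimately show "x \<in> {x \<in> ray_cone S. pairing n (\<lambda>i. real_of_int (m i)) x = 0}" by simp
  next
    fix x assume "x \<in> {x \<in> ray_cone S. pairing n (\<lambda>i. real_of_int (m i)) x = 0}"
    then obtain y where y: "\<forall>c\<in>C. 0 \<le> y c" "\<forall>c\<in>C - S. y c = 0" "x = vsum y"
      and 0: "pairing n (\<lambda>i. real_of_int (m i)) x = 0"
      using ray_cone_iff[OF assms(1)] by blast
    have nonneg: "0 \<le> y c * real_of_int (exponent m c)" if "c \<in> C" for c
    proof (cases "c \<in> S")
      case True
      then have "0 \<le> exponent m c" using m(2,3) by (cases "c \<in> T") (auto intro: less_imp_le)
      then show ?thesis using y that by simp
    qed (use y that in auto)
    have "\<forall>c\<in>C. y c * real_of_int (exponent m c) = 0"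
      using 0 sum_nonneg_eq_0_iff[OF finite_C, of "\<lambda>c. y c * real_of_int (exponent m c)"] nonneg
      by (simp add: y pairing_int_vsum)
    then have "y c = 0" if "c \<in> C - T" for c
    proof (cases "c \<in> S")
      case True
      then have "exponent m c \<noteq> 0" using m(3) that by force
      moreover have "y c * real_of_int (exponent m c) = 0"
        using \<open>\<forall>c\<in>C. y c * real_of_int (exponent m c) = 0\<close> that by blast
      ultimately show ?thesis by simp
    qed (use that y(2) in blast)
    then show "x \<in> ray_cone T" unfolding ray_cone_iff[OF T] using y by (intro exI[of _ y]) auto
  qed
  ultimately show ?thesis unfolding cone_face_def by blast
qed

lemma face_is_cone:
  assumes "admissible S" "cone_face n \<tau> (ray_cone S)"
  shows "\<exists>T\<subseteq>S. \<tau> = ray_cone T"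
proof -
  obtain m where m: "m \<in> dual_cone n (ray_cone S)" "\<tau> = {x \<in> ray_cone S. pairing n m x = 0}"
    using assms(2) unfolding cone_face_def by blast
  define f where "f = (\<lambda>c. \<Sum>i<n. m i * real_of_int (v c i))"
  have pairing_f: "pairing n m (vsum y) = (\<Sum>c\<in>C. y c * f c)" for y
    by (simp add: pairing_vsum f_def)
  have f: "0 \<le> f c" if "c \<in> S" for c using m(1) that by (simp add: dual_cone_iff[OF assms(1)] f_def)
  define T where "T = {c \<in> S. f c = 0}"
  have T: "admissible T" by (rule admissible_subset[OF assms(1)]) (simp add: T_def)
  have "\<tau> = ray_cone T"
  proof (intro subset_antisym subsetI)
    fix x assume "x \<in> \<tau>"
    then obtain y where y: "\<forall>c\<in>C. 0 \<le> y c" "\<forall>c\<in>C - S. y c = 0" "x = vsum y"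
      and 0: "pairing n m x = 0" using ray_cone_iff[OF assms(1)] m(2) by blast
    have nonneg: "0 \<le> y c * f c" if "c \<in> C" for c using y f that by (cases "c \<in> S") auto
    have "\<forall>c\<in>C. y c * f c = 0"
      using 0 sum_nonneg_eq_0_iff[OF finite_C, of "\<lambda>c. y c * f c"] nonneg
      by (simp add: y pairing_f)
    then have "y c = 0" if "c \<in> C - T" for c using that y by (cases "c \<in> S") (auto simp: T_def)
    then show "x \<in> ray_cone T" unfolding ray_cone_iff[OF T] using y by (intro exI[of _ y]) auto
  next
    fix x assume "x \<in> ray_cone T"
    then obtain y where y: "\<forall>c\<in>C. 0 \<le> y c" "\<forall>c\<in>C - T. y c = 0" "x = vsum y"
      using ray_cone_iff[OF T] by blast
    have "y c * f c = 0" if "c \<in> C" for c using that y by (cases "c \<in> T") (auto simp: T_def)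
    then have "pairing n m x = 0"
      unfolding y(3) pairing_f by (intro sum.neutral) blast
    moreover have "x \<in> ray_cone S" unfolding ray_cone_iff[OF assms(1)]
      by (intro exI[of _ y]) (use y in \<open>auto simp: T_def\<close>)
    ultimately show "x \<in> \<tau>" using m(2) by simp
  qed
  then show ?thesis by (intro exI[of _ T]) (auto simp: T_def)
qed

definition cones :: "(nat \<Rightarrow> real) set set" where
  "cones = ray_cone ` {S. admissible S}"

lemma rays_in_lattice: "v ` S \<subseteq> int_lattice n"
  by (auto simp: int_lattice_def v_ge)

lemma cone_strongly_convex:
  assumes "admissible S"
  shows "strongly_convex (ray_cone S)"
  unfolding strongly_convex_def
proof (intro ballI impI)
  fix x assume "x \<in> ray_cone S" "(\<lambda>i. - x i) \<in> ray_cone S"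
  then obtain y y' where y: "\<forall>c\<in>C. 0 \<le> y c" "\<forall>c\<in>C - S. y c = 0" "x = vsum y"
    and y': "\<forall>c\<in>C. 0 \<le> y' c" "\<forall>c\<in>C - S. y' c = 0" "(\<lambda>i. - x i) = vsum y'"
    unfolding ray_cone_iff[OF assms] by blast
  have "vsum (\<lambda>c. y c + y' c) i = 0" for i
    using fun_cong[OF y(3), of i] fun_cong[OF y'(3), of i]
    by (simp add: vsum_def distrib_right sum.distrib)
  then have zero: "vsum (\<lambda>c. y c + y' c) = (\<lambda>_. 0)" by blast
  have "y c = 0" if "c \<in> C" for c
  proof -
    have "y c + y' c = 0"
      by (rule rays_independent[OF assms zero _ that]) (use y(2) y'(2) in auto)
    then show ?thesis using y(1)[rule_format, OF that] y'(1)[rule_format, OF that] by linarith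
  qed
  then show "x = (\<lambda>_. 0)" by (simp add: y vsum_def)
qed

lemma cones_fan: "fan n cones"
  unfolding fan_def
proof (intro conjI ballI allI impI)
  have "{S. admissible S} \<subseteq> Pow C" by (auto simp: admissible_def)
  then show "finite cones" unfolding cones_def using finite_C finite_subset by blast
next
  fix \<sigma> assume "\<sigma> \<in> cones"
  then obtain S where S: "admissible S" "\<sigma> = ray_cone S" by (auto simp: cones_def)
  show "rational_polyhedral_cone n \<sigma>" unfolding rational_polyhedral_cone_def
    by (intro exI[of _ "v ` S"]) (use S rays_in_lattice admissible_finite in \<open>auto simp: ray_cone_def\<close>)
  show "strongly_convex \<sigma>" using S cone_strongly_convex by simp
  fix \<tau> assume "cone_face n \<tau> \<sigma>"
  then obtain T where "T \<subseteq> S" "\<tau> = ray_cone T" using face_is_cone S by blast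
  then show "\<tau> \<in> cones" using S admissible_subset by (auto simp: cones_def)
next
  fix \<sigma> \<sigma>' assume "\<sigma> \<in> cones" "\<sigma>' \<in> cones"
  then obtain S S' where S: "admissible S" "\<sigma> = ray_cone S" "admissible S'" "\<sigma>' = ray_cone S'"
    by (auto simp: cones_def)
  show "cone_face n (\<sigma> \<inter> \<sigma>') \<sigma>" "cone_face n (\<sigma> \<inter> \<sigma>') \<sigma>'"
    using S by (auto simp: cone_inter intro: cone_face_subset)
qed

lemma cones_simplicial: "simplicial_fan n cones"
  unfolding simplicial_fan_def
proof (intro conjI ballI)
  fix \<sigma> assume "\<sigma> \<in> cones"
  then obtain S where S: "admissible S" "\<sigma> = ray_cone S" by (auto simp: cones_def)
  have "lin_indep (v ` S)" unfolding lin_indep_def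
  proof (intro allI impI ballI)
    fix r :: "(nat \<Rightarrow> int) \<Rightarrow> real" and u
    assume r: "\<forall>i. (\<Sum>u\<in>v ` S. r u * real_of_int (u i)) = 0" and "u \<in> v ` S"
    then obtain c where c: "c \<in> S" "u = v c" by blast
    define y where "y = (\<lambda>c. if c \<in> S then r (v c) else 0)"
    have "vsum y i = 0" for i
    proof -
      have "vsum y i = (\<Sum>c\<in>S. r (v c) * real_of_int (v c i))" unfolding vsum_def
        by (rule sum.mono_neutral_cong_right) (use S finite_C in \<open>auto simp: y_def admissible_def\<close>)
      then show ?thesis using r by (simp add: sum.reindex[OF v_inj[OF S(1)]])
    qed
    then have zero: "vsum y = (\<lambda>_. 0)" by blast
    have cC: "c \<in> C" using S(1) c(1) by (auto simp: admissible_def)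
    have "y c = 0" by (rule rays_independent[OF S(1) zero _ cC]) (simp add: y_def)
    then show "r u = 0" using c by (simp add: y_def)
  qed
  then show "\<exists>S. S \<subseteq> int_lattice n \<and> finite S \<and> lin_indep S \<and> \<sigma> = gen_cone S"
    using S rays_in_lattice admissible_finite by (intro exI[of _ "v ` S"]) (auto simp: ray_cone_def)
qed (rule cones_fan)

lemma cones_complete: "complete_fan n cones"
  unfolding complete_fan_def
proof (intro conjI subset_antisym subsetI)
  fix x assume "x \<in> \<Union>cones"
  then obtain S where "admissible S" "x \<in> ray_cone S" by (auto simp: cones_def)
  then show "x \<in> real_span n" by (auto simp: ray_cone_iff real_span_def vsum_ge)
next
  fix x assume "x \<in> real_span n"
  then obtain y where y: "vsum y = x" "\<forall>c\<in>C. 0 \<le> y c" "\<forall>j\<le>d. \<exists>c\<in>C. grp c = j \<and> y c = 0"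
    using cox_exists by blast
  define S where "S = {c \<in> C. y c \<noteq> 0}"
  have S: "admissible S" using y(3) by (auto simp: admissible_def S_def)
  have "x \<in> ray_cone S" unfolding ray_cone_iff[OF S]
    by (intro exI[of _ y]) (use y in \<open>auto simp: S_def\<close>)
  then show "x \<in> \<Union>cones" using S by (auto simp: cones_def)
qed (rule cones_fan)

end

section \<open>Points of the charts\<close>

lemma powi_add_if_nonneg:
  fixes z :: "'a::field"
  assumes "z \<noteq> 0 \<or> (0 \<le> i \<and> 0 \<le> j)"
  shows "z powi (i + j) = z powi i * z powi j"
proof (cases "z = 0")
  case True
  then show ?thesis using assms by (cases "i = 0"; cases "j = 0") (auto simp: power_int_0_left add_nonneg_eq_0_iff)
qed (simp add: power_int_add)

context dominant_grading
begin

definition monomial :: "('c \<Rightarrow> complex) \<Rightarrow> ('c \<Rightarrow> int) \<Rightarrow> complex" where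
  "monomial x k = (\<Prod>c\<in>C. x c powi k c)"

text \<open>Entries beyond \<open>d\<close> are set to zero, so that weights can be compared as functions.\<close>

definition weight :: "('c \<Rightarrow> int) \<Rightarrow> nat \<Rightarrow> int" where
  "weight k j = (if j \<le> d then \<Sum>c\<in>C. k c * w c j else 0)"

definition character :: "(nat \<Rightarrow> complex) \<Rightarrow> (nat \<Rightarrow> int) \<Rightarrow> complex" where
  "character l \<eta> = (\<Prod>j\<le>d. l j powi \<eta> j)"

definition act :: "(nat \<Rightarrow> complex) \<Rightarrow> ('c \<Rightarrow> complex) \<Rightarrow> 'c \<Rightarrow> complex" where
  "act l x c = (if c \<in> C then character l (w c) * x c else 0)"

definition stable_points :: "('c \<Rightarrow> complex) set" where
  "stable_points = {x. (\<forall>c. c \<notin> C \<longrightarrow> x c = 0) \<and> (\<forall>j\<le>d. \<exists>c\<in>C. grp c = j \<and> x c \<noteq> 0)}"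

definition chart_domain :: "'c set \<Rightarrow> ('c \<Rightarrow> complex) set" where
  "chart_domain S = {x. (\<forall>c. c \<notin> C \<longrightarrow> x c = 0) \<and> (\<forall>c\<in>C - S. x c \<noteq> 0)}"

lemma monomial_add:
  assumes "\<And>c. c \<in> C \<Longrightarrow> x c \<noteq> 0 \<or> (0 \<le> k c \<and> 0 \<le> k' c)"
  shows "monomial x (\<lambda>c. k c + k' c) = monomial x k * monomial x k'"
  unfolding monomial_def prod.distrib[symmetric]
  by (rule prod.cong[OF refl]) (use assms powi_add_if_nonneg in auto)

lemma monomial_add_chart:
  assumes "x \<in> chart_domain S" "\<And>c. c \<in> S \<Longrightarrow> 0 \<le> k c" "\<And>c. c \<in> S \<Longrightarrow> 0 \<le> k' c"
  shows "monomial x (\<lambda>c. k c + k' c) = monomial x k * monomial x k'"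
  by (rule monomial_add) (use assms in \<open>auto simp: chart_domain_def\<close>)

lemma monomial_zero [simp]: "monomial x (\<lambda>_. 0) = 1"
  by (simp add: monomial_def)

lemma monomial_scale_nat: "monomial x (\<lambda>c. int N * k c) = monomial x k ^ N"
proof -
  have "z powi (int N * i) = (z powi i) ^ N" for z :: complex and i
    using power_int_mult[of z i "int N"] by (simp add: mult.commute)
  then show ?thesis by (simp add: monomial_def prod_power_distrib)
qed

lemma monomial_eq_0_iff: "monomial x k = 0 \<longleftrightarrow> (\<exists>c\<in>C. x c = 0 \<and> k c \<noteq> 0)"
  using finite_C by (auto simp: monomial_def power_int_eq_0_iff)

lemma character_nz: "l \<in> torus d \<Longrightarrow> character l \<eta> \<noteq> 0"
  by (auto simp: character_def torus_def power_int_eq_0_iff)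

lemma character_mult: "character (\<lambda>j. l j * l' j) \<eta> = character l \<eta> * character l' \<eta>"
  by (simp add: character_def power_int_mult_distrib prod.distrib)

lemma torus_mult: "l \<in> torus d \<Longrightarrow> l' \<in> torus d \<Longrightarrow> (\<lambda>j. l j * l' j) \<in> torus d"
  by (simp add: torus_def)

lemma act_in_chart: "l \<in> torus d \<Longrightarrow> act l x \<in> chart_domain S \<longleftrightarrow> (\<forall>c\<in>C - S. x c \<noteq> 0)"
  by (auto simp: act_def chart_domain_def character_nz)

lemma act_stable: "l \<in> torus d \<Longrightarrow> x \<in> stable_points \<Longrightarrow> act l x \<in> stable_points"
  by (auto simp: act_def stable_points_def character_nz)

lemma monomial_act:
  assumes "l \<in> torus d"
  shows "monomial (act l x) k = character l (weight k) * monomial x k"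
proof -
  have lnz: "l j \<noteq> 0" if "j \<le> d" for j using assms that by (simp add: torus_def)
  have "monomial (act l x) k = (\<Prod>c\<in>C. character l (w c) powi k c) * monomial x k"
    unfolding monomial_def prod.distrib[symmetric]
    by (rule prod.cong) (auto simp: act_def power_int_mult_distrib)
  also have "(\<Prod>c\<in>C. character l (w c) powi k c) = (\<Prod>c\<in>C. \<Prod>j\<le>d. l j powi (k c * w c j))"
    unfolding character_def powi_prod by (simp add: power_int_mult[symmetric] mult.commute)
  also have "\<dots> = (\<Prod>j\<le>d. \<Prod>c\<in>C. l j powi (k c * w c j))" by (rule prod.swap)
  also have "\<dots> = (\<Prod>j\<le>d. l j powi weight k j)"
    by (rule prod.cong) (auto simp: weight_def prod_powi_sum lnz)
  finally show ?thesis by (simp add: character_def)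
qed

lemma weight_relation: "k \<in> relations \<Longrightarrow> weight k = (\<lambda>_. 0)"
  by (auto simp: relations_def weight_def)

lemma weight_add: "weight (\<lambda>c. k c + k' c) j = weight k j + weight k' j"
  by (simp add: weight_def distrib_right sum.distrib)

lemma chart_domain_stable: "admissible S \<Longrightarrow> chart_domain S \<subseteq> stable_points"
  unfolding admissible_def chart_domain_def stable_points_def by blast

lemma stable_point_in_chart:
  assumes "x \<in> stable_points"
  shows "admissible {c \<in> C. x c = 0}" "x \<in> chart_domain {c \<in> C. x c = 0}"
  using assms by (auto simp: admissible_def chart_domain_def stable_points_def)

definition chart_map :: "'c set \<Rightarrow> ('c \<Rightarrow> complex) \<Rightarrow> (nat \<Rightarrow> int) \<Rightarrow> complex" where
  "chart_map S x = restrict (\<lambda>m. monomial x (exponent m)) (dual_monoid n (ray_cone S))"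

lemma exponent_add': "exponent (\<lambda>i. m i + m' i) = (\<lambda>c. exponent m c + exponent m' c)"
  by (auto simp: exponent_add)

lemma exponent_scale': "exponent (\<lambda>i. q * m i) = (\<lambda>c. q * exponent m c)"
  by (auto simp: exponent_scale)

lemma exponent_zero': "exponent (\<lambda>_. 0) = (\<lambda>_. 0)"
  by (auto simp: exponent_zero)

lemma lattice_add: "m \<in> int_lattice n \<Longrightarrow> m' \<in> int_lattice n \<Longrightarrow> (\<lambda>i. m i + m' i) \<in> int_lattice n"
  by (simp add: int_lattice_def)

lemma lattice_scale: "m \<in> int_lattice n \<Longrightarrow> (\<lambda>i. q * m i) \<in> int_lattice n"
  by (simp add: int_lattice_def)

lemma dual_monoid_add:
  assumes "admissible S" "m \<in> dual_monoid n (ray_cone S)" "m' \<in> dual_monoid n (ray_cone S)"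
  shows "(\<lambda>i. m i + m' i) \<in> dual_monoid n (ray_cone S)"
  using assms(2,3) by (auto simp: dual_monoid_iff[OF assms(1)] lattice_add exponent_add)

lemma dual_monoid_scale:
  assumes "admissible S" "m \<in> dual_monoid n (ray_cone S)"
  shows "(\<lambda>i. int N * m i) \<in> dual_monoid n (ray_cone S)"
  using assms(2) by (auto simp: dual_monoid_iff[OF assms(1)] lattice_scale exponent_scale)

lemma dual_monoid_zero: "admissible S \<Longrightarrow> (\<lambda>_. 0) \<in> dual_monoid n (ray_cone S)"
  by (simp add: dual_monoid_iff int_lattice_def exponent_zero)

lemma chart_point_add:
  assumes "\<gamma> \<in> chart_points n \<sigma>" "m \<in> dual_monoid n \<sigma>" "m' \<in> dual_monoid n \<sigma>"
  shows "\<gamma> (\<lambda>i. m i + m' i) = \<gamma> m * \<gamma> m'"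
  using assms by (simp add: chart_points_def)

lemma chart_point_zero: "\<gamma> \<in> chart_points n \<sigma> \<Longrightarrow> \<gamma> (\<lambda>_. 0) = 1"
  by (simp add: chart_points_def)

lemma chart_point_scale:
  assumes "admissible S" "\<gamma> \<in> chart_points n (ray_cone S)" "m \<in> dual_monoid n (ray_cone S)"
  shows "\<gamma> (\<lambda>i. int N * m i) = \<gamma> m ^ N"
proof (induction N)
  case 0
  then show ?case using chart_point_zero[OF assms(2)] by simp
next
  case (Suc N)
  have "(\<lambda>i. int (Suc N) * m i) = (\<lambda>i. m i + int N * m i)" by (auto simp: algebra_simps)
  then show ?case
    using chart_point_add[OF assms(2,3) dual_monoid_scale[OF assms(1,3), of N]] Suc by simp
qed

lemma chart_map_in:
  assumes "admissible S" "x \<in> chart_domain S"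
  shows "chart_map S x \<in> chart_points n (ray_cone S)"
  unfolding chart_points_def
proof (intro CollectI conjI ballI)
  show "chart_map S x \<in> extensional (dual_monoid n (ray_cone S))" by (simp add: chart_map_def)
  show "chart_map S x (\<lambda>_. 0) = 1"
    by (simp add: chart_map_def dual_monoid_zero[OF assms(1)] exponent_zero')
  fix m m' assume m: "m \<in> dual_monoid n (ray_cone S)" "m' \<in> dual_monoid n (ray_cone S)"
  then have "monomial x (\<lambda>c. exponent m c + exponent m' c) = monomial x (exponent m) * monomial x (exponent m')"
    by (intro monomial_add_chart[OF assms(2)]) (auto simp: dual_monoid_iff[OF assms(1)])
  then show "chart_map S x (\<lambda>i. m i + m' i) = chart_map S x m * chart_map S x m'"
    by (simp add: chart_map_def dual_monoid_add[OF assms(1)] m exponent_add')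
qed

text \<open>Localisation at a face: adding a large multiple of a character that defines a face moves a
  character which is nonnegative on that face into the dual monoid.\<close>

lemma shift_into_dual_monoid:
  assumes S: "admissible S" and "m \<in> int_lattice n" "m0 \<in> int_lattice n"
    and "\<And>c. c \<in> S \<Longrightarrow> 0 \<le> exponent m0 c"
    and "\<And>c. c \<in> S \<Longrightarrow> exponent m0 c = 0 \<Longrightarrow> 0 \<le> exponent m c"
  shows "\<exists>N. (\<lambda>i. m i + int N * m0 i) \<in> dual_monoid n (ray_cone S)"
proof -
  define N where "N = nat (\<Sum>c\<in>S. \<bar>exponent m c\<bar>)"
  have N: "int N = (\<Sum>c\<in>S. \<bar>exponent m c\<bar>)" by (simp add: N_def sum_nonneg)
  have "0 \<le> exponent m c + int N * exponent m0 c" if c: "c \<in> S" for c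
  proof (cases "exponent m0 c = 0")
    case True then show ?thesis using assms(5)[OF c] by simp
  next
    case False
    then have "1 \<le> exponent m0 c" using assms(4)[OF c] by linarith
    then have "int N * 1 \<le> int N * exponent m0 c" by (intro mult_left_mono) auto
    moreover have "\<bar>exponent m c\<bar> \<le> int N" unfolding N
      by (rule member_le_sum[OF c]) (use admissible_finite[OF S] in auto)
    ultimately show ?thesis by linarith
  qed
  then show ?thesis
    by (intro exI[of _ N]) (auto simp: dual_monoid_iff[OF S] exponent_add exponent_scale lattice_add lattice_scale assms)
qed

text \<open>The characters at which \<open>\<gamma>\<close> does not vanish form a face of the dual monoid, cut out by the set \<open>I\<close>
  of rays on which all of them vanish. So \<open>\<gamma>\<close> extends to a character of the group of all exponent
  vectors of weight zero that vanish on \<open>I\<close>, and this one extends to a character of \<open>\<int>\<^sup>C\<close>. Its values at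
  the unit vectors are the coordinates of a preimage of \<open>\<gamma>\<close>, except for those in \<open>I\<close>, which are zero.\<close>

lemma chart_map_surj:
  assumes S: "admissible S" and \<gamma>: "\<gamma> \<in> chart_points n (ray_cone S)"
  shows "\<exists>x\<in>chart_domain S. chart_map S x = \<gamma>"
proof -
  let ?M = "dual_monoid n (ray_cone S)"
  note M = dual_monoid_iff[OF S]
  define F where "F = {m \<in> ?M. \<gamma> m \<noteq> 0}"
  define I where "I = {c \<in> S. \<forall>m\<in>F. exponent m c = 0}"
  have F_zero: "(\<lambda>_. 0) \<in> F"
    by (simp add: F_def dual_monoid_zero[OF S] chart_point_zero[OF \<gamma>])
  have F_add: "(\<lambda>i. m i + m' i) \<in> F" if "m \<in> F" "m' \<in> F" for m m'
    using that chart_point_add[OF \<gamma>] by (simp add: F_def dual_monoid_add[OF S])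
  have "finite (S - I)" using admissible_finite[OF S] by simp
  then have "\<exists>m\<in>F. \<forall>c\<in>S - I. 0 < exponent m c"
  proof -
    have "A \<subseteq> S - I \<Longrightarrow> \<exists>m\<in>F. \<forall>c\<in>A. 0 < exponent m c" if "finite A" for A
      using that
    proof (induction A rule: finite_induct)
      case empty then show ?case using F_zero by blast
    next
      case (insert a A)
      then obtain m where m: "m \<in> F" "\<forall>c\<in>A. 0 < exponent m c" by auto
      obtain m' where m': "m' \<in> F" "exponent m' a \<noteq> 0" using insert.prems by (auto simp: I_def)
      have nonneg: "0 \<le> exponent m c" "0 \<le> exponent m' c" if "c \<in> insert a A" for c
        using m(1) m'(1) that insert.prems by (auto simp: F_def M)
      have "0 < exponent m' a" using m'(2) nonneg[of a] by simp
      then have "\<forall>c\<in>insert a A. 0 < exponent (\<lambda>i. m i + m' i) c"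
        using m(2) nonneg by (fastforce simp: exponent_add intro: add_pos_nonneg add_nonneg_pos)
      then show ?case using F_add[OF m(1) m'(1)] by blast
    qed
    then show ?thesis using \<open>finite (S - I)\<close> by blast
  qed
  then obtain m0 where m0: "m0 \<in> F" "\<And>c. c \<in> S - I \<Longrightarrow> 0 < exponent m0 c" by blast
  have m0M: "m0 \<in> ?M" "\<gamma> m0 \<noteq> 0" "m0 \<in> int_lattice n" using m0(1) by (auto simp: F_def M)
  have m0I: "exponent m0 c = 0" if "c \<in> I" for c using that m0(1) by (auto simp: I_def)
  have m0_nonneg: "0 \<le> exponent m0 c" if "c \<in> S" for c using m0M(1) that by (simp add: M)
  have shift: "\<exists>N. (\<lambda>i. m i + int N * m0 i) \<in> ?M"
    if "m \<in> int_lattice n" "\<forall>c\<in>I. exponent m c = 0" for m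
  proof (rule shift_into_dual_monoid[OF S that(1) m0M(3) m0_nonneg])
    fix c assume "c \<in> S" "exponent m0 c = 0"
    then have "c \<in> I" using m0(2)[of c] by force
    then show "0 \<le> exponent m c" using that(2) by simp
  qed
  have face: "\<gamma> m \<noteq> 0" if m: "m \<in> ?M" "\<forall>c\<in>I. exponent m c = 0" for m
  proof -
    have "(\<lambda>i. - m i) \<in> int_lattice n" "\<forall>c\<in>I. exponent (\<lambda>i. - m i) c = 0"
      using m by (auto simp: M int_lattice_def exponent_uminus)
    then obtain N where N: "(\<lambda>i. - m i + int N * m0 i) \<in> ?M" using shift by blast
    have "(\<lambda>i. int N * m0 i) = (\<lambda>i. m i + (- m i + int N * m0 i))" by auto
    then have "\<gamma> m0 ^ N = \<gamma> m * \<gamma> (\<lambda>i. - m i + int N * m0 i)"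
      using chart_point_add[OF \<gamma> m(1) N] chart_point_scale[OF S \<gamma> m0M(1), of N] by simp
    then show ?thesis using m0M(2) by (metis mult_zero_left power_not_zero)
  qed
  define K where "K = {k \<in> relations. \<forall>c\<in>I. k c = 0}"
  define sh where "sh = (\<lambda>k N i. lift k i + int N * m0 i)"
  define \<psi> where "\<psi> = (\<lambda>k. let N = SOME N. sh k N \<in> ?M in \<gamma> (sh k N) / \<gamma> m0 ^ N)"
  have sh_add: "\<gamma> (sh k (N + N')) = \<gamma> (sh k N) * \<gamma> m0 ^ N'" if "sh k N \<in> ?M" for k N N'
  proof -
    have "sh k (N + N') = (\<lambda>i. sh k N i + int N' * m0 i)" by (auto simp: sh_def algebra_simps)
    then show ?thesis
      using chart_point_add[OF \<gamma> that dual_monoid_scale[OF S m0M(1), of N']]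
        chart_point_scale[OF S \<gamma> m0M(1), of N'] by simp
  qed
  have sh_ex: "\<exists>N. sh k N \<in> ?M" if "k \<in> K" for k
    unfolding sh_def by (rule shift[OF lift_lattice]) (use that in \<open>auto simp: K_def exponent_lift\<close>)
  have \<psi>: "\<psi> k * \<gamma> m0 ^ N = \<gamma> (sh k N)" if "sh k N \<in> ?M" for k N
  proof -
    define N' where "N' = (SOME N. sh k N \<in> ?M)"
    have N': "sh k N' \<in> ?M" unfolding N'_def by (rule someI[of "\<lambda>N. sh k N \<in> ?M"]) (rule that)
    have "\<gamma> (sh k N) * \<gamma> m0 ^ N' = \<gamma> (sh k N') * \<gamma> m0 ^ N"
      using sh_add[OF that, of N'] sh_add[OF N', of N] by (simp add: add.commute)
    then show ?thesis using m0M(2) by (simp add: \<psi>_def Let_def N'_def[symmetric] field_simps)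
  qed
  have "\<exists>z. (\<forall>c. z c \<noteq> 0) \<and> (\<forall>k\<in>K. \<psi> k = (\<Prod>c\<in>C. z c powi k c))"
  proof (rule character_extension[OF finite_C])
    show "k c = 0" if "k \<in> K" "c \<notin> C" for k c using that by (simp add: K_def relations_def)
    show KA: "(\<lambda>c. k c + k' c) \<in> K" if "k \<in> K" "k' \<in> K" for k k'
      using that by (auto simp: K_def relations_def distrib_right sum.distrib)
    show "(\<lambda>c. - k c) \<in> K" if "k \<in> K" for k
      using that by (auto simp: K_def relations_def sum_negf)
    show "\<psi> (\<lambda>c. k c + k' c) = \<psi> k * \<psi> k'" if k: "k \<in> K" "k' \<in> K" for k k'
    proof -
      obtain N where N: "sh k N \<in> ?M" using sh_ex[OF k(1)] by blast
      obtain N' where N': "sh k' N' \<in> ?M" using sh_ex[OF k(2)] by blast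
      have eq: "sh (\<lambda>c. k c + k' c) (N + N') = (\<lambda>i. sh k N i + sh k' N' i)"
        by (auto simp: sh_def lift_def algebra_simps)
      have "\<psi> (\<lambda>c. k c + k' c) * \<gamma> m0 ^ (N + N') = \<gamma> (sh k N) * \<gamma> (sh k' N')"
        using \<psi>[of "\<lambda>c. k c + k' c" "N + N'"] dual_monoid_add[OF S N N'] chart_point_add[OF \<gamma> N N']
        by (simp add: eq)
      also have "\<dots> = (\<psi> k * \<psi> k') * \<gamma> m0 ^ (N + N')"
        by (simp add: \<psi>[OF N, symmetric] \<psi>[OF N', symmetric] power_add)
      finally show ?thesis using m0M(2) by simp
    qed
    show "\<psi> k \<noteq> 0" if k: "k \<in> K" for k
    proof -
      obtain N where N: "sh k N \<in> ?M" using sh_ex[OF k] by blast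
      have "\<forall>c\<in>I. exponent (sh k N) c = 0"
        using k m0I by (auto simp: sh_def exponent_add exponent_scale K_def exponent_lift)
      then have "\<gamma> (sh k N) \<noteq> 0" by (rule face[OF N])
      then show ?thesis using \<psi>[OF N] by auto
    qed
  qed
  then obtain z where z: "\<And>c. z c \<noteq> 0" "\<And>k. k \<in> K \<Longrightarrow> \<psi> k = (\<Prod>c\<in>C. z c powi k c)" by blast
  define x where "x = (\<lambda>c. if c \<in> C - I then z c else 0)"
  have "x \<in> chart_domain S" using z by (auto simp: chart_domain_def x_def I_def)
  moreover have "chart_map S x = \<gamma>"
  proof (rule extensionalityI)
    show "chart_map S x \<in> extensional ?M" by (simp add: chart_map_def)
    show "\<gamma> \<in> extensional ?M" using \<gamma> by (simp add: chart_points_def)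
    fix m assume m: "m \<in> ?M"
    have IC: "I \<subseteq> C" using S by (auto simp: I_def admissible_def)
    show "chart_map S x m = \<gamma> m"
    proof (cases "\<forall>c\<in>I. exponent m c = 0")
      case True
      then have k: "exponent m \<in> K" by (simp add: K_def exponent_relations)
      have "sh (exponent m) 0 = m" using m by (simp add: sh_def M lift_exponent)
      then have "\<gamma> m = \<psi> (exponent m)" using \<psi>[of "exponent m" 0] m by simp
      also have "\<dots> = monomial x (exponent m)" unfolding z(2)[OF k] monomial_def
        by (rule prod.cong) (use True in \<open>auto simp: x_def\<close>)
      finally show ?thesis using m by (simp add: chart_map_def)
    next
      case False
      then obtain c where c: "c \<in> I" "exponent m c \<noteq> 0" by blast
      then have "monomial x (exponent m) = 0" using IC by (auto simp: monomial_eq_0_iff x_def)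
      moreover have "\<gamma> m = 0" using c m by (auto simp: I_def F_def)
      ultimately show ?thesis using m by (simp add: chart_map_def)
    qed
  qed
  ultimately show ?thesis by blast
qed

text \<open>If no monomial of weight zero separates \<open>x\<close> from \<open>y\<close>, then the value of a monomial at the quotient
  \<open>r = y / x\<close> depends only on the weight of the monomial. This defines a character on a group of
  weights; an extension of it to \<open>\<int>\<^sup>d\<^sup>+\<^sup>1\<close> is the required element of the torus.\<close>

lemma same_orbit:
  assumes x: "\<And>c. c \<notin> C \<Longrightarrow> x c = 0" and y: "\<And>c. c \<notin> C \<Longrightarrow> y c = 0"
    and zeros: "\<And>c. c \<in> C \<Longrightarrow> x c = 0 \<longleftrightarrow> y c = 0"
    and monomial: "\<And>k. k \<in> relations \<Longrightarrow> (\<And>c. c \<in> C \<Longrightarrow> x c = 0 \<Longrightarrow> k c = 0) \<Longrightarrow> monomial x k = monomial y k"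
  shows "\<exists>l\<in>torus d. y = act l x"
proof -
  define D where "D = {c \<in> C. x c \<noteq> 0}"
  define r where "r = (\<lambda>c. if c \<in> D then y c / x c else 1)"
  define K where "K = {k :: 'c \<Rightarrow> int. \<forall>c. c \<notin> D \<longrightarrow> k c = 0}"
  have r0: "r c \<noteq> 0" for c using zeros[of c] by (auto simp: r_def D_def)
  have r_add: "monomial r (\<lambda>c. k c + k' c) = monomial r k * monomial r k'" for k k'
    by (rule monomial_add) (simp add: r0)
  have mono_y: "monomial y k = monomial r k * monomial x k" if "k \<in> K" for k
    unfolding monomial_def prod.distrib[symmetric] power_int_mult_distrib[symmetric]
  proof (rule prod.cong[OF refl])
    fix c assume "c \<in> C"
    then show "y c powi k c = (r c * x c) powi k c"
      using that by (cases "c \<in> D") (auto simp: r_def D_def K_def)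
  qed
  have r_rel: "monomial r k = 1" if k: "k \<in> K" "weight k = (\<lambda>_. 0)" for k
  proof -
    have "(\<Sum>c\<in>C. k c * w c j) = 0" if "j \<le> d" for j
      using fun_cong[OF k(2), of j] that by (simp add: weight_def)
    then have "k \<in> relations" using k(1) by (auto simp: relations_def K_def D_def)
    then have "monomial x k = monomial y k" using k(1) by (intro monomial) (auto simp: K_def D_def)
    moreover have "monomial x k \<noteq> 0" using k(1) by (auto simp: monomial_eq_0_iff K_def D_def)
    ultimately show ?thesis using mono_y[OF k(1)] by simp
  qed
  have r_wt: "monomial r k = monomial r k'" if k: "k \<in> K" "k' \<in> K" "weight k = weight k'" for k k'
  proof -
    have "weight (\<lambda>c. k c - k' c) = (\<lambda>_. 0)"
    proof
      fix j show "weight (\<lambda>c. k c - k' c) j = 0"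
        using fun_cong[OF k(3), of j] by (auto simp: weight_def left_diff_distrib sum_subtractf)
    qed
    then have "monomial r (\<lambda>c. k c - k' c) = 1" by (intro r_rel) (use k in \<open>auto simp: K_def\<close>)
    then show ?thesis using r_add[of "\<lambda>c. k c - k' c" k'] by simp
  qed
  define \<psi> where "\<psi> = (\<lambda>h. monomial r (SOME k. k \<in> K \<and> weight k = h))"
  have \<psi>: "\<psi> (weight k) = monomial r k" if "k \<in> K" for k
  proof -
    have "(SOME k'. k' \<in> K \<and> weight k' = weight k) \<in> K
        \<and> weight (SOME k'. k' \<in> K \<and> weight k' = weight k) = weight k"
      by (rule someI[of "\<lambda>k'. k' \<in> K \<and> weight k' = weight k" k]) (simp add: that)
    then show ?thesis unfolding \<psi>_def using r_wt that by blast
  qed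
  have w_add: "weight (\<lambda>c. k c + k' c) = (\<lambda>j. weight k j + weight k' j)" for k k'
    by (auto simp: weight_add)
  have "\<exists>l. (\<forall>j. l j \<noteq> 0) \<and> (\<forall>h\<in>weight ` K. \<psi> h = (\<Prod>j\<in>{..d}. l j powi h j))"
  proof (rule character_extension)
    show "h j = 0" if "h \<in> weight ` K" "j \<notin> {..d}" for h j using that by (auto simp: weight_def)
    show "(\<lambda>j. h j + h' j) \<in> weight ` K" if hh: "h \<in> weight ` K" "h' \<in> weight ` K" for h h'
    proof -
      obtain k k' where k: "k \<in> K" "k' \<in> K" "h = weight k" "h' = weight k'" using hh by blast
      have "(\<lambda>c. k c + k' c) \<in> K" using k by (simp add: K_def)
      then show ?thesis unfolding k(3,4) w_add[symmetric] by (rule imageI)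
    qed
    show "(\<lambda>j. - h j) \<in> weight ` K" if hh: "h \<in> weight ` K" for h
    proof -
      obtain k where k: "k \<in> K" "h = weight k" using hh by blast
      have "(\<lambda>j. - weight k j) = weight (\<lambda>c. - k c)" by (auto simp: weight_def sum_negf)
      moreover have "(\<lambda>c. - k c) \<in> K" using k by (simp add: K_def)
      ultimately show ?thesis using k by auto
    qed
    show "\<psi> (\<lambda>j. h j + h' j) = \<psi> h * \<psi> h'" if hh: "h \<in> weight ` K" "h' \<in> weight ` K" for h h'
    proof -
      obtain k k' where k: "k \<in> K" "k' \<in> K" "h = weight k" "h' = weight k'" using hh by blast
      have "(\<lambda>c. k c + k' c) \<in> K" using k by (simp add: K_def)
      then show ?thesis using \<psi> k r_add by (simp add: w_add[symmetric])
    qed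
    show "\<psi> h \<noteq> 0" if "h \<in> weight ` K" for h using that \<psi> r0 by (auto simp: monomial_eq_0_iff)
  qed simp
  then obtain l where l: "\<And>j. l j \<noteq> 0"
    "\<And>k. k \<in> K \<Longrightarrow> \<psi> (weight k) = (\<Prod>j\<in>{..d}. l j powi weight k j)" by blast
  have "y c = act l x c" for c
  proof (cases "c \<in> D")
    case True
    define k where "k = (\<lambda>c'. if c' = c then 1 else 0 :: int)"
    have cC: "c \<in> C" and kK: "k \<in> K" using True by (auto simp: k_def K_def D_def)
    have "monomial r k = (\<Prod>c'\<in>C. if c' = c then r c else 1)"
      unfolding monomial_def by (rule prod.cong) (auto simp: k_def)
    then have rc: "monomial r k = r c" using cC finite_C by simp
    have "weight k j = w c j" if "j \<le> d" for j
    proof -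
      have "(\<Sum>c'\<in>C. k c' * w c' j) = (\<Sum>c'\<in>C. if c' = c then w c j else 0)"
        by (rule sum.cong) (auto simp: k_def)
      then show ?thesis using cC finite_C that by (simp add: weight_def)
    qed
    then have "character l (w c) = r c"
      using l(2)[OF kK] \<psi>[OF kK] rc by (simp add: character_def)
    then show ?thesis using True by (simp add: act_def r_def D_def)
  next
    case False
    then show ?thesis using x y zeros by (auto simp: act_def D_def)
  qed
  then show ?thesis using l(1) by (intro bexI[of _ l]) (auto simp: torus_def)
qed

text \<open>The representatives, in all charts that contain it, of the point of the toric variety below \<open>x\<close>.\<close>

definition toric_point :: "('c \<Rightarrow> complex) \<Rightarrow> ((nat \<Rightarrow> real) set \<times> ((nat \<Rightarrow> int) \<Rightarrow> complex)) set" where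
  "toric_point x = {(ray_cone S, chart_map S x) | S. admissible S \<and> x \<in> chart_domain S}"

lemma dual_monoid_antimono:
  "admissible S \<Longrightarrow> T \<subseteq> S \<Longrightarrow> dual_monoid n (ray_cone S) \<subseteq> dual_monoid n (ray_cone T)"
  using admissible_subset[of S T] by (simp add: dual_monoid_iff subset_iff)

lemma restrict_chart_map:
  assumes "admissible S" "T \<subseteq> S"
  shows "restrict (chart_map T x) (dual_monoid n (ray_cone S)) = chart_map S x"
  using dual_monoid_antimono[OF assms] by (auto simp: chart_map_def restrict_def fun_eq_iff)

text \<open>If a point of the chart of \<open>S\<close> lies in the open part that belongs to a face, then its coordinates
  outside the face do not vanish, because a character defining the face becomes invertible. On the
  face the point has only one extension.\<close>

lemma glued_extension:
  assumes S: "admissible S" and T: "T \<subseteq> S" and x: "x \<in> chart_domain S"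
    and \<delta>: "\<delta> \<in> chart_points n (ray_cone T)"
    and eq: "restrict \<delta> (dual_monoid n (ray_cone S)) = chart_map S x"
  shows "x \<in> chart_domain T" "\<delta> = chart_map T x"
proof -
  have aT: "admissible T" by (rule admissible_subset[OF S T])
  note MS = dual_monoid_iff[OF S] and MT = dual_monoid_iff[OF aT]
  have val: "\<delta> m = monomial x (exponent m)" if "m \<in> dual_monoid n (ray_cone S)" for m
    using fun_cong[OF eq, of m] that by (simp add: chart_map_def)
  obtain m0 where m0: "m0 \<in> int_lattice n" "\<forall>c\<in>T. exponent m0 c = 0" "\<forall>c\<in>S - T. 0 < exponent m0 c"
    using supporting_character_exists[OF S T] by blast
  have m0_nonneg: "0 \<le> exponent m0 c" if "c \<in> S" for c
    using m0(2,3) that by (cases "c \<in> T") (auto intro: less_imp_le)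
  have m0S: "m0 \<in> dual_monoid n (ray_cone S)" using m0(1) m0_nonneg by (simp add: MS)
  have m0T: "m0 \<in> dual_monoid n (ray_cone T)" "(\<lambda>i. - m0 i) \<in> dual_monoid n (ray_cone T)"
    using m0 by (auto simp: MT exponent_uminus int_lattice_def)
  have "\<delta> m0 * \<delta> (\<lambda>i. - m0 i) = 1"
    using chart_point_add[OF \<delta> m0T] chart_point_zero[OF \<delta>] by simp
  then have nz: "monomial x (exponent m0) \<noteq> 0" using val[OF m0S] by auto
  have "x c \<noteq> 0" if "c \<in> C - T" for c
  proof (cases "c \<in> S")
    case True
    then show ?thesis using nz m0(3) that unfolding monomial_eq_0_iff by force
  qed (use x that in \<open>auto simp: chart_domain_def\<close>)
  then show xT: "x \<in> chart_domain T" using x by (simp add: chart_domain_def)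
  show "\<delta> = chart_map T x"
  proof (rule extensionalityI)
    show "\<delta> \<in> extensional (dual_monoid n (ray_cone T))" using \<delta> by (simp add: chart_points_def)
    show "chart_map T x \<in> extensional (dual_monoid n (ray_cone T))" by (simp add: chart_map_def)
    fix m assume m: "m \<in> dual_monoid n (ray_cone T)"
    have "\<exists>N. (\<lambda>i. m i + int N * m0 i) \<in> dual_monoid n (ray_cone S)"
    proof (rule shift_into_dual_monoid[OF S _ m0(1) m0_nonneg])
      show "m \<in> int_lattice n" using m by (simp add: MT)
      show "0 \<le> exponent m c" if "c \<in> S" "exponent m0 c = 0" for c
      proof -
        have "c \<in> T" using m0(3) that by force
        then show ?thesis using m by (simp add: MT)
      qed
    qed
    then obtain N where N: "(\<lambda>i. m i + int N * m0 i) \<in> dual_monoid n (ray_cone S)" by blast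
    have "\<delta> m * \<delta> m0 ^ N = \<delta> (\<lambda>i. m i + int N * m0 i)"
      using chart_point_add[OF \<delta> m dual_monoid_scale[OF aT m0T(1), of N]]
        chart_point_scale[OF aT \<delta> m0T(1), of N] by simp
    also have "\<dots> = monomial x (exponent (\<lambda>i. m i + int N * m0 i))" by (rule val[OF N])
    also have "\<dots> = monomial x (exponent m) * monomial x (exponent m0) ^ N"
      unfolding exponent_add' exponent_scale' monomial_scale_nat[symmetric]
      by (rule monomial_add_chart[OF xT]) (use m m0T in \<open>auto simp: MT\<close>)
    finally have "\<delta> m = monomial x (exponent m)" using nz val[OF m0S] by simp
    then show "\<delta> m = chart_map T x m" using m by (simp add: chart_map_def)
  qed
qed

lemma glued_point_chart_map:
  assumes S: "admissible S" and x: "x \<in> chart_domain S"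
  shows "glued_point n cones (ray_cone S) (chart_map S x) = toric_point x"
proof (intro subset_antisym subsetI)
  fix q assume "q \<in> glued_point n cones (ray_cone S) (chart_map S x)"
  then obtain S' \<gamma>' \<delta> where q: "q = (ray_cone S', \<gamma>')" "admissible S'"
    and \<delta>: "\<delta> \<in> chart_points n (ray_cone S \<inter> ray_cone S')"
      "restrict \<delta> (dual_monoid n (ray_cone S)) = chart_map S x"
      "restrict \<delta> (dual_monoid n (ray_cone S')) = \<gamma>'"
    unfolding glued_point_def cones_def by blast
  have \<delta>': "\<delta> \<in> chart_points n (ray_cone (S \<inter> S'))" using \<delta>(1) by (simp add: cone_inter[OF S q(2)])
  note ext = glued_extension[OF S _ x \<delta>' \<delta>(2), simplified]
  have "\<gamma>' = chart_map S' x" using \<delta>(3) restrict_chart_map[OF q(2), of "S \<inter> S'" x] ext(2) by simp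
  moreover have "x \<in> chart_domain S'" using ext(1) by (auto simp: chart_domain_def)
  ultimately show "q \<in> toric_point x" using q by (auto simp: toric_point_def)
next
  fix q assume "q \<in> toric_point x"
  then obtain S' where q: "q = (ray_cone S', chart_map S' x)" "admissible S'" "x \<in> chart_domain S'"
    by (auto simp: toric_point_def)
  have xI: "x \<in> chart_domain (S \<inter> S')" using x q(3) by (auto simp: chart_domain_def)
  have aI: "admissible (S \<inter> S')" by (rule admissible_subset[OF S]) simp
  have "chart_map (S \<inter> S') x \<in> chart_points n (ray_cone S \<inter> ray_cone S')"
    unfolding cone_inter[OF S q(2)] by (rule chart_map_in[OF aI xI])
  moreover have "restrict (chart_map (S \<inter> S') x) (dual_monoid n (ray_cone S)) = chart_map S x"
    "restrict (chart_map (S \<inter> S') x) (dual_monoid n (ray_cone S')) = chart_map S' x"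
    using restrict_chart_map S q(2) by auto
  ultimately show "q \<in> glued_point n cones (ray_cone S) (chart_map S x)"
    unfolding glued_point_def q(1) using chart_map_in[OF q(2,3)] q(2) by (auto simp: cones_def)
qed

lemma ray_cone_inj: "admissible S \<Longrightarrow> admissible S' \<Longrightarrow> ray_cone S = ray_cone S' \<longleftrightarrow> S = S'"
  using cone_subset_imp[of S S'] cone_subset_imp[of S' S] by auto

lemma toric_point_in:
  assumes "admissible S" "(ray_cone S, \<gamma>) \<in> toric_point x"
  shows "x \<in> chart_domain S" "\<gamma> = chart_map S x"
  using assms by (auto simp: toric_point_def ray_cone_inj)

lemma monomial_act_relation:
  "l \<in> torus d \<Longrightarrow> k \<in> relations \<Longrightarrow> monomial (act l x) k = monomial x k"
  by (simp add: monomial_act weight_relation character_def)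

text \<open>The smallest cone whose chart contains the point determines which coordinates vanish.\<close>

lemma toric_point_eq_iff:
  assumes x: "x \<in> stable_points" and y: "y \<in> stable_points"
  shows "toric_point x = toric_point y \<longleftrightarrow> (\<exists>l\<in>torus d. y = act l x)"
proof
  assume eq: "toric_point x = toric_point y"
  define Z where "Z = (\<lambda>x :: 'c \<Rightarrow> complex. {c \<in> C. x c = 0})"
  have Z: "admissible (Z x)" "x \<in> chart_domain (Z x)" "admissible (Z y)" "y \<in> chart_domain (Z y)"
    using stable_point_in_chart x y by (simp_all add: Z_def)
  have "(ray_cone (Z x), chart_map (Z x) x) \<in> toric_point y"
    unfolding eq[symmetric] using Z by (auto simp: toric_point_def)
  note xy = toric_point_in[OF Z(1) this]
  have "(ray_cone (Z y), chart_map (Z y) y) \<in> toric_point x"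
    unfolding eq using Z by (auto simp: toric_point_def)
  note yx = toric_point_in[OF Z(3) this]
  show "\<exists>l\<in>torus d. y = act l x"
  proof (rule same_orbit)
    show "x c = 0 \<longleftrightarrow> y c = 0" if "c \<in> C" for c
    proof -
      have "c \<in> C - Z x \<longrightarrow> y c \<noteq> 0" "c \<in> C - Z y \<longrightarrow> x c \<noteq> 0"
        using xy(1) yx(1) unfolding chart_domain_def by blast+
      then show ?thesis using that unfolding Z_def by blast
    qed
    fix k assume k: "k \<in> relations" "\<And>c. c \<in> C \<Longrightarrow> x c = 0 \<Longrightarrow> k c = 0"
    then have "lift k \<in> dual_monoid n (ray_cone (Z x))"
      by (simp add: dual_monoid_iff[OF Z(1)] lift_lattice exponent_lift) (simp add: Z_def)
    then show "monomial x k = monomial y k"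
      using fun_cong[OF xy(2), of "lift k"] k(1) by (simp add: chart_map_def exponent_lift)
  qed (use x y in \<open>auto simp: stable_points_def\<close>)
next
  assume "\<exists>l\<in>torus d. y = act l x"
  then obtain l where l: "l \<in> torus d" "y = act l x" by blast
  have "chart_map S y = chart_map S x" for S
    unfolding chart_map_def l(2) by (simp add: monomial_act_relation[OF l(1) exponent_relations])
  moreover have "y \<in> chart_domain S \<longleftrightarrow> x \<in> chart_domain S" for S
    using x unfolding l(2) act_in_chart[OF l(1)] by (simp add: chart_domain_def stable_points_def)
  ultimately show "toric_point x = toric_point y" by (simp add: toric_point_def)
qed

end

section \<open>Quasi-affine spaces and final structures\<close>

lemma openin_quasi_affine:
  "openin (ztop (quasi_affine P (gen_algebra G))) V \<longleftrightarrow>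
     V \<subseteq> P \<and> (\<forall>x\<in>V. \<exists>q\<in>gen_algebra G. q x \<noteq> 0 \<and> {y \<in> P. q y \<noteq> 0} \<subseteq> V)"
proof -
  let ?B = "(\<lambda>q. {x \<in> P. q x \<noteq> 0}) ` gen_algebra G"
  have "openin (topology_generated_by ?B) V \<longleftrightarrow>
     V \<subseteq> P \<and> (\<forall>x\<in>V. \<exists>q\<in>gen_algebra G. q x \<noteq> 0 \<and> {y \<in> P. q y \<noteq> 0} \<subseteq> V)"
  proof
    assume "openin (topology_generated_by ?B) V"
    then have "generate_topology_on ?B V" by (simp add: openin_topology_generated_by_iff)
    then show "V \<subseteq> P \<and> (\<forall>x\<in>V. \<exists>q\<in>gen_algebra G. q x \<noteq> 0 \<and> {y \<in> P. q y \<noteq> 0} \<subseteq> V)"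
    proof induction
      case Empty then show ?case by simp
    next
      case (Int a b)
      show ?case
      proof (intro conjI ballI)
        show "a \<inter> b \<subseteq> P" using Int.IH by blast
        fix x assume x: "x \<in> a \<inter> b"
        obtain q where q: "q \<in> gen_algebra G" "q x \<noteq> 0" "{y \<in> P. q y \<noteq> 0} \<subseteq> a" using Int.IH x by blast
        obtain q' where q': "q' \<in> gen_algebra G" "q' x \<noteq> 0" "{y \<in> P. q' y \<noteq> 0} \<subseteq> b" using Int.IH x by blast
        show "\<exists>q\<in>gen_algebra G. q x \<noteq> 0 \<and> {y \<in> P. q y \<noteq> 0} \<subseteq> a \<inter> b"
          by (rule bexI[OF _ gen_algebra.mult[OF q(1) q'(1)]]) (use q q' in auto)
      qed
    next
      case (UN K)
      then show ?case by (meson Sup_le_iff Union_upper UnionE subset_trans)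
    next
      case (Basis s)
      then show ?case by auto
    qed
  next
    assume R: "V \<subseteq> P \<and> (\<forall>x\<in>V. \<exists>q\<in>gen_algebra G. q x \<noteq> 0 \<and> {y \<in> P. q y \<noteq> 0} \<subseteq> V)"
    define K where "K = {B \<in> ?B. B \<subseteq> V}"
    have "V = \<Union>K"
    proof (intro subset_antisym subsetI)
      fix x assume x: "x \<in> V"
      then obtain q where "q \<in> gen_algebra G" "q x \<noteq> 0" "{y \<in> P. q y \<noteq> 0} \<subseteq> V" using R by blast
      then show "x \<in> \<Union>K" using x R by (intro UnionI[of "{y \<in> P. q y \<noteq> 0}"]) (auto simp: K_def)
    qed (auto simp: K_def)
    moreover have "openin (topology_generated_by ?B) (\<Union>K)"
      by (rule openin_Union) (auto simp: K_def topology_generated_by_Basis)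
    ultimately show "openin (topology_generated_by ?B) V" by simp
  qed
  then show ?thesis by (simp add: quasi_affine_def)
qed

lemma topspace_quasi_affine [simp]: "topspace (ztop (quasi_affine P (gen_algebra G))) = P"
proof -
  have "(\<lambda>_. 1) \<in> gen_algebra G" by (rule gen_algebra.const)
  then show ?thesis by (force simp: quasi_affine_def)
qed

lemma reg_quasi_affine:
  "f \<in> reg (quasi_affine P A) V \<longleftrightarrow>
     (\<forall>x\<in>V. \<exists>p\<in>A. \<exists>q\<in>A. q x \<noteq> 0 \<and> (\<forall>y\<in>V. q y \<noteq> 0 \<longrightarrow> f y = p y / q y))"
  by (simp add: quasi_affine_def)

lemma reg_quasi_affine_subset:
  "f \<in> reg (quasi_affine P A) V \<Longrightarrow> V' \<subseteq> V \<Longrightarrow> f \<in> reg (quasi_affine P A) V'"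
  unfolding reg_quasi_affine by blast

lemma reg_quasi_affine_cong:
  assumes "\<And>x. x \<in> V \<Longrightarrow> f x = g x"
  shows "f \<in> reg (quasi_affine P A) V \<longleftrightarrow> g \<in> reg (quasi_affine P A) V"
  unfolding reg_quasi_affine using assms by simp

text \<open>Multiplying numerator and denominator by \<open>h\<close> extends a representation from the part where \<open>h\<close> does
  not vanish to all of \<open>V\<close>.\<close>

lemma reg_quasi_affine_local:
  assumes "\<And>x. x \<in> V \<Longrightarrow> \<exists>h\<in>gen_algebra G. h x \<noteq> 0 \<and>
      f \<in> reg (quasi_affine P (gen_algebra G)) {y \<in> V. h y \<noteq> 0}"
  shows "f \<in> reg (quasi_affine P (gen_algebra G)) V"
  unfolding reg_quasi_affine
proof
  fix x assume x: "x \<in> V"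
  obtain h where h: "h \<in> gen_algebra G" "h x \<noteq> 0"
    "f \<in> reg (quasi_affine P (gen_algebra G)) {y \<in> V. h y \<noteq> 0}" using assms[OF x] by blast
  then obtain p q where pq: "p \<in> gen_algebra G" "q \<in> gen_algebra G" "q x \<noteq> 0"
    "\<forall>y\<in>{y \<in> V. h y \<noteq> 0}. q y \<noteq> 0 \<longrightarrow> f y = p y / q y" using x unfolding reg_quasi_affine by blast
  show "\<exists>p\<in>gen_algebra G. \<exists>q\<in>gen_algebra G. q x \<noteq> 0 \<and> (\<forall>y\<in>V. q y \<noteq> 0 \<longrightarrow> f y = p y / q y)"
    by (rule bexI[OF _ gen_algebra.mult[OF pq(1) h(1)]], rule bexI[OF _ gen_algebra.mult[OF pq(2) h(1)]])
      (use pq h in auto)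
qed

lemma gen_algebra_power: "f \<in> gen_algebra G \<Longrightarrow> (\<lambda>x. f x ^ N) \<in> gen_algebra G"
  by (induction N) (auto intro: gen_algebra.intros)

lemma gen_algebra_prod:
  assumes "\<And>i. i \<in> I \<Longrightarrow> f i \<in> gen_algebra G"
  shows "(\<lambda>x. \<Prod>i\<in>I. f i x) \<in> gen_algebra G"
  using assms by (induction I rule: infinite_finite_induct) (auto intro: gen_algebra.intros)

lemma topspace_final_fspace:
  "topspace (ztop (final_fspace I X \<pi>)) = (\<Union>i\<in>I. \<pi> i ` topspace (ztop (X i)))"
proof (rule subset_antisym)
  show "topspace (ztop (final_fspace I X \<pi>)) \<subseteq> (\<Union>i\<in>I. \<pi> i ` topspace (ztop (X i)))"
    using openin_topspace[of "ztop (final_fspace I X \<pi>)"] unfolding openin_final_fspace by blast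
  have "{x \<in> topspace (ztop (X i)). \<pi> i x \<in> (\<Union>i\<in>I. \<pi> i ` topspace (ztop (X i)))} = topspace (ztop (X i))"
    if "i \<in> I" for i using that by blast
  then have "openin (ztop (final_fspace I X \<pi>)) (\<Union>i\<in>I. \<pi> i ` topspace (ztop (X i)))"
    unfolding openin_final_fspace by simp
  then show "(\<Union>i\<in>I. \<pi> i ` topspace (ztop (X i))) \<subseteq> topspace (ztop (final_fspace I X \<pi>))"
    by (rule openin_subset)
qed

lemma reg_final_fspace:
  "f \<in> reg (final_fspace I X \<pi>) V \<longleftrightarrow>
     (\<forall>i\<in>I. f \<circ> \<pi> i \<in> reg (X i) {x \<in> topspace (ztop (X i)). \<pi> i x \<in> V})"
  by (simp add: final_fspace_def)

lemma powi_two_inject: "(2 :: complex) powi i = 2 powi j \<Longrightarrow> i = j"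
proof (rule ccontr)
  assume eq: "(2 :: complex) powi i = 2 powi j" and "i \<noteq> j"
  have "norm ((2 :: complex) powi i) = norm ((2 :: complex) powi j)" by (simp add: eq)
  then have "(2 :: real) powi i = 2 powi j" by (simp add: norm_power_int)
  then show False using \<open>i \<noteq> j\<close> power_int_strict_increasing[of i j "2 :: real"]
      power_int_strict_increasing[of j i "2 :: real"] by (cases "i < j") auto
qed

context dominant_grading
begin

definition coord_algebra :: "(('c \<Rightarrow> complex) \<Rightarrow> complex) set" where
  "coord_algebra = gen_algebra ((\<lambda>c x. x c) ` C)"

definition stable_space :: "('c \<Rightarrow> complex) fspace" where
  "stable_space = quasi_affine stable_points coord_algebra"

definition char_algebra :: "'c set \<Rightarrow> (((nat \<Rightarrow> int) \<Rightarrow> complex) \<Rightarrow> complex) set" where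
  "char_algebra S = gen_algebra ((\<lambda>m \<gamma>. \<gamma> m) ` dual_monoid n (ray_cone S))"

lemmas coord_algebra_intros = gen_algebra.intros[where G = "(\<lambda>c x. x c) ` C", folded coord_algebra_def]
lemmas char_algebra_intros = gen_algebra.intros[where G = "(\<lambda>m \<gamma>. \<gamma> m) ` dual_monoid n (ray_cone S)" for S, folded char_algebra_def]

lemma char_in_algebra: "m \<in> dual_monoid n (ray_cone S) \<Longrightarrow> (\<lambda>\<gamma>. \<gamma> m) \<in> char_algebra S"
  by (rule char_algebra_intros(2)) blast

section \<open>Weight components\<close>

text \<open>Laurent polynomials are given by lists of pairs of a coefficient and an exponent vector.\<close>

definition laurent_eval :: "(complex \<times> ('c \<Rightarrow> int)) list \<Rightarrow> ('c \<Rightarrow> complex) \<Rightarrow> complex" where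
  "laurent_eval L x = (\<Sum>(a, k)\<leftarrow>L. a * monomial x k)"

lemma laurent_eval_simps [simp]:
  "laurent_eval [] x = 0" "laurent_eval ((a, k) # L) x = a * monomial x k + laurent_eval L x" "laurent_eval (L @ L') x = laurent_eval L x + laurent_eval L' x"
  by (simp_all add: laurent_eval_def)

definition list_product :: "(complex \<times> ('c \<Rightarrow> int)) list \<Rightarrow> (complex \<times> ('c \<Rightarrow> int)) list \<Rightarrow>
    (complex \<times> ('c \<Rightarrow> int)) list" where
  "list_product L L' = [(a * a', \<lambda>c. k c + k' c). (a, k) \<leftarrow> L, (a', k') \<leftarrow> L']"

lemma set_list_product:
  "set (list_product L L') = {(a * a', \<lambda>c. k c + k' c) | a k a' k'. (a, k) \<in> set L \<and> (a', k') \<in> set L'}"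
proof (intro subset_antisym subsetI)
  fix z assume "z \<in> {(a * a', \<lambda>c. k c + k' c) | a k a' k'. (a, k) \<in> set L \<and> (a', k') \<in> set L'}"
  then show "z \<in> set (list_product L L')" unfolding list_product_def by force
qed (auto simp: list_product_def)

lemma eval_list_product:
  assumes "\<And>a k a' k'. (a, k) \<in> set L \<Longrightarrow> (a', k') \<in> set L' \<Longrightarrow>
      monomial x (\<lambda>c. k c + k' c) = monomial x k * monomial x k'"
  shows "laurent_eval (list_product L L') x = laurent_eval L x * laurent_eval L' x"
proof -
  have row: "laurent_eval (map (\<lambda>(a', k'). (a * a', \<lambda>c. k c + k' c)) L') x = a * monomial x k * laurent_eval L' x"
    if "\<And>a' k'. (a', k') \<in> set L' \<Longrightarrow> monomial x (\<lambda>c. k c + k' c) = monomial x k * monomial x k'" for a k L'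
    using that
  proof (induction L')
    case Nil then show ?case by simp
  next
    case (Cons ak' L')
    obtain a' k' where ak': "ak' = (a', k')" by force
    have "monomial x (\<lambda>c. k c + k' c) = monomial x k * monomial x k'" by (rule Cons.prems[of a' k']) (simp add: ak')
    moreover have "laurent_eval (map (\<lambda>(a', k'). (a * a', \<lambda>c. k c + k' c)) L') x = a * monomial x k * laurent_eval L' x"
      by (rule Cons.IH) (use Cons.prems in auto)
    ultimately show ?case by (simp add: ak' distrib_left mult_ac)
  qed
  show ?thesis using assms
  proof (induction L)
    case Nil then show ?case by (simp add: list_product_def)
  next
    case (Cons ak L)
    obtain a k where ak: "ak = (a, k)" by force
    have "list_product (ak # L) L' = map (\<lambda>(a', k'). (a * a', \<lambda>c. k c + k' c)) L' @ list_product L L'"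
      by (simp add: list_product_def ak)
    moreover have "laurent_eval (list_product L L') x = laurent_eval L x * laurent_eval L' x"
      by (rule Cons.IH) (use Cons.prems in auto)
    moreover have "laurent_eval (map (\<lambda>(a', k'). (a * a', \<lambda>c. k c + k' c)) L') x = a * monomial x k * laurent_eval L' x"
      by (rule row) (rule Cons.prems[of a k], simp_all add: ak)
    ultimately show ?case by (simp add: ak distrib_right)
  qed
qed

text \<open>Homogeneous functions of weight \<open>\<eta>\<close> on \<open>chart_domain S\<close>: only the coordinates outside \<open>S\<close> may occur
  with negative exponents.\<close>

definition laurent :: "'c set \<Rightarrow> (nat \<Rightarrow> int) \<Rightarrow> (('c \<Rightarrow> complex) \<Rightarrow> complex) \<Rightarrow> bool" where
  "laurent S \<eta> f \<longleftrightarrow> (\<exists>L. (\<forall>a k. (a, k) \<in> set L \<longrightarrow> weight k = \<eta> \<and> (\<forall>c\<in>S. 0 \<le> k c)) \<and>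
     (\<forall>x\<in>chart_domain S. f x = laurent_eval L x))"

lemma laurent_mult:
  assumes "laurent S \<eta> f" "laurent S \<eta>' g"
  shows "laurent S (\<lambda>j. \<eta> j + \<eta>' j) (\<lambda>x. f x * g x)"
proof -
  obtain L where L: "\<And>a k. (a, k) \<in> set L \<Longrightarrow> weight k = \<eta> \<and> (\<forall>c\<in>S. 0 \<le> k c)"
    "\<forall>x\<in>chart_domain S. f x = laurent_eval L x" using assms(1) unfolding laurent_def by blast
  obtain L' where L': "\<And>a k. (a, k) \<in> set L' \<Longrightarrow> weight k = \<eta>' \<and> (\<forall>c\<in>S. 0 \<le> k c)"
    "\<forall>x\<in>chart_domain S. g x = laurent_eval L' x" using assms(2) unfolding laurent_def by blast
  have "weight k = (\<lambda>j. \<eta> j + \<eta>' j) \<and> (\<forall>c\<in>S. 0 \<le> k c)" if k: "(a, k) \<in> set (list_product L L')" for a k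
  proof -
    obtain a1 k1 a2 k2 where k12: "(a1, k1) \<in> set L" "(a2, k2) \<in> set L'" "k = (\<lambda>c. k1 c + k2 c)"
      using k by (auto simp: set_list_product)
    then show ?thesis using L(1)[OF k12(1)] L'(1)[OF k12(2)] by (auto simp: weight_add)
  qed
  moreover have "f x * g x = laurent_eval (list_product L L') x" if x: "x \<in> chart_domain S" for x
  proof -
    have "monomial x (\<lambda>c. k c + k' c) = monomial x k * monomial x k'" if "(a, k) \<in> set L" "(a', k') \<in> set L'" for a k a' k'
      using L(1)[OF that(1)] L'(1)[OF that(2)] by (intro monomial_add_chart[OF x]) blast+
    then have "laurent_eval (list_product L L') x = laurent_eval L x * laurent_eval L' x" by (rule eval_list_product)
    then show ?thesis using L(2) L'(2) x by simp
  qed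
  ultimately show ?thesis unfolding laurent_def by (intro exI[of _ "list_product L L'"]) auto
qed

lemma laurent_power:
  assumes "laurent S \<eta> f"
  shows "laurent S (\<lambda>j. int N * \<eta> j) (\<lambda>x. f x ^ N)"
proof (induction N)
  case 0
  show ?case unfolding laurent_def
    by (intro exI[of _ "[(1, \<lambda>_. 0)]"]) (auto simp: weight_def)
next
  case (Suc N)
  then show ?case using laurent_mult[OF assms Suc] by (simp add: algebra_simps)
qed

lemma laurent_monomial: "(\<And>c. c \<in> S \<Longrightarrow> 0 \<le> k c) \<Longrightarrow> laurent S (weight k) (\<lambda>x. monomial x k)"
  unfolding laurent_def by (intro exI[of _ "[(1, k)]"]) auto

text \<open>A monomial of weight zero is a character of the chart.\<close>

lemma invariant_is_pulled_back:
  assumes S: "admissible S" and f: "laurent S (\<lambda>_. 0) f"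
  shows "\<exists>q\<in>char_algebra S. \<forall>x\<in>chart_domain S. f x = q (chart_map S x)"
proof -
  obtain L where L: "\<And>a k. (a, k) \<in> set L \<Longrightarrow> weight k = (\<lambda>_. 0) \<and> (\<forall>c\<in>S. 0 \<le> k c)"
    "\<forall>x\<in>chart_domain S. f x = laurent_eval L x" using f unfolding laurent_def by blast
  have "\<exists>q\<in>char_algebra S. \<forall>x\<in>chart_domain S. laurent_eval L x = q (chart_map S x)"
    using L(1)
  proof (induction L)
    case Nil
    show ?case by (rule bexI[OF _ char_algebra_intros(1)[of 0]]) simp
  next
    case (Cons ak L)
    obtain a k where ak: "ak = (a, k)" by force
    obtain q where q: "q \<in> char_algebra S" "\<forall>x\<in>chart_domain S. laurent_eval L x = q (chart_map S x)"
      using Cons.IH Cons.prems by (meson list.set_intros(2))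
    have k: "weight k = (\<lambda>_. 0)" "\<forall>c\<in>S. 0 \<le> k c" using Cons.prems[of a k] ak by auto
    define k' where "k' = (\<lambda>c. if c \<in> C then k c else 0)"
    have "(\<Sum>c\<in>C. k' c * w c j) = 0" if "j \<le> d" for j
      using fun_cong[OF k(1), of j] that by (simp add: weight_def k'_def)
    then have rel: "k' \<in> relations" by (simp add: relations_def k'_def)
    have lift: "lift k' \<in> dual_monoid n (ray_cone S)"
    proof -
      have "\<forall>c\<in>S. 0 \<le> k' c" using k(2) by (simp add: k'_def)
      then show ?thesis by (simp add: dual_monoid_iff[OF S] lift_lattice exponent_lift[OF rel])
    qed
    have "monomial x k = chart_map S x (lift k')" for x
      using lift by (simp add: chart_map_def exponent_lift[OF rel]) (simp add: monomial_def k'_def)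
    then show ?case
      by (intro bexI[OF _ char_algebra_intros(3)[OF char_algebra_intros(4)[OF char_algebra_intros(1)[of a]
        char_in_algebra[OF lift]] q(1)]]) (use q ak in auto)
  qed
  then show ?thesis using L(2) by auto
qed

definition component :: "(complex \<times> ('c \<Rightarrow> int)) list \<Rightarrow> (nat \<Rightarrow> int) \<Rightarrow> ('c \<Rightarrow> complex) \<Rightarrow> complex" where
  "component L \<eta> = laurent_eval (filter (\<lambda>(a, k). weight k = \<eta>) L)"

lemma component_laurent:
  "(\<And>a k. (a, k) \<in> set L \<Longrightarrow> \<forall>c\<in>S. 0 \<le> k c) \<Longrightarrow> laurent S \<eta> (component L \<eta>)"
  unfolding laurent_def component_def
  by (intro exI[of _ "filter (\<lambda>(a, k). weight k = \<eta>) L"]) auto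

lemma eval_act:
  assumes "finite X" "\<And>a k. (a, k) \<in> set L \<Longrightarrow> weight k \<in> X" "l \<in> torus d"
  shows "laurent_eval L (act l x) = (\<Sum>\<eta>\<in>X. component L \<eta> x * character l \<eta>)"
  using assms(2)
proof (induction L)
  case Nil then show ?case by (simp add: component_def)
next
  case (Cons ak L)
  obtain a k where ak: "ak = (a, k)" by force
  have wk: "weight k \<in> X" using Cons.prems ak by auto
  have IH: "laurent_eval L (act l x) = (\<Sum>\<eta>\<in>X. component L \<eta> x * character l \<eta>)"
    by (rule Cons.IH) (use Cons.prems in auto)
  have "component (ak # L) \<eta> x = (if \<eta> = weight k then a * monomial x k else 0) + component L \<eta> x" for \<eta>
    by (auto simp: component_def ak)
  then have "(\<Sum>\<eta>\<in>X. component (ak # L) \<eta> x * character l \<eta>)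
      = (\<Sum>\<eta>\<in>X. (if \<eta> = weight k then a * monomial x k * character l (weight k) else 0) + component L \<eta> x * character l \<eta>)"
    by (intro sum.cong) (auto simp: distrib_right)
  also have "\<dots> = a * monomial x k * character l (weight k) + laurent_eval L (act l x)"
    using wk assms(1) by (simp add: sum.distrib IH)
  finally show ?case by (simp add: ak monomial_act[OF assms(3)])
qed

lemma character_separates:
  assumes "\<And>j. j > d \<Longrightarrow> \<eta> j = 0" "\<And>j. j > d \<Longrightarrow> \<eta>' j = 0" "\<eta> \<noteq> \<eta>'"
  shows "\<exists>l\<in>torus d. character l \<eta> \<noteq> character l \<eta>'"
proof -
  obtain j where j: "\<eta> j \<noteq> \<eta>' j" using assms(3) by blast
  then have jd: "j \<le> d" using assms(1,2)[of j] by (cases "j \<le> d") auto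
  define l where "l = (\<lambda>i. if i = j then 2 else 1 :: complex)"
  have "character l \<eta> = 2 powi \<eta> j" for \<eta>
  proof -
    have "character l \<eta> = (\<Prod>i\<le>d. if i = j then 2 powi \<eta> j else 1)"
      unfolding character_def by (rule prod.cong) (auto simp: l_def)
    then show ?thesis using jd by simp
  qed
  then show ?thesis using powi_two_inject j by (intro bexI[of _ l]) (auto simp: torus_def l_def)
qed

text \<open>Since \<open>z\<close> does not depend on \<open>l\<close>, independence of the characters of the torus allows comparison of
  the coefficients.\<close>

lemma component_eq:
  assumes "\<And>l. l \<in> torus d \<Longrightarrow> laurent_eval L (act l x) * z = laurent_eval L' (act l x)"
  shows "component L \<eta> x * z = component L' \<eta> x"
proof (cases "\<eta> \<in> (weight \<circ> snd) ` (set L \<union> set L')")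
  case True
  define X where "X = (weight \<circ> snd) ` (set L \<union> set L')"
  have X: "finite X" by (simp add: X_def)
  have mem: "weight k \<in> X" if "(a, k) \<in> set L \<or> (a, k) \<in> set L'" for a k
    unfolding X_def by (rule image_eqI[of _ _ "(a, k)"]) (use that in auto)
  have "\<forall>\<eta>\<in>X. component L \<eta> x * z - component L' \<eta> x = 0"
  proof (rule characters_independent[OF X, where T = "torus d" and op = "\<lambda>l l' j. l j * l' j"
      and \<phi> = "\<lambda>\<eta> l. character l \<eta>"])
    fix \<eta> \<eta>' assume "\<eta> \<in> X" "\<eta>' \<in> X" "\<eta> \<noteq> \<eta>'"
    then show "\<exists>t\<in>torus d. character t \<eta> \<noteq> character t \<eta>'"
      by (intro character_separates) (auto simp: X_def weight_def)
  next
    fix \<eta> show "\<exists>t\<in>torus d. character t \<eta> \<noteq> 0"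
      by (rule bexI[of _ "\<lambda>_. 1"]) (auto simp: torus_def character_def)
  next
    fix t assume t: "t \<in> torus d"
    show "(\<Sum>\<eta>\<in>X. (component L \<eta> x * z - component L' \<eta> x) * character t \<eta>) = 0"
    proof -
      have "laurent_eval L (act t x) = (\<Sum>\<eta>\<in>X. component L \<eta> x * character t \<eta>)"
        by (rule eval_act[OF X _ t]) (use mem in blast)
      moreover have "laurent_eval L' (act t x) = (\<Sum>\<eta>\<in>X. component L' \<eta> x * character t \<eta>)"
        by (rule eval_act[OF X _ t]) (use mem in blast)
      moreover have "(\<Sum>\<eta>\<in>X. (component L \<eta> x * z - component L' \<eta> x) * character t \<eta>)
          = (\<Sum>\<eta>\<in>X. component L \<eta> x * character t \<eta>) * z - (\<Sum>\<eta>\<in>X. component L' \<eta> x * character t \<eta>)"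
        unfolding sum_distrib_right sum_subtractf[symmetric] by (rule sum.cong) (auto simp: algebra_simps)
      ultimately show ?thesis using assms[OF t] by simp
    qed
  qed (auto simp: torus_mult character_mult)
  then have "component L \<eta> x * z - component L' \<eta> x = 0" using True unfolding X_def by (rule bspec)
  then show ?thesis by simp
next
  case False
  then have "filter (\<lambda>(a, k). weight k = \<eta>) L = []" "filter (\<lambda>(a, k). weight k = \<eta>) L' = []"
    by (force simp: filter_empty_conv)+
  then show ?thesis by (simp add: component_def)
qed

lemma coord_algebra_eval:
  assumes "f \<in> coord_algebra"
  shows "\<exists>L. (\<forall>a k. (a, k) \<in> set L \<longrightarrow> (\<forall>c. 0 \<le> k c)) \<and> f = laurent_eval L"
  using assms unfolding coord_algebra_def
proof induction
  case (const z)
  show ?case by (intro exI[of _ "[(z, \<lambda>_. 0)]"]) auto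
next
  case (gen g)
  then obtain c where c: "c \<in> C" "g = (\<lambda>x. x c)" by blast
  have "monomial x (\<lambda>c'. if c' = c then 1 else 0) = x c" for x
  proof -
    have "monomial x (\<lambda>c'. if c' = c then 1 else 0) = (\<Prod>c'\<in>C. if c' = c then x c else 1)"
      unfolding monomial_def by (rule prod.cong) auto
    then show ?thesis using c finite_C by simp
  qed
  then show ?case by (intro exI[of _ "[(1, \<lambda>c'. if c' = c then 1 else 0)]"]) (auto simp: c)
next
  case (add p q)
  then obtain L L' where "\<forall>a k. (a, k) \<in> set L \<longrightarrow> (\<forall>c. 0 \<le> k c)" "p = laurent_eval L" "\<forall>a k. (a, k) \<in> set L' \<longrightarrow> (\<forall>c. 0 \<le> k c)" "q = laurent_eval L'"
    by blast
  then show ?case by (intro exI[of _ "L @ L'"]) auto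
next
  case (mult p q)
  then obtain L L' where L: "\<forall>a k. (a, k) \<in> set L \<longrightarrow> (\<forall>c. 0 \<le> k c)" "p = laurent_eval L"
    "\<forall>a k. (a, k) \<in> set L' \<longrightarrow> (\<forall>c. 0 \<le> k c)" "q = laurent_eval L'" by blast
  have "laurent_eval (list_product L L') x = laurent_eval L x * laurent_eval L' x" for x
    by (intro eval_list_product monomial_add disjI2 conjI)
      (erule L(1)[rule_format], erule L(3)[rule_format])
  moreover have "\<forall>a k. (a, k) \<in> set (list_product L L') \<longrightarrow> (\<forall>c. 0 \<le> k c)"
    using L(1,3) unfolding set_list_product by fastforce
  ultimately show ?case using L by (intro exI[of _ "list_product L L'"]) auto
qed

lemma act_one: "x \<in> stable_points \<Longrightarrow> act (\<lambda>_. 1) x = x"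
  by (auto simp: act_def character_def stable_points_def)

lemma component_nonzero_exists:
  assumes "x \<in> stable_points" "laurent_eval L x \<noteq> 0"
  shows "\<exists>\<eta>. component L \<eta> x \<noteq> 0"
proof (rule ccontr)
  assume "\<nexists>\<eta>. component L \<eta> x \<noteq> 0"
  then have "laurent_eval L (act (\<lambda>_. 1) x) = 0"
    by (subst eval_act[of "(weight \<circ> snd) ` set L"]) (force simp: torus_def)+
  then show False using assms act_one by simp
qed

lemma component_nonzero_orbit:
  assumes "component L \<eta> x \<noteq> 0"
  shows "\<exists>l\<in>torus d. laurent_eval L (act l x) \<noteq> 0"
proof (rule ccontr)
  assume "\<not> (\<exists>l\<in>torus d. laurent_eval L (act l x) \<noteq> 0)"
  then have "component L \<eta> x * 1 = component [] \<eta> x" by (intro component_eq) auto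
  then show False using assms by (simp add: component_def)
qed

text \<open>An invertible monomial whose weight cancels a positive multiple of \<open>\<eta>\<close>.\<close>

lemma unit_of_opposite_weight:
  assumes S: "admissible S"
  shows "\<exists>N u. 0 < (N :: nat) \<and> laurent S (\<lambda>j. if j \<le> d then - int N * \<eta> j else 0) u \<and> (\<forall>x\<in>chart_domain S. u x \<noteq> 0)"
proof -
  obtain N k where k: "0 < (N :: nat)" "\<forall>c. c \<notin> C - S \<longrightarrow> k c = 0"
    "\<forall>i\<le>d. (\<Sum>c\<in>C. k c * w c i) + int N * \<eta> i = 0" using multiple_of_weight_spanned[OF S] by blast
  have lau: "laurent S (weight k) (\<lambda>x. monomial x k)" by (rule laurent_monomial) (use k in auto)
  have wt: "weight k = (\<lambda>j. if j \<le> d then - int N * \<eta> j else 0)"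
  proof
    fix j show "weight k j = (if j \<le> d then - int N * \<eta> j else 0)"
    proof (cases "j \<le> d")
      case True
      then have "(\<Sum>c\<in>C. k c * w c j) + int N * \<eta> j = 0" using k(3) by blast
      then have "(\<Sum>c\<in>C. k c * w c j) = - int N * \<eta> j" by linarith
      then show ?thesis using True by (simp add: weight_def)
    qed (simp add: weight_def)
  qed
  have "\<forall>x\<in>chart_domain S. monomial x k \<noteq> 0"
    using k(2) by (auto simp: monomial_eq_0_iff chart_domain_def)
  then show ?thesis using k(1) lau[unfolded wt]
    by (intro exI[of _ N] exI[of _ "\<lambda>x. monomial x k"] conjI)
qed

section \<open>The charts as quotients\<close>

text \<open>Cuts out \<open>chart_domain S\<close> as a principal open subset of the stable points.\<close>

definition boundary_product :: "'c set \<Rightarrow> ('c \<Rightarrow> complex) \<Rightarrow> complex" where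
  "boundary_product S x = (\<Prod>c\<in>C - S. x c)"

lemma boundary_product_algebra: "boundary_product S \<in> coord_algebra"
  unfolding boundary_product_def [abs_def] coord_algebra_def
  by (rule gen_algebra_prod) (auto intro: gen_algebra.gen)

lemma boundary_product_nz:
  "x \<in> stable_points \<Longrightarrow> boundary_product S x \<noteq> 0 \<longleftrightarrow> x \<in> chart_domain S"
  using finite_C by (auto simp: boundary_product_def chart_domain_def stable_points_def)

lemma boundary_product_chart: "x \<in> chart_domain S \<Longrightarrow> boundary_product S x \<noteq> 0"
  using finite_C by (auto simp: boundary_product_def chart_domain_def)

lemma clear_denominators:
  assumes S: "admissible S" and "q \<in> char_algebra S"
  shows "\<exists>r\<in>coord_algebra. \<exists>N. \<forall>x\<in>chart_domain S. q (chart_map S x) * boundary_product S x ^ N = r x"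
  using assms(2) unfolding char_algebra_def
proof induction
  case (const z)
  show ?case by (intro bexI[OF _ coord_algebra_intros(1)[of z]] exI[of _ 0]) simp
next
  case (gen g)
  then obtain m where m: "m \<in> dual_monoid n (ray_cone S)" "g = (\<lambda>\<gamma>. \<gamma> m)" by blast
  define N where "N = nat (\<Sum>c\<in>C. \<bar>exponent m c\<bar>)"
  have N: "\<bar>exponent m c\<bar> \<le> int N" if "c \<in> C" for c
    using member_le_sum[OF that, of "\<lambda>c. \<bar>exponent m c\<bar>"] finite_C by (simp add: N_def sum_nonneg)
  define r :: "('c \<Rightarrow> complex) \<Rightarrow> complex"
    where "r = (\<lambda>x. \<Prod>c\<in>C. x c ^ nat (exponent m c + (if c \<in> S then 0 else int N)))"
  have "r \<in> coord_algebra" unfolding r_def coord_algebra_def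
    by (intro gen_algebra_prod gen_algebra_power gen_algebra.gen) blast
  moreover have "g (chart_map S x) * boundary_product S x ^ N = r x" if x: "x \<in> chart_domain S" for x
  proof -
    have "boundary_product S x ^ N = (\<Prod>c\<in>C - S. x c ^ N)"
      by (simp add: boundary_product_def prod_power_distrib)
    also have "\<dots> = (\<Prod>c\<in>C. if c \<in> S then 1 else x c ^ N)"
      by (rule prod.mono_neutral_cong_left) (use finite_C in auto)
    finally have "g (chart_map S x) * boundary_product S x ^ N
        = (\<Prod>c\<in>C. x c powi exponent m c * (if c \<in> S then 1 else x c ^ N))"
      using m by (simp add: chart_map_def monomial_def prod.distrib)
    also have "\<dots> = r x" unfolding r_def
    proof (rule prod.cong[OF refl])
      fix c assume c: "c \<in> C"
      show "x c powi exponent m c * (if c \<in> S then 1 else x c ^ N)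
        = x c ^ nat (exponent m c + (if c \<in> S then 0 else int N))"
      proof (cases "c \<in> S")
        case True
        then have "0 \<le> exponent m c" using m by (simp add: dual_monoid_iff[OF S])
        then show ?thesis using True by (simp add: power_int_def)
      next
        case False
        then have "x c \<noteq> 0" using x c by (simp add: chart_domain_def)
        moreover have "0 \<le> exponent m c + int N" using N[OF c] by linarith
        ultimately have "x c ^ nat (exponent m c + int N) = x c powi exponent m c * x c powi int N"
          using power_int_add[of "x c" "exponent m c" "int N"] by (simp add: power_int_def)
        then show ?thesis using False by simp
      qed
    qed
    finally show ?thesis .
  qed
  ultimately show ?case by blast
next
  case (add p q)
  then obtain r N r' N' where r: "r \<in> coord_algebra" "r' \<in> coord_algebra"
    "\<forall>x\<in>chart_domain S. p (chart_map S x) * boundary_product S x ^ N = r x"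
    "\<forall>x\<in>chart_domain S. q (chart_map S x) * boundary_product S x ^ N' = r' x" by blast
  have pow: "(\<lambda>x. boundary_product S x ^ M) \<in> coord_algebra" for M
    using gen_algebra_power boundary_product_algebra unfolding coord_algebra_def by blast
  show ?case
    by (intro bexI[OF _ coord_algebra_intros(3)[OF coord_algebra_intros(4)[OF r(1) pow[of N']]
      coord_algebra_intros(4)[OF r(2) pow[of N]]]] exI[of _ "N + N'"])
      (use r in \<open>auto simp: power_add algebra_simps simp flip: r(3,4)[rule_format]\<close>)
next
  case (mult p q)
  then obtain r N r' N' where r: "r \<in> coord_algebra" "r' \<in> coord_algebra"
    "\<forall>x\<in>chart_domain S. p (chart_map S x) * boundary_product S x ^ N = r x"
    "\<forall>x\<in>chart_domain S. q (chart_map S x) * boundary_product S x ^ N' = r' x" by blast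
  show ?case
    by (intro bexI[OF _ coord_algebra_intros(4)[OF r(1,2)]] exI[of _ "N + N'"])
      (use r in \<open>auto simp: power_add algebra_simps simp flip: r(3,4)[rule_format]\<close>)
qed

lemma openin_stable_space:
  "openin (ztop stable_space) V \<longleftrightarrow>
     V \<subseteq> stable_points \<and> (\<forall>x\<in>V. \<exists>q\<in>coord_algebra. q x \<noteq> 0 \<and> {y \<in> stable_points. q y \<noteq> 0} \<subseteq> V)"
  unfolding stable_space_def coord_algebra_def by (rule openin_quasi_affine)

lemma openin_toric_chart:
  "openin (ztop (toric_chart n (ray_cone S))) E \<longleftrightarrow>
     E \<subseteq> chart_points n (ray_cone S) \<and>
     (\<forall>\<gamma>\<in>E. \<exists>q\<in>char_algebra S. q \<gamma> \<noteq> 0 \<and> {\<gamma>' \<in> chart_points n (ray_cone S). q \<gamma>' \<noteq> 0} \<subseteq> E)"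
  unfolding toric_chart_def char_algebra_def by (rule openin_quasi_affine)

lemma chart_map_act: "l \<in> torus d \<Longrightarrow> chart_map S (act l x) = chart_map S x"
  by (simp add: chart_map_def monomial_act_relation exponent_relations cong: restrict_cong)

lemma act_chart_domain: "l \<in> torus d \<Longrightarrow> x \<in> chart_domain S \<Longrightarrow> act l x \<in> chart_domain S"
  unfolding act_in_chart by (simp add: chart_domain_def)

text \<open>With \<open>g\<^sup>N u\<close> invariant for the unit \<open>u\<close> of weight \<open>-N \<eta>\<close>, the quotient \<open>f / g\<close> equals
  \<open>(f g\<^sup>N\<^sup>-\<^sup>1 u) / (g\<^sup>N u)\<close>, in which both terms are invariant.\<close>

lemma invariant_multiple:
  assumes S: "admissible S" and f: "laurent S \<eta> f" and g: "laurent S \<eta> g"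
    and \<eta>: "\<And>j. j > d \<Longrightarrow> \<eta> j = 0"
  shows "\<exists>p\<in>char_algebra S. \<exists>q\<in>char_algebra S. \<forall>x\<in>chart_domain S.
    (q (chart_map S x) \<noteq> 0 \<longleftrightarrow> g x \<noteq> 0) \<and>
    (g x \<noteq> 0 \<longrightarrow> p (chart_map S x) / q (chart_map S x) = f x / g x)"
proof -
  obtain N u where u: "0 < (N :: nat)" "laurent S (\<lambda>j. if j \<le> d then - int N * \<eta> j else 0) u"
    "\<forall>x\<in>chart_domain S. u x \<noteq> 0" using unit_of_opposite_weight[OF S, of \<eta>] by blast
  obtain M where M: "N = Suc M" using u(1) by (cases N) auto
  have wt: "(\<lambda>j. \<eta> j + int M * \<eta> j + (if j \<le> d then - int N * \<eta> j else 0)) = (\<lambda>_. 0)"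
  proof
    fix j show "\<eta> j + int M * \<eta> j + (if j \<le> d then - int N * \<eta> j else 0) = 0"
      using \<eta>[of j] by (cases "j \<le> d") (auto simp: M algebra_simps)
  qed
  have "laurent S (\<lambda>_. 0) (\<lambda>x. f x * g x ^ M * u x)"
    using laurent_mult[OF laurent_mult[OF f laurent_power[OF g, of M]] u(2)] unfolding wt .
  then obtain p where p: "p \<in> char_algebra S" "\<forall>x\<in>chart_domain S. f x * g x ^ M * u x = p (chart_map S x)"
    using invariant_is_pulled_back[OF S] by blast
  have "laurent S (\<lambda>_. 0) (\<lambda>x. g x * g x ^ M * u x)"
    using laurent_mult[OF laurent_mult[OF g laurent_power[OF g, of M]] u(2)] unfolding wt .
  then obtain q where q: "q \<in> char_algebra S" "\<forall>x\<in>chart_domain S. g x * g x ^ M * u x = q (chart_map S x)"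
    using invariant_is_pulled_back[OF S] by blast
  show ?thesis
  proof (rule bexI[OF _ p(1)], rule bexI[OF _ q(1)], intro ballI)
    fix x assume x: "x \<in> chart_domain S"
    have "p (chart_map S x) = f x * g x ^ M * u x" "q (chart_map S x) = g x * g x ^ M * u x"
      using p(2) q(2) x by auto
    then show "(q (chart_map S x) \<noteq> 0 \<longleftrightarrow> g x \<noteq> 0) \<and>
      (g x \<noteq> 0 \<longrightarrow> p (chart_map S x) / q (chart_map S x) = f x / g x)" using u(3) x by auto
  qed
qed

lemma weight_vanishes: "component L \<eta> x \<noteq> 0 \<Longrightarrow> j > d \<Longrightarrow> \<eta> j = 0"
proof -
  assume "component L \<eta> x \<noteq> 0" "j > d"
  then have "filter (\<lambda>(a, k). weight k = \<eta>) L \<noteq> []" by (auto simp: component_def)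
  then have "\<exists>k. weight k = \<eta>" by (auto simp: filter_empty_conv)
  then show "\<eta> j = 0" using \<open>j > d\<close> by (auto simp: weight_def)
qed

text \<open>Let the preimage of \<open>E\<close> be open, containing the principal open set of a polynomial \<open>f\<close> near a point.
  The principal open set of a weight component of \<open>f\<close> is contained in the union of the translates of
  that of \<open>f\<close>, hence still in the preimage. An invariant function with the same zeros as the component
  then gives a neighbourhood in the chart.\<close>

lemma openin_chart_iff:
  assumes S: "admissible S" and E: "E \<subseteq> chart_points n (ray_cone S)"
  shows "openin (ztop (toric_chart n (ray_cone S))) E \<longleftrightarrow>
    openin (ztop stable_space) {x \<in> chart_domain S. chart_map S x \<in> E}" (is "_ \<longleftrightarrow> openin _ ?V")
proof
  assume open_E: "openin (ztop (toric_chart n (ray_cone S))) E"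
  show "openin (ztop stable_space) ?V"
    unfolding openin_stable_space
  proof (intro conjI ballI)
    show "?V \<subseteq> stable_points" using chart_domain_stable[OF S] by blast
    fix x assume x: "x \<in> ?V"
    obtain q where q: "q \<in> char_algebra S" "q (chart_map S x) \<noteq> 0"
      "{\<gamma>' \<in> chart_points n (ray_cone S). q \<gamma>' \<noteq> 0} \<subseteq> E" using open_E x unfolding openin_toric_chart by blast
    obtain r N where r: "r \<in> coord_algebra"
      "\<And>x. x \<in> chart_domain S \<Longrightarrow> q (chart_map S x) * boundary_product S x ^ N = r x"
      using clear_denominators[OF S q(1)] by blast
    show "\<exists>q\<in>coord_algebra. q x \<noteq> 0 \<and> {y \<in> stable_points. q y \<noteq> 0} \<subseteq> ?V"
    proof (rule bexI[OF _ coord_algebra_intros(4)[OF r(1) boundary_product_algebra[of S]]], intro conjI subsetI)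
      have "boundary_product S x \<noteq> 0" using x boundary_product_chart by blast
      then show "r x * boundary_product S x \<noteq> 0" using x q(2) r(2)[of x, symmetric] by simp
      fix y assume y: "y \<in> {y \<in> stable_points. r y * boundary_product S y \<noteq> 0}"
      then have yS: "y \<in> chart_domain S" using boundary_product_nz by auto
      then have "q (chart_map S y) \<noteq> 0" using y r(2)[OF yS, symmetric] by simp
      then show "y \<in> ?V" using yS q(3) chart_map_in[OF S yS] by blast
    qed
  qed
next
  assume V: "openin (ztop stable_space) ?V"
  show "openin (ztop (toric_chart n (ray_cone S))) E"
    unfolding openin_toric_chart
  proof (intro conjI ballI)
    show "E \<subseteq> chart_points n (ray_cone S)" by (rule E)
    fix \<gamma> assume \<gamma>: "\<gamma> \<in> E"
    then obtain x where x: "x \<in> chart_domain S" "chart_map S x = \<gamma>" using chart_map_surj[OF S] E by blast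
    have xs: "x \<in> stable_points" using x chart_domain_stable[OF S] by blast
    obtain f where f: "f \<in> coord_algebra" "f x \<noteq> 0" "{y \<in> stable_points. f y \<noteq> 0} \<subseteq> ?V"
      using V x \<gamma> unfolding openin_stable_space by blast
    obtain L where L: "\<forall>a k. (a, k) \<in> set L \<longrightarrow> (\<forall>c. 0 \<le> k c)" "f = laurent_eval L" using coord_algebra_eval[OF f(1)] by blast
    obtain \<eta> where \<eta>: "component L \<eta> x \<noteq> 0" using component_nonzero_exists[OF xs] f(2) L(2) by blast
    have lau: "laurent S \<eta> (component L \<eta>)" by (rule component_laurent) (use L(1) in auto)
    obtain q where q: "q \<in> char_algebra S"
      "\<And>y. y \<in> chart_domain S \<Longrightarrow> q (chart_map S y) \<noteq> 0 \<longleftrightarrow> component L \<eta> y \<noteq> 0"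
      using invariant_multiple[OF S lau lau weight_vanishes[OF \<eta>]] by blast
    show "\<exists>q\<in>char_algebra S. q \<gamma> \<noteq> 0 \<and> {\<gamma>' \<in> chart_points n (ray_cone S). q \<gamma>' \<noteq> 0} \<subseteq> E"
    proof (rule bexI[OF _ q(1)], intro conjI subsetI)
      show "q \<gamma> \<noteq> 0" using q(2)[OF x(1)] \<eta> x(2) by simp
      fix \<gamma>' assume \<gamma>': "\<gamma>' \<in> {\<gamma>' \<in> chart_points n (ray_cone S). q \<gamma>' \<noteq> 0}"
      then obtain y where y: "y \<in> chart_domain S" "chart_map S y = \<gamma>'" using chart_map_surj[OF S] by blast
      then have "component L \<eta> y \<noteq> 0" using q(2)[OF y(1)] \<gamma>' by simp
      then obtain l where l: "l \<in> torus d" "laurent_eval L (act l y) \<noteq> 0" using component_nonzero_orbit by blast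
      have "act l y \<in> stable_points"
        using act_stable[OF l(1)] y(1) chart_domain_stable[OF S] by blast
      then have "act l y \<in> ?V" using f(3) l(2) L(2) by blast
      then show "\<gamma>' \<in> E" using y(2) chart_map_act[OF l(1)] by simp
    qed
  qed
qed

text \<open>Let the pullback of \<open>f\<close> equal \<open>p / q\<close> near a point. The pullback is constant on orbits, so each
  weight component of \<open>q\<close> times it is the corresponding component of \<open>p\<close>; a component of \<open>q\<close> that does
  not vanish at the given point provides a representation by invariant functions.\<close>

lemma reg_chart_iff:
  assumes S: "admissible S" and E: "E \<subseteq> chart_points n (ray_cone S)"
  shows "f \<in> reg (toric_chart n (ray_cone S)) E \<longleftrightarrow>
    f \<circ> chart_map S \<in> reg stable_space {x \<in> chart_domain S. chart_map S x \<in> E}" (is "_ \<longleftrightarrow> _ \<in> reg _ ?V")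
proof
  assume f: "f \<in> reg (toric_chart n (ray_cone S)) E"
  show "f \<circ> chart_map S \<in> reg stable_space ?V"
    unfolding stable_space_def reg_quasi_affine
  proof
    fix x assume x: "x \<in> ?V"
    obtain p q where pq: "p \<in> char_algebra S" "q \<in> char_algebra S" "q (chart_map S x) \<noteq> 0"
      "\<And>\<gamma>. \<gamma> \<in> E \<Longrightarrow> q \<gamma> \<noteq> 0 \<Longrightarrow> f \<gamma> = p \<gamma> / q \<gamma>"
      using f x unfolding toric_chart_def reg_quasi_affine char_algebra_def[symmetric] by blast
    obtain r N where r: "r \<in> coord_algebra"
      "\<And>x. x \<in> chart_domain S \<Longrightarrow> p (chart_map S x) * boundary_product S x ^ N = r x"
      using clear_denominators[OF S pq(1)] by blast
    obtain r' N' where r': "r' \<in> coord_algebra"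
      "\<And>x. x \<in> chart_domain S \<Longrightarrow> q (chart_map S x) * boundary_product S x ^ N' = r' x"
      using clear_denominators[OF S pq(2)] by blast
    have pow: "(\<lambda>x. boundary_product S x ^ M) \<in> coord_algebra" for M
      using gen_algebra_power boundary_product_algebra unfolding coord_algebra_def by blast
    show "\<exists>p\<in>coord_algebra. \<exists>q\<in>coord_algebra. q x \<noteq> 0 \<and>
        (\<forall>y\<in>?V. q y \<noteq> 0 \<longrightarrow> (f \<circ> chart_map S) y = p y / q y)"
    proof (rule bexI[OF _ coord_algebra_intros(4)[OF r(1) pow[of N']]],
        rule bexI[OF _ coord_algebra_intros(4)[OF r'(1) pow[of N]]], intro conjI ballI impI)
      show "r' x * boundary_product S x ^ N \<noteq> 0"
        using x pq(3) r'(2)[of x, symmetric] boundary_product_chart[of x S] by simp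
      fix y assume y: "y \<in> ?V" "r' y * boundary_product S y ^ N \<noteq> 0"
      have h: "boundary_product S y \<noteq> 0" using y boundary_product_chart by blast
      have "q (chart_map S y) \<noteq> 0" using y r'(2)[of y, symmetric] by simp
      then have "f (chart_map S y) = p (chart_map S y) / q (chart_map S y)" using y pq(4) by simp
      then show "(f \<circ> chart_map S) y = r y * boundary_product S y ^ N' / (r' y * boundary_product S y ^ N)"
        using y h by (simp add: r(2)[of y, symmetric] r'(2)[of y, symmetric])
    qed
  qed
next
  assume F: "f \<circ> chart_map S \<in> reg stable_space ?V"
  show "f \<in> reg (toric_chart n (ray_cone S)) E"
    unfolding toric_chart_def reg_quasi_affine char_algebra_def[symmetric]
  proof
    fix \<gamma> assume \<gamma>: "\<gamma> \<in> E"
    then obtain x where x: "x \<in> chart_domain S" "chart_map S x = \<gamma>" using chart_map_surj[OF S] E by blast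
    have xs: "x \<in> stable_points" using x chart_domain_stable[OF S] by blast
    obtain p q where pq: "p \<in> coord_algebra" "q \<in> coord_algebra" "q x \<noteq> 0"
      "\<And>y. y \<in> ?V \<Longrightarrow> q y \<noteq> 0 \<Longrightarrow> f (chart_map S y) = p y / q y"
      using F x \<gamma> unfolding stable_space_def reg_quasi_affine by fastforce
    \<comment> \<open>Multiplying by \<open>q\<close> makes the relation hold where \<open>q\<close> vanishes, too.\<close>
    obtain L where L: "\<forall>a k. (a, k) \<in> set L \<longrightarrow> (\<forall>c. 0 \<le> k c)" "(\<lambda>x. q x * q x) = laurent_eval L"
      using coord_algebra_eval[OF coord_algebra_intros(4)[OF pq(2,2)]] by blast
    obtain L' where L': "\<forall>a k. (a, k) \<in> set L' \<longrightarrow> (\<forall>c. 0 \<le> k c)" "(\<lambda>x. p x * q x) = laurent_eval L'"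
      using coord_algebra_eval[OF coord_algebra_intros(4)[OF pq(1,2)]] by blast
    have rel: "laurent_eval L y * f (chart_map S y) = laurent_eval L' y" if "y \<in> ?V" for y
      using pq(4)[OF that] by (cases "q y = 0") (auto simp flip: L(2) L'(2))
    have comp: "component L \<eta> y * f (chart_map S y) = component L' \<eta> y" if y: "y \<in> ?V" for y \<eta>
    proof (rule component_eq)
      fix l assume l: "l \<in> torus d"
      then have "act l y \<in> ?V" using y by (simp add: chart_map_act act_chart_domain)
      from rel[OF this] show "laurent_eval L (act l y) * f (chart_map S y) = laurent_eval L' (act l y)"
        by (simp add: chart_map_act[OF l])
    qed
    have "laurent_eval L x \<noteq> 0" using pq(3) by (simp flip: L(2))
    then obtain \<eta> where \<eta>: "component L \<eta> x \<noteq> 0" using component_nonzero_exists[OF xs] by blast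
    have lau: "laurent S \<eta> (component L \<eta>)" "laurent S \<eta> (component L' \<eta>)"
      using L(1) L'(1) by (auto intro!: component_laurent)
    obtain p' q' where pq': "p' \<in> char_algebra S" "q' \<in> char_algebra S"
      "\<And>y. y \<in> chart_domain S \<Longrightarrow> q' (chart_map S y) \<noteq> 0 \<longleftrightarrow> component L \<eta> y \<noteq> 0"
      "\<And>y. y \<in> chart_domain S \<Longrightarrow> component L \<eta> y \<noteq> 0 \<Longrightarrow>
        p' (chart_map S y) / q' (chart_map S y) = component L' \<eta> y / component L \<eta> y"
      using invariant_multiple[OF S lau(2,1) weight_vanishes[OF \<eta>]] by blast
    show "\<exists>p\<in>char_algebra S. \<exists>q\<in>char_algebra S. q \<gamma> \<noteq> 0 \<and> (\<forall>\<gamma>'\<in>E. q \<gamma>' \<noteq> 0 \<longrightarrow> f \<gamma>' = p \<gamma>' / q \<gamma>')"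
    proof (rule bexI[OF _ pq'(1)], rule bexI[OF _ pq'(2)], intro conjI ballI impI)
      show "q' \<gamma> \<noteq> 0" using pq'(3)[OF x(1)] \<eta> x(2) by simp
      fix \<gamma>' assume \<gamma>': "\<gamma>' \<in> E" "q' \<gamma>' \<noteq> 0"
      then obtain y where y: "y \<in> chart_domain S" "chart_map S y = \<gamma>'" using chart_map_surj[OF S] E by blast
      have nz: "component L \<eta> y \<noteq> 0" using pq'(3)[OF y(1)] \<gamma>'(2) y(2) by simp
      have "component L \<eta> y * f \<gamma>' = component L' \<eta> y" using comp[of y \<eta>] y \<gamma>'(1) by simp
      then have "f \<gamma>' = component L' \<eta> y / component L \<eta> y" using nz by (simp add: field_simps)
      then show "f \<gamma>' = p' \<gamma>' / q' \<gamma>'" using pq'(4)[OF y(1) nz] y(2) by simp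
    qed
  qed
qed

section \<open>The toric variety as a quotient\<close>

lemma topspace_stable_space [simp]: "topspace (ztop stable_space) = stable_points"
  by (simp add: stable_space_def coord_algebra_def)

lemma topspace_toric_chart [simp]: "topspace (ztop (toric_chart n \<sigma>)) = chart_points n \<sigma>"
  by (simp add: toric_chart_def)

lemma glued_points_preimage:
  assumes S: "admissible S"
  shows "{x \<in> chart_domain S. chart_map S x \<in> {\<gamma> \<in> chart_points n (ray_cone S). glued_point n cones (ray_cone S) \<gamma> \<in> W}}
    = {x \<in> chart_domain S. toric_point x \<in> W}"
  using chart_map_in[OF S] glued_point_chart_map[OF S] by auto

lemma topspace_toric_variety: "topspace (ztop (toric_variety n cones)) = toric_point ` stable_points"
proof -
  have "(\<Union>\<sigma>\<in>cones. glued_point n cones \<sigma> ` chart_points n \<sigma>) = toric_point ` stable_points"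
  proof (intro subset_antisym subsetI)
    fix q assume "q \<in> (\<Union>\<sigma>\<in>cones. glued_point n cones \<sigma> ` chart_points n \<sigma>)"
    then obtain S \<gamma> where S: "admissible S" "\<gamma> \<in> chart_points n (ray_cone S)"
      "q = glued_point n cones (ray_cone S) \<gamma>" by (auto simp: cones_def)
    obtain x where x: "x \<in> chart_domain S" "chart_map S x = \<gamma>" using chart_map_surj[OF S(1,2)] by blast
    then show "q \<in> toric_point ` stable_points"
      using glued_point_chart_map[OF S(1) x(1)] S(3) chart_domain_stable[OF S(1)] by auto
  next
    fix q assume "q \<in> toric_point ` stable_points"
    then obtain x where x: "x \<in> stable_points" "q = toric_point x" by blast
    define S where "S = {c \<in> C. x c = 0}"
    have S: "admissible S" "x \<in> chart_domain S" using stable_point_in_chart[OF x(1)] by (simp_all add: S_def)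
    then show "q \<in> (\<Union>\<sigma>\<in>cones. glued_point n cones \<sigma> ` chart_points n \<sigma>)"
      using glued_point_chart_map[OF S] chart_map_in[OF S] x(2) by (auto simp: cones_def image_iff)
  qed
  then show ?thesis by (simp add: toric_variety_def topspace_final_fspace)
qed

lemma openin_chart_domain: "admissible S \<Longrightarrow> openin (ztop stable_space) (chart_domain S)"
  unfolding openin_stable_space
  using chart_domain_stable[of S] boundary_product_algebra[of S] boundary_product_nz[of _ S] by blast

lemma openin_toric_variety:
  "openin (ztop (toric_variety n cones)) W \<longleftrightarrow> W \<subseteq> toric_point ` stable_points \<and>
     openin (ztop stable_space) {x \<in> stable_points. toric_point x \<in> W}"
proof -
  have "openin (ztop (toric_variety n cones)) W \<longleftrightarrow> W \<subseteq> topspace (ztop (toric_variety n cones)) \<and>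
    (\<forall>S. admissible S \<longrightarrow> openin (ztop (toric_chart n (ray_cone S)))
      {\<gamma> \<in> chart_points n (ray_cone S). glued_point n cones (ray_cone S) \<gamma> \<in> W})"
    unfolding toric_variety_def openin_final_fspace topspace_final_fspace by (simp add: cones_def)
  also have "(\<forall>S. admissible S \<longrightarrow> openin (ztop (toric_chart n (ray_cone S)))
      {\<gamma> \<in> chart_points n (ray_cone S). glued_point n cones (ray_cone S) \<gamma> \<in> W}) \<longleftrightarrow>
    (\<forall>S. admissible S \<longrightarrow> openin (ztop stable_space) {x \<in> chart_domain S. toric_point x \<in> W})"
    by (intro all_cong imp_cong refl, subst openin_chart_iff, assumption, blast,
        subst glued_points_preimage, assumption, rule refl)
  also have "\<dots> \<longleftrightarrow> openin (ztop stable_space) {x \<in> stable_points. toric_point x \<in> W}"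
  proof
    assume R: "\<forall>S. admissible S \<longrightarrow> openin (ztop stable_space) {x \<in> chart_domain S. toric_point x \<in> W}"
    have "{x \<in> stable_points. toric_point x \<in> W}
        = \<Union>((\<lambda>S. {x \<in> chart_domain S. toric_point x \<in> W}) ` {S. admissible S})"
      using stable_point_in_chart chart_domain_stable by fast
    then show "openin (ztop stable_space) {x \<in> stable_points. toric_point x \<in> W}"
      using R by (simp only:) (intro openin_Union, blast)
  next
    assume R: "openin (ztop stable_space) {x \<in> stable_points. toric_point x \<in> W}"
    show "\<forall>S. admissible S \<longrightarrow> openin (ztop stable_space) {x \<in> chart_domain S. toric_point x \<in> W}"
    proof (intro allI impI)
      fix S assume S: "admissible S"
      have "{x \<in> chart_domain S. toric_point x \<in> W} = chart_domain S \<inter> {x \<in> stable_points. toric_point x \<in> W}"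
        using chart_domain_stable[OF S] by blast
      then show "openin (ztop stable_space) {x \<in> chart_domain S. toric_point x \<in> W}"
        using openin_Int[OF openin_chart_domain[OF S] R] by simp
    qed
  qed
  finally show ?thesis by (simp add: topspace_toric_variety)
qed

lemma reg_toric_variety:
  "f \<in> reg (toric_variety n cones) W \<longleftrightarrow>
     f \<circ> toric_point \<in> reg stable_space {x \<in> stable_points. toric_point x \<in> W}"
proof -
  have "f \<in> reg (toric_variety n cones) W \<longleftrightarrow>
    (\<forall>S. admissible S \<longrightarrow> f \<circ> glued_point n cones (ray_cone S) \<in> reg (toric_chart n (ray_cone S))
      {\<gamma> \<in> chart_points n (ray_cone S). glued_point n cones (ray_cone S) \<gamma> \<in> W})"
    unfolding toric_variety_def reg_final_fspace by (simp add: cones_def)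
  also have "\<dots> \<longleftrightarrow> (\<forall>S. admissible S \<longrightarrow>
      f \<circ> toric_point \<in> reg stable_space {x \<in> chart_domain S. toric_point x \<in> W})"
  proof (intro all_cong imp_cong refl)
    fix S assume S: "admissible S"
    have "f \<circ> glued_point n cones (ray_cone S) \<in> reg (toric_chart n (ray_cone S))
        {\<gamma> \<in> chart_points n (ray_cone S). glued_point n cones (ray_cone S) \<gamma> \<in> W}
      \<longleftrightarrow> (f \<circ> glued_point n cones (ray_cone S)) \<circ> chart_map S
        \<in> reg stable_space {x \<in> chart_domain S. toric_point x \<in> W}"
      by (subst reg_chart_iff[OF S], blast, subst glued_points_preimage[OF S], rule refl)
    also have "\<dots> \<longleftrightarrow> f \<circ> toric_point \<in> reg stable_space {x \<in> chart_domain S. toric_point x \<in> W}"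
      unfolding stable_space_def by (rule reg_quasi_affine_cong) (simp add: glued_point_chart_map[OF S])
    finally show "f \<circ> glued_point n cones (ray_cone S) \<in> reg (toric_chart n (ray_cone S))
        {\<gamma> \<in> chart_points n (ray_cone S). glued_point n cones (ray_cone S) \<gamma> \<in> W}
      \<longleftrightarrow> f \<circ> toric_point \<in> reg stable_space {x \<in> chart_domain S. toric_point x \<in> W}" .
  qed
  also have "\<dots> \<longleftrightarrow> f \<circ> toric_point \<in> reg stable_space {x \<in> stable_points. toric_point x \<in> W}"
  proof
    assume R: "\<forall>S. admissible S \<longrightarrow>
      f \<circ> toric_point \<in> reg stable_space {x \<in> chart_domain S. toric_point x \<in> W}"
    show "f \<circ> toric_point \<in> reg stable_space {x \<in> stable_points. toric_point x \<in> W}"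
      unfolding stable_space_def coord_algebra_def
    proof (rule reg_quasi_affine_local, unfold coord_algebra_def[symmetric] stable_space_def[symmetric])
      fix x assume x: "x \<in> {x \<in> stable_points. toric_point x \<in> W}"
      define S where "S = {c \<in> C. x c = 0}"
      have S: "admissible S" "x \<in> chart_domain S" using stable_point_in_chart x by (simp_all add: S_def)
      have "{y \<in> {x \<in> stable_points. toric_point x \<in> W}. boundary_product S y \<noteq> 0}
          = {x \<in> chart_domain S. toric_point x \<in> W}"
        using boundary_product_nz[of _ S] chart_domain_stable[OF S(1)] by blast
      then show "\<exists>h\<in>coord_algebra. h x \<noteq> 0 \<and> f \<circ> toric_point \<in> reg stable_space
          {y \<in> {x \<in> stable_points. toric_point x \<in> W}. h y \<noteq> 0}"
        using R S boundary_product_chart boundary_product_algebra by (intro bexI[of _ "boundary_product S"]) auto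
    qed
  next
    assume R: "f \<circ> toric_point \<in> reg stable_space {x \<in> stable_points. toric_point x \<in> W}"
    show "\<forall>S. admissible S \<longrightarrow>
      f \<circ> toric_point \<in> reg stable_space {x \<in> chart_domain S. toric_point x \<in> W}"
      using R chart_domain_stable unfolding stable_space_def
      by (blast intro: reg_quasi_affine_subset)
  qed
  finally show ?thesis .
qed

text \<open>The projection \<open>\<pi>\<close> may take values in any type, as long as its fibres are the orbits.\<close>

theorem torus_quotient_toric_orbifold:
  fixes \<pi> :: "('c \<Rightarrow> complex) \<Rightarrow> 'q"
  assumes \<pi>: "\<And>x y. x \<in> stable_points \<Longrightarrow> y \<in> stable_points \<Longrightarrow>
      \<pi> x = \<pi> y \<longleftrightarrow> (\<exists>l\<in>torus d. y = act l x)"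
  shows "compact_toric_orbifold (final_fspace {()} (\<lambda>_. stable_space) (\<lambda>_. \<pi>))"
proof -
  let ?X = "final_fspace {()} (\<lambda>_. stable_space) (\<lambda>_. \<pi>)" and ?Y = "toric_variety n cones"
  define \<phi> where "\<phi> = (\<lambda>q. toric_point (SOME x. x \<in> stable_points \<and> \<pi> x = q))"
  have \<phi>: "\<phi> (\<pi> x) = toric_point x" if x: "x \<in> stable_points" for x
  proof -
    define y where "y = (SOME y. y \<in> stable_points \<and> \<pi> y = \<pi> x)"
    have y: "y \<in> stable_points \<and> \<pi> y = \<pi> x" unfolding y_def
      by (rule someI[of "\<lambda>y. y \<in> stable_points \<and> \<pi> y = \<pi> x" x]) (simp add: x)
    then have "toric_point y = toric_point x"
      using \<pi>[of y x] toric_point_eq_iff[of y x] x by blast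
    then show ?thesis by (simp add: \<phi>_def y_def)
  qed
  have topX: "topspace (ztop ?X) = \<pi> ` stable_points" by (simp add: topspace_final_fspace)
  have pre: "{x \<in> stable_points. \<pi> x \<in> \<pi> ` stable_points \<and> \<phi> (\<pi> x) \<in> W}
      = {x \<in> stable_points. toric_point x \<in> W}" for W
    by (intro Collect_cong conj_cong refl) (simp add: \<phi>)
  have "homeomorphic_map (ztop ?X) (ztop ?Y) \<phi>"
    unfolding homeomorphic_map_def quotient_map_def
  proof (intro conjI allI impI)
    show "\<phi> ` topspace (ztop ?X) = topspace (ztop ?Y)"
      unfolding topX topspace_toric_variety image_image by (rule image_cong) (auto simp: \<phi>)
    show "inj_on \<phi> (topspace (ztop ?X))"
      unfolding topX by (auto simp: inj_on_def \<phi> \<pi> toric_point_eq_iff)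
    fix W assume "W \<subseteq> topspace (ztop ?Y)"
    then show "openin (ztop ?X) {q. q \<in> topspace (ztop ?X) \<and> \<phi> q \<in> W} \<longleftrightarrow> openin (ztop ?Y) W"
      unfolding openin_toric_variety topX openin_final_fspace
      using pre[of W] by (auto simp: topspace_toric_variety)
  qed
  moreover have "f \<in> reg ?Y W \<longleftrightarrow> f \<circ> \<phi> \<in> reg ?X {q \<in> topspace (ztop ?X). \<phi> q \<in> W}" for W f
  proof -
    have "f \<circ> \<phi> \<in> reg ?X {q \<in> topspace (ztop ?X). \<phi> q \<in> W}
        \<longleftrightarrow> (f \<circ> \<phi>) \<circ> \<pi> \<in> reg stable_space {x \<in> stable_points. toric_point x \<in> W}"
      by (simp add: reg_final_fspace topX pre)
    also have "\<dots> \<longleftrightarrow> f \<circ> toric_point \<in> reg stable_space {x \<in> stable_points. toric_point x \<in> W}"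
      unfolding stable_space_def by (rule reg_quasi_affine_cong) (simp add: \<phi>)
    finally show ?thesis by (simp add: reg_toric_variety)
  qed
  ultimately have "fspace_iso ?X ?Y \<phi>" by (simp add: fspace_iso_def)
  then show ?thesis
    unfolding compact_toric_orbifold_def fspace_isomorphic_def
    using cones_complete cones_simplicial by blast
qed

end

section \<open>Quasi-maps to the weighted projective space\<close>

text \<open>The coordinates are grouped by the nonvanishing condition in which they occur; for \<open>cB k\<close> these
  are the triples \<open>k = 3 j - 1, 3 j, 3 j + 1\<close>.\<close>

fun qm_group :: "coord \<Rightarrow> nat" where
  "qm_group (cA i j) = j"
| "qm_group (cB k) = (k + 1) div 3"
| "qm_group (cU k) = k"

text \<open>The weights of the \<open>cB k\<close> run through the lattice points of the segments from \<open>3 e\<^sub>j\<close> to \<open>3 e\<^sub>j\<^sub>+\<^sub>1\<close>.\<close>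

fun qm_weight :: "coord \<Rightarrow> nat \<Rightarrow> int" where
  "qm_weight (cA i j) l = of_bool (l = j)"
| "qm_weight (cB k) l = (3 - int (k mod 3)) * of_bool (l = k div 3) + int (k mod 3) * of_bool (l = k div 3 + 1)"
| "qm_weight (cU k) l = 2 * of_bool (l = k) - of_bool (l + 1 = k) - of_bool (l = k + 1)"

definition qm_height :: "nat \<Rightarrow> nat \<Rightarrow> real" where
  "qm_height d j = (real j + 1) * (real d + 1 - real j)"

lemma finite_coords: "finite (coords d)"
proof -
  have "coords d = (\<lambda>(i, j). cA i j) ` ({..2} \<times> {..d}) \<union> cB ` {..3 * d} \<union> cU ` {1..d - 1}"
    by (auto simp: coords_def)
  then show ?thesis by simp
qed

lemma sum_of_bool_eq:
  assumes "finite A"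
  shows "(\<Sum>l\<in>A. of_bool (l = j) * f l) = (if j \<in> A then f j else 0 :: real)"
proof -
  have "(\<Sum>l\<in>A. of_bool (l = j) * f l) = (\<Sum>l\<in>A. if l = j then f j else 0)" by (rule sum.cong) auto
  then show ?thesis using assms by simp
qed

lemma B_cases:
  fixes k :: nat
  obtains (zero) j where "k = 3 * j" | (one) j where "k = 3 * j + 1" | (two) j where "k = 3 * j + 2"
proof -
  have "k = 3 * (k div 3) + k mod 3" "k mod 3 < 3" by simp_all
  then consider "k = 3 * (k div 3)" | "k = 3 * (k div 3) + 1" | "k = 3 * (k div 3) + 2" by linarith
  then show ?thesis using that by cases blast+
qed

lemma weight_B_simps [simp]:
  "qm_weight (cB (3 * j)) l = 3 * of_bool (l = j)"
  "qm_weight (cB (3 * j + 1)) l = 2 * of_bool (l = j) + of_bool (l = j + 1)"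
  "qm_weight (cB (3 * j + 2)) l = of_bool (l = j) + 2 * of_bool (l = j + 1)"
  "qm_weight (cB (Suc (3 * j))) l = 2 * of_bool (l = j) + of_bool (l = j + 1)"
  "qm_weight (cB (Suc (Suc (3 * j)))) l = of_bool (l = j) + 2 * of_bool (l = j + 1)"
proof -
  have "(3 * j + 1) mod 3 = 1" "(3 * j + 1) div 3 = j" "(3 * j + 2) mod 3 = 2" "(3 * j + 2) div 3 = j"
    by presburger+
  then show "qm_weight (cB (3 * j)) l = 3 * of_bool (l = j)"
    and "qm_weight (cB (3 * j + 1)) l = 2 * of_bool (l = j) + of_bool (l = j + 1)"
    and "qm_weight (cB (3 * j + 2)) l = of_bool (l = j) + 2 * of_bool (l = j + 1)" by simp_all
  then show "qm_weight (cB (Suc (3 * j))) l = 2 * of_bool (l = j) + of_bool (l = j + 1)"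
    and "qm_weight (cB (Suc (Suc (3 * j)))) l = of_bool (l = j) + 2 * of_bool (l = j + 1)"
    by (simp_all only: Suc_eq_plus1 add.assoc nat_1_add_1)
qed

lemma group_B_simps:
  "qm_group (cB (3 * j)) = j" "qm_group (cB (3 * j + 1)) = j" "qm_group (cB (3 * j + 2)) = j + 1"
  "qm_group (cB (Suc (3 * j))) = j" "qm_group (cB (Suc (Suc (3 * j)))) = Suc j"
proof -
  have "(3 * j + 1) div 3 = j" "(3 * j + 1 + 1) div 3 = j" "(3 * j + 2 + 1) div 3 = j + 1" by presburger+
  then show "qm_group (cB (3 * j)) = j" "qm_group (cB (3 * j + 1)) = j" "qm_group (cB (3 * j + 2)) = j + 1"
    and "qm_group (cB (Suc (3 * j))) = j" "qm_group (cB (Suc (Suc (3 * j)))) = Suc j"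
    unfolding qm_group.simps by simp_all
qed

text \<open>The inequalities to be checked are \<open>p\<^sub>j\<^sub>+\<^sub>1 < 2 p\<^sub>j\<close>, \<open>p\<^sub>j < 2 p\<^sub>j\<^sub>+\<^sub>1\<close> and
  \<open>p\<^sub>j + p\<^sub>j\<^sub>+\<^sub>2 < 2 p\<^sub>j\<^sub>+\<^sub>1\<close>, where \<open>p\<close> is the quadratic \<open>qm_height\<close>, with second difference \<open>-2\<close>.\<close>

lemma dominant_grading_qm:
  assumes "d \<ge> 1"
  shows "dominant_grading (coords d) d qm_group qm_weight (cA 0) (qm_height d)"
proof
  have pos: "0 < qm_height d j" if "j \<le> d" for j using that by (simp add: qm_height_def)
  have up: "qm_height d (j + 1) < 2 * qm_height d j" if j: "j + 1 \<le> d" for j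
  proof -
    obtain m where "d = j + 1 + m" using le_Suc_ex[OF j] by blast
    moreover have "0 < 2 + (real j * real m + real j * 3)"
      by (intro add_pos_nonneg add_nonneg_nonneg) simp_all
    ultimately show ?thesis by (simp add: qm_height_def algebra_simps)
  qed
  have down: "qm_height d j < 2 * qm_height d (j + 1)" if j: "j + 1 \<le> d" for j
  proof -
    obtain m where "d = j + 1 + m" using le_Suc_ex[OF j] by blast
    moreover have "0 < 2 + (real j * real m + real m * 3)"
      by (intro add_pos_nonneg add_nonneg_nonneg) simp_all
    ultimately show ?thesis by (simp add: qm_height_def algebra_simps)
  qed
  have concave: "qm_height d j + qm_height d (j + 2) < 2 * qm_height d (j + 1)" for j
    by (simp add: qm_height_def algebra_simps)
  show "finite (coords d)" by (rule finite_coords)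
  show "qm_group c \<le> d" if "c \<in> coords d" for c
    using that by (auto simp: coords_def)
  show "cA 0 j \<in> coords d" if "j \<le> d" for j using that by (simp add: coords_def)
  show "qm_group (cA 0 j) = j" for j by simp
  show "qm_weight (cA 0 j) i = (if i = j then 1 else 0)" for i j by simp
  show "0 < qm_height d j" if "j \<le> d" for j using that by (rule pos)
  fix c assume c: "c \<in> coords d"
  have split: "(\<Sum>l\<in>{..d} - {g}. \<bar>real_of_int (qm_weight c l)\<bar> * qm_height d l)
      = a * (if i \<in> {..d} - {g} then qm_height d i else 0) + b * (if j \<in> {..d} - {g} then qm_height d j else 0)"
    if "\<And>l. l \<noteq> g \<Longrightarrow> \<bar>real_of_int (qm_weight c l)\<bar> = a * of_bool (l = i) + b * of_bool (l = j)" for a b g i j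
  proof -
    have "(\<Sum>l\<in>{..d} - {g}. \<bar>real_of_int (qm_weight c l)\<bar> * qm_height d l)
        = (\<Sum>l\<in>{..d} - {g}. a * (of_bool (l = i) * qm_height d l) + b * (of_bool (l = j) * qm_height d l))"
      by (rule sum.cong) (use that in \<open>auto simp: algebra_simps\<close>)
    then show ?thesis by (simp only: sum.distrib sum_distrib_left[symmetric] sum_of_bool_eq finite_Diff finite_atMost)
  qed
  show "(\<Sum>i\<in>{..d} - {qm_group c}. \<bar>real_of_int (qm_weight c i)\<bar> * qm_height d i)
      < real_of_int (qm_weight c (qm_group c)) * qm_height d (qm_group c)"
  proof (cases c)
    case (cA i j)
    then have "j \<le> d" using c by (auto simp: coords_def)
    then show ?thesis using pos split[of j 0 0 0 0] cA by simp
  next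
    case (cB k)
    then have k: "k \<le> 3 * d" using c by (auto simp: coords_def)
    show ?thesis
    proof (cases k rule: B_cases)
      case (zero j)
      then have "j \<le> d" using k by simp
      then show ?thesis using pos[of j] split[of j 0 0 0 0] cB zero
        by (simp add: group_B_simps del: qm_weight.simps qm_group.simps)
    next
      case (one j)
      then have "j + 1 \<le> d" using k by simp
      then show ?thesis using up[of j] split[of j 1 "j + 1" 0 0] cB one
        by (simp add: group_B_simps del: qm_weight.simps qm_group.simps)
    next
      case (two j)
      then have "j + 1 \<le> d" using k by simp
      then show ?thesis using down[of j] split[of "j + 1" 1 j 0 0] cB two
        by (simp add: group_B_simps del: qm_weight.simps qm_group.simps)
    qed
  next
    case (cU k)
    then have "1 \<le> k" "k \<le> d - 1" using c by (auto simp: coords_def)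
    then obtain j where j: "k = j + 1" "j + 2 \<le> d" using assms
      by (metis add.commute le_Suc_ex le_diff_conv2 add_2_eq_Suc' Suc_eq_plus1 add_le_cancel_right one_add_one add.assoc)
    then show ?thesis using concave[of j] split[of "j + 1" 1 j 1 "j + 2"] cU by simp
  qed
qed

lemma prod_powi_of_bool:
  fixes l :: "nat \<Rightarrow> complex"
  assumes "i \<le> d"
  shows "(\<Prod>j\<le>d. l j powi (a * of_bool (j = i))) = l i powi a"
proof -
  have "(\<Prod>j\<le>d. l j powi (a * of_bool (j = i))) = (\<Prod>j\<le>d. if j = i then l i powi a else 1)"
    by (rule prod.cong) auto
  then show ?thesis using assms by simp
qed

lemma qm_group_nonzero_iff:
  assumes "d \<ge> 1" and j: "j \<le> d"
  shows "(\<exists>c\<in>coords d. qm_group c = j \<and> x c \<noteq> 0) \<longleftrightarrow>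
      (\<exists>i\<le>2. x (cA i j) \<noteq> 0) \<or> (1 \<le> j \<and> x (cB (3 * j - 1)) \<noteq> 0) \<or> x (cB (3 * j)) \<noteq> 0 \<or>
      (j \<le> d - 1 \<and> x (cB (3 * j + 1)) \<noteq> 0) \<or> (1 \<le> j \<and> j \<le> d - 1 \<and> x (cU j) \<noteq> 0)"
  (is "?L \<longleftrightarrow> ?R")
proof
  assume ?L
  then obtain c where c: "c \<in> coords d" "qm_group c = j" "x c \<noteq> 0" by blast
  show ?R
  proof (cases c)
    case (cA i j') then show ?thesis using c by (auto simp: coords_def)
  next
    case (cU k) then show ?thesis using c by (auto simp: coords_def)
  next
    case (cB k)
    then have k: "k \<le> 3 * d" "(k + 1) div 3 = j" using c by (auto simp: coords_def)
    then have "(1 \<le> j \<and> k = 3 * j - 1) \<or> k = 3 * j \<or> (j \<le> d - 1 \<and> k = 3 * j + 1)"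
      using assms(1) by linarith
    then show ?thesis using c(3) cB by auto
  qed
next
  assume ?R
  moreover have "cB (3 * j - 1) \<in> coords d \<and> qm_group (cB (3 * j - 1)) = j" if "1 \<le> j"
    using j that by (auto simp: coords_def)
  moreover have "cB (3 * j) \<in> coords d \<and> qm_group (cB (3 * j)) = j"
    using j by (auto simp: coords_def)
  moreover have "cB (3 * j + 1) \<in> coords d \<and> qm_group (cB (3 * j + 1)) = j" if "j \<le> d - 1"
    using assms that group_B_simps(2)[of j] by (auto simp: coords_def)
  moreover have "cU j \<in> coords d \<and> qm_group (cU j) = j" if "1 \<le> j" "j \<le> d - 1"
    using that by (auto simp: coords_def)
  moreover have "cA i j \<in> coords d \<and> qm_group (cA i j) = j" if "i \<le> 2" for i
    using j that by (auto simp: coords_def)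
  ultimately show ?L by blast
qed

theorem theorem1p2:
  fixes d :: nat
  assumes "d \<ge> 1"
  shows "compact_toric_orbifold (Mp02 d)"
proof -
  interpret dominant_grading "coords d" d qm_group qm_weight "cA 0" "qm_height d"
    by (rule dominant_grading_qm[OF assms])
  have char1: "character l (\<lambda>j. a * of_bool (j = i)) = l i powi a" if "i \<le> d" for l a i
    unfolding character_def by (rule prod_powi_of_bool[OF that])
  have char_add: "character l (\<lambda>j. \<eta> j + \<eta>' j) = character l \<eta> * character l \<eta>'" if "l \<in> torus d" for l \<eta> \<eta>'
    unfolding character_def prod.distrib[symmetric]
    by (rule prod.cong) (use that in \<open>auto simp: torus_def power_int_add\<close>)
  have act_eq: "act l x = torus_act l x" if l: "l \<in> torus d" and x: "x \<in> stable_points" for l x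
  proof
    fix c
    show "act l x c = torus_act l x c"
    proof (cases "c \<in> coords d")
      case False
      then have "x c = 0" using x by (simp add: stable_points_def)
      then show ?thesis using False by (cases c) (simp_all add: act_def Let_def)
    next
      case True
      show ?thesis
      proof (cases c)
        case (cA i j)
        then have "j \<le> d" using True by (auto simp: coords_def)
        moreover have "qm_weight c = (\<lambda>l. 1 * of_bool (l = j))" by (auto simp: cA)
        ultimately have "character l (qm_weight c) = l j" by (simp only: char1 power_int_1_right)
        then show ?thesis using True cA by (simp add: act_def)
      next
        case (cB k)
        then have k: "k \<le> 3 * d" using True by (auto simp: coords_def)
        show ?thesis
        proof (cases k rule: B_cases)
          case (zero j)
          then have "j \<le> d" using k by simp
          moreover have "qm_weight c = (\<lambda>l. 3 * of_bool (l = j))"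
            unfolding cB zero by (intro ext weight_B_simps)
          ultimately have "character l (qm_weight c) = l j ^ 3" by (simp add: char1)
          then show ?thesis using True cB zero by (simp add: act_def)
        next
          case (one j)
          then have "j + 1 \<le> d" using k by simp
          moreover have "qm_weight c = (\<lambda>l. 2 * of_bool (l = j) + 1 * of_bool (l = j + 1))"
            unfolding cB one mult_1 by (intro ext weight_B_simps)
          moreover have "(3 * j + 1) mod 3 = 1" "(3 * j + 1) div 3 = j" by presburger+
          ultimately show ?thesis using True unfolding act_def
            by (simp only: char_add[OF l] char1 cB one torus_act.simps Let_def) simp
        next
          case (two j)
          then have "j + 1 \<le> d" using k by simp
          moreover have "qm_weight c = (\<lambda>l. 1 * of_bool (l = j) + 2 * of_bool (l = j + 1))"
            unfolding cB two mult_1 by (intro ext weight_B_simps)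
          moreover have "(3 * j + 2) mod 3 = 2" "(3 * j + 2) div 3 = j" by presburger+
          ultimately show ?thesis using True unfolding act_def
            by (simp only: char_add[OF l] char1 cB two torus_act.simps Let_def) simp
        qed
      next
        case (cU k)
        then have k: "1 \<le> k" "k + 1 \<le> d" using True assms by (auto simp: coords_def)
        have "qm_weight c = (\<lambda>j. ((-1) * of_bool (j = k - 1) + 2 * of_bool (j = k)) + (-1) * of_bool (j = k + 1))"
          using k by (auto simp: cU fun_eq_iff of_bool_def)
        then have "character l (qm_weight c) = inverse (l (k - 1)) * l k ^ 2 * inverse (l (k + 1))"
          using k by (simp only: char_add[OF l] char1) (simp add: power_int_minus)
        then show ?thesis using True cU by (simp add: act_def)
      qed
    qed
  qed
  have stable: "stable_points = qm_domain d"
  proof (intro set_eqI iffI)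
    fix x assume "x \<in> stable_points"
    then have x: "\<forall>c. c \<notin> coords d \<longrightarrow> x c = 0"
      and G: "\<And>j. j \<le> d \<Longrightarrow> \<exists>c\<in>coords d. qm_group c = j \<and> x c \<noteq> 0"
      by (auto simp: stable_points_def)
    show "x \<in> qm_domain d"
      unfolding qm_domain_def ambient_def mem_Collect_eq
    proof (intro conjI allI impI)
      show "x c = 0" if "c \<notin> coords d" for c using x that by blast
      show "(\<exists>i\<le>2. x (cA i 0) \<noteq> 0) \<or> x (cB 0) \<noteq> 0 \<or> x (cB 1) \<noteq> 0"
        using G[of 0] unfolding qm_group_nonzero_iff[OF assms le0] by simp
      show "(\<exists>i\<le>2. x (cA i d) \<noteq> 0) \<or> x (cB (3 * d - 1)) \<noteq> 0 \<or> x (cB (3 * d)) \<noteq> 0"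
      proof -
        have "\<not> d \<le> d - 1" using assms by simp
        then show ?thesis using G[of d] unfolding qm_group_nonzero_iff[OF assms order_refl] by blast
      qed
      fix j assume j: "1 \<le> j \<and> j \<le> d - 1"
      then have "j \<le> d" by linarith
      from G[OF this] show "(\<exists>i\<le>2. x (cA i j) \<noteq> 0) \<or> x (cB (3 * j - 1)) \<noteq> 0 \<or> x (cB (3 * j)) \<noteq> 0 \<or>
          x (cB (3 * j + 1)) \<noteq> 0 \<or> x (cU j) \<noteq> 0"
        unfolding qm_group_nonzero_iff[OF assms \<open>j \<le> d\<close>] by blast
    qed
  next
    fix x assume x: "x \<in> qm_domain d"
    have "\<exists>c\<in>coords d. qm_group c = j \<and> x c \<noteq> 0" if j: "j \<le> d" for j
    proof -
      consider "j = 0" | "1 \<le> j" "j \<le> d - 1" | "j = d" using j assms by linarith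
      then show ?thesis
      proof cases
        case 1
        then show ?thesis using x unfolding qm_group_nonzero_iff[OF assms j] by (simp add: qm_domain_def)
      next
        case 2
        then show ?thesis using x unfolding qm_group_nonzero_iff[OF assms j] by (simp add: qm_domain_def)
      next
        case 3
        then show ?thesis using x assms unfolding qm_group_nonzero_iff[OF assms j] by (simp add: qm_domain_def) blast
      qed
    qed
    then show "x \<in> stable_points" using x by (auto simp: stable_points_def qm_domain_def ambient_def)
  qed
  have space: "qm_open d = stable_space"
    by (simp add: qm_open_def stable_space_def coord_algebra_def stable)
  have orbit: "torus_orbit d x = torus_orbit d y \<longleftrightarrow> (\<exists>l\<in>torus d. y = act l x)"
    if x: "x \<in> stable_points" and y: "y \<in> stable_points" for x y
  proof -
    have orb: "torus_orbit d z = {y \<in> stable_points. toric_point z = toric_point y}" if z: "z \<in> stable_points" for z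
      unfolding torus_orbit_def using toric_point_eq_iff[OF z] act_eq[OF _ z] act_stable[OF _ z]
      by (intro subset_antisym subsetI) (auto, metis+)
    show ?thesis using x y unfolding orb[OF x] orb[OF y] toric_point_eq_iff[OF x y, symmetric] by blast
  qed
  show ?thesis
    unfolding Mp02_def space by (rule torus_quotient_toric_orbifold[OF orbit])
qed

end
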